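(* The matrix $q(\lambda)=(q_{lm}(\lambda))_{l,m=1,\dots,n}$ satisfying $$\bigl(E(a,b)f\bigr)(x)=\int_a^b\sum_{l,m=1}^n q_{lm}(\lambda)\,F_\lambda^{-,l}(x)\int_N\overline{F_\lambda^{-,m}}(x')\,f(x')\,dx'\,d\lambda$$ (for all $a_1\le a<b<+\infty$, all $f\in H$ with compact support and all $x\in N$) is given by $$q(\lambda)=(D(\lambda)^{-1})^T\,\operatorname{Im}\Bigl(\frac1{w(\lambda)}\sum_{j=1}^n e_j\,d_j(\lambda)^T e_{j+1}\,e_j^T D(\lambda)\Bigr)\,\overline{D(\lambda)}^{\,-1} =(D(\lambda)^{-1})^T\,\operatorname{Im}\Bigl(\frac{-i}{w(\lambda)}\,C(\lambda)D(\lambda)\Bigr)\,\overline{D(\lambda)}^{\,-1}$$ for almost all $\lambda>a_1$, where $j$ is understood modulo $n$ ($j+1=1$ if $j=n$).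
   Context: Let $n\ge 2$, $c_1,\dots,c_n>0$ and $0\le a_1\le a_2\le\dots\le a_n<+\infty$. Let $N_1,\dots,N_n$ be $n$ disjoint copies of $(0,+\infty)$ and let $N=\bigcup_{k=1}^n\overline{N_k}$ with the endpoints $0$ of all branches identified (star-shaped network). A function $f$ on $N$ is identified with the tuple $(f_1,\dots,f_n)$ of its restrictions to the branches, and $\int_N$ denotes the sum of the integrals over the $N_k$, $k=1,\dots,n$. Transmission conditions for $(u_k)_{k=1}^n$: $(T_0)$: $u_k\in C^0(\overline{N_k})$ and $u_i(0)=u_k(0)$ for all $i,k$; $(T_1)$: $u_k\in C^1(\overline{N_k})$ and $\sum_{k=1}^n c_k u_k'(0^+)=0$. $H=\prod_{k=1}^n L^2(N_k)$ (complex-valued functions) with $(u,v)_H=\sum_k(u_k,v_k)_{L^2(N_k)}$. The operator $A:D(A)\to H$ is $A(u_k)_k=(-c_k u_k''+a_k u_k)_k$ with $D(A)=\{(u_k)\in\prod_k H^2(N_k): (T_0)\text{ and }(T_1)\text{ hold}\}$. It is self-adjoint; $E(a,b)=\mathbf 1_{(a,b)}(A)$ is its resolution of the identity. A matrix $q(\lambda)$ with the stated property exists and is unique up to a null set of $\lambda$. The complex square root is $\sqrt{re^{i\phi}}=\sqrt r\,e^{i\phi/2}$ for $r>0$, $\phi\in[-\pi,\pi)$. For $\lambda\in\mathbb C$: $\xi_k(\lambda)=\sqrt{(\lambda-a_k)/c_k}$, $s_k(\lambda)=-\dfrac{\sum_{l\ne k}c_l\xi_l(\lambda)}{c_k\xi_k(\lambda)}$.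 The functions $F_\lambda^{-,j}:N\to\mathbb C$ are given on $\overline{N_k}$ by $F_{\lambda,k}^{-,j}$, where $F_{\lambda,j}^{-,j}(x)=\cos(\xi_j(\lambda)x)-i\,s_j(\lambda)\sin(\xi_j(\lambda)x)$ and $F_{\lambda,k}^{-,j}(x)=\exp(-i\xi_k(\lambda)x)$ for $k\ne j$. For real $\lambda$, $w(\lambda)=-i\sum_{j=1}^n c_j\xi_j(\lambda)$. Put $F_\lambda(x)=(F_\lambda^{-,1}(x),\dots,F_\lambda^{-,n}(x))^T\in\mathbb C^n$, let $e_k$ be the $k$-th unit vector of $\mathbb C^n$, set $d_1(\lambda)=F_\lambda(0)=(1,\dots,1)^T$, and for $j=2,\dots,n$ fix a point $x_j\in N_j$ (so $x_j\neq 0$) and set $d_j(\lambda)=F_\lambda(x_j)$. Then $d_j(\lambda)=\beta_je_j+\alpha_j\sum_{k\ne j}e_k$ with $\alpha_j=e^{-i\xi_j(\lambda)x_j}$ and $\beta_j=F_{\lambda,j}^{-,j}(x_j)$. Let $D(\lambda)=\sum_{j=1}^n d_j(\lambda)e_j^T$ (the matrix with columns $d_1,\dots,d_n$; $\det D=\prod_{j=2}^n(\beta_j-\alpha_j)$, so $D$ is invertible when $\alpha_j\ne\beta_j$ for $j=2,\dots,n$), and let $C(\lambda)$ be the diagonal matrix with diagonal entries $i$ in position $(1,1)$ and $i\alpha_j$ in position $(j,j)$ for $j=2,\dots,n$. $\operatorname{Im}$ of a matrix and the complex conjugate $\overline{D}$ are taken entrywise.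
   Formalization: Both printed expressions for q(λ) are multiplied by 1/π: for n=2, c_1=c_2=1, a_1=a_2=0 Fourier inversion gives q=I/(4π√λ), whereas the printed formula gives I/(4√λ). *)

theory Defs
  imports "HOL-Analysis.Analysis"
begin

section \<open>The star-shaped network and its Hilbert space\<close>

text \<open>
  The branches are indexed by a finite linearly ordered type \<open>'n\<close>; the least element
  plays the role of the index 1. A function on the network is \<open>f :: 'n \<Rightarrow> real \<Rightarrow> complex\<close>, where
  \<open>f k x\<close> is the value at the point \<open>x \<ge> 0\<close> of the closed branch \<open>k\<close>; values at
  \<open>x < 0\<close> are irrelevant.
\<close>

definition first :: "'n::{finite,linorder}" where
  "first = Min UNIV"

definition cyclic_next :: "'n::{finite,linorder} \<Rightarrow> 'n" where
  "cyclic_next j = (if j = Max UNIV then Min UNIV else Min {k. j < k})"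

abbreviation branch :: "real measure" where
  "branch \<equiv> lebesgue_on {0<..}"

text \<open>
  Elements of \<open>L\<^sup>2\<close> and of \<open>H\<close> are handled through representatives;
  equality in \<open>H\<close> is the relation \<open>eq_H\<close>.
\<close>

definition L2_branch :: "(real \<Rightarrow> complex) set" where
  "L2_branch = {u. u \<in> borel_measurable branch \<and> integrable branch (\<lambda>x. (cmod (u x))\<^sup>2)}"

definition space_H :: "('n \<Rightarrow> real \<Rightarrow> complex) set" where
  "space_H = {f. \<forall>k. f k \<in> L2_branch}"

definition eq_H :: "('n \<Rightarrow> real \<Rightarrow> complex) \<Rightarrow> ('n \<Rightarrow> real \<Rightarrow> complex) \<Rightarrow> bool" where
  "eq_H f g \<longleftrightarrow> (\<forall>k. AE x in branch. f k x = g k x)"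

definition inner_H :: "('n::finite \<Rightarrow> real \<Rightarrow> complex) \<Rightarrow> ('n \<Rightarrow> real \<Rightarrow> complex) \<Rightarrow> complex" where
  "inner_H f g = (\<Sum>k\<in>UNIV. LINT x|branch. f k x * cnj (g k x))"

definition norm_H :: "('n::finite \<Rightarrow> real \<Rightarrow> complex) \<Rightarrow> real" where
  "norm_H f = sqrt (Re (inner_H f f))"

definition compact_support :: "('n \<Rightarrow> real \<Rightarrow> complex) \<Rightarrow> bool" where
  "compact_support f \<longleftrightarrow> (\<exists>R. \<forall>k. AE x in branch. R < x \<longrightarrow> f k x = 0)"

section \<open>The operator\<close>

definition test_function :: "(real \<Rightarrow> real) \<Rightarrow> bool" where
  "test_function \<phi> \<longleftrightarrow> (\<forall>m x. (deriv ^^ m) \<phi> field_differentiable at x) \<and>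
     (\<exists>r s. 0 < r \<and> (\<forall>x. x \<notin> {r..s} \<longrightarrow> \<phi> x = 0))"

definition weak_derivative :: "(real \<Rightarrow> complex) \<Rightarrow> (real \<Rightarrow> complex) \<Rightarrow> bool" where
  "weak_derivative u v \<longleftrightarrow> (\<forall>\<phi>. test_function \<phi> \<longrightarrow>
     (LINT x|branch. u x * of_real (deriv \<phi> x)) = - (LINT x|branch. v x * of_real (\<phi> x)))"

text \<open>The \<open>L\<^sup>2\<close> weak derivative; it is unique up to null sets.\<close>

definition wderiv :: "(real \<Rightarrow> complex) \<Rightarrow> real \<Rightarrow> complex" where
  "wderiv u = (SOME v. v \<in> L2_branch \<and> weak_derivative u v)"

definition sobolev_H2 :: "(real \<Rightarrow> complex) set" where
  "sobolev_H2 = {u \<in> L2_branch. \<exists>v\<in>L2_branch. weak_derivative u v \<and>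
     (\<exists>w\<in>L2_branch. weak_derivative v w)}"

definition transmission0 :: "('n \<Rightarrow> real \<Rightarrow> complex) \<Rightarrow> bool" where
  "transmission0 u \<longleftrightarrow> (\<forall>k. continuous_on {0..} (u k)) \<and> (\<forall>i k. u i 0 = u k 0)"

text \<open>The derivative at 0 within \<open>{0..}\<close> is the one-sided derivative.\<close>

definition transmission1 :: "('n::finite \<Rightarrow> real) \<Rightarrow> ('n \<Rightarrow> real \<Rightarrow> complex) \<Rightarrow> bool" where
  "transmission1 c u \<longleftrightarrow> (\<exists>u'.
     (\<forall>k. continuous_on {0..} (u' k) \<and>
          (\<forall>x\<ge>0. (u k has_vector_derivative u' k x) (at x within {0..}))) \<and>
     (\<Sum>k\<in>UNIV. of_real (c k) * u' k 0) = 0)"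

text \<open>
  The domain consists of the continuously differentiable representatives (on the closed branches)
  of the classes belonging to \<open>D(A)\<close>.
\<close>

definition dom_A :: "('n::finite \<Rightarrow> real) \<Rightarrow> ('n \<Rightarrow> real \<Rightarrow> complex) set" where
  "dom_A c = {u. (\<forall>k. u k \<in> sobolev_H2) \<and> transmission0 u \<and> transmission1 c u}"

definition op_A :: "('n \<Rightarrow> real) \<Rightarrow> ('n \<Rightarrow> real) \<Rightarrow>
    ('n \<Rightarrow> real \<Rightarrow> complex) \<Rightarrow> 'n \<Rightarrow> real \<Rightarrow> complex" where
  "op_A c a u k x = - of_real (c k) * wderiv (wderiv (u k)) x + of_real (a k) * u k x"

section \<open>Resolution of the identity\<close>

text \<open>
  \<open>E B\<close> is the spectral projection of the Borel set \<open>B\<close>, so that \<open>E(a,b)\<close> is \<open>E {a<..<b}\<close>.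
\<close>

definition projection_valued_measure ::
    "(real set \<Rightarrow> ('n::finite \<Rightarrow> real \<Rightarrow> complex) \<Rightarrow> 'n \<Rightarrow> real \<Rightarrow> complex) \<Rightarrow> bool" where
  "projection_valued_measure E \<longleftrightarrow>
     (\<forall>B\<in>sets borel.
        (\<forall>f\<in>space_H. E B f \<in> space_H) \<and>
        (\<forall>f\<in>space_H. \<forall>g\<in>space_H. eq_H f g \<longrightarrow> eq_H (E B f) (E B g)) \<and>
        (\<forall>f\<in>space_H. \<forall>g\<in>space_H. \<forall>z.
           eq_H (E B (\<lambda>k x. z * f k x + g k x)) (\<lambda>k x. z * E B f k x + E B g k x)) \<and>
        (\<forall>f\<in>space_H. eq_H (E B (E B f)) (E B f)) \<and>
        (\<forall>f\<in>space_H. \<forall>g\<in>space_H. inner_H (E B f) g = inner_H f (E B g))) \<and>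
     (\<forall>f\<in>space_H. eq_H (E UNIV f) f) \<and>
     (\<forall>B::nat \<Rightarrow> real set. range B \<subseteq> sets borel \<longrightarrow> disjoint_family B \<longrightarrow>
        (\<forall>f\<in>space_H.
           (\<lambda>m. norm_H (\<lambda>k x. E (\<Union>i. B i) f k x - (\<Sum>i<m. E (B i) f k x)))
             \<longlonglongrightarrow> 0))"

definition spectral_measure ::
    "(real set \<Rightarrow> ('n::finite \<Rightarrow> real \<Rightarrow> complex) \<Rightarrow> 'n \<Rightarrow> real \<Rightarrow> complex) \<Rightarrow>
     ('n \<Rightarrow> real \<Rightarrow> complex) \<Rightarrow> real measure" where
  "spectral_measure E f = measure_of UNIV (sets borel) (\<lambda>B. ennreal (Re (inner_H (E B f) f)))"

text \<open>
  \<open>T = \<integral> t dE(t)\<close> as an unbounded operator with domain \<open>Dom\<close>: a vector \<open>f\<close> is in the domain iff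
  \<open>\<integral> t\<^sup>2 d(E(t)f,f)\<close> is finite, and \<open>(Tu,u) = \<integral> t d(E(t)u,u)\<close> there, which
  determines \<open>T\<close> by polarization.
\<close>

definition resolution_of_identity ::
    "('n::finite \<Rightarrow> real \<Rightarrow> complex) set \<Rightarrow>
     (('n \<Rightarrow> real \<Rightarrow> complex) \<Rightarrow> 'n \<Rightarrow> real \<Rightarrow> complex) \<Rightarrow>
     (real set \<Rightarrow> ('n \<Rightarrow> real \<Rightarrow> complex) \<Rightarrow> 'n \<Rightarrow> real \<Rightarrow> complex) \<Rightarrow> bool" where
  "resolution_of_identity Dom T E \<longleftrightarrow> projection_valued_measure E \<and>
     (\<forall>f\<in>space_H. (\<exists>u\<in>Dom. eq_H f u) \<longleftrightarrow> integrable (spectral_measure E f) (\<lambda>t. t\<^sup>2)) \<and>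
     (\<forall>u\<in>Dom. inner_H (T u) u = of_real (LINT t|spectral_measure E u. t))"

section \<open>Generalized eigenfunctions\<close>

text \<open>
  The square root with argument in \<open>[-\<pi>,\<pi>)\<close>; it differs from \<open>csqrt\<close> on the negative reals.
\<close>

definition lower_sqrt :: "complex \<Rightarrow> complex" where
  "lower_sqrt z = cnj (csqrt (cnj z))"

lemma lower_sqrt_polar:
  assumes "0 < r" "-pi \<le> t" "t < pi"
  shows "lower_sqrt (of_real r * cis t) = of_real (sqrt r) * cis (t / 2)"
proof -
  have "csqrt (of_real r * cis (- t)) = of_real (sqrt r) * cis (- t / 2)"
  proof (rule csqrt_unique)
    have "(cis (- t / 2))\<^sup>2 = cis (- t)"
      by (simp add: power2_eq_square cis_mult)
    moreover have "(complex_of_real (sqrt r))\<^sup>2 = of_real r"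
      using assms(1) by (metis less_imp_le of_real_power real_sqrt_pow2)
    ultimately show "(of_real (sqrt r) * cis (- t / 2))\<^sup>2 = of_real r * cis (- t)"
      by (simp add: power_mult_distrib)
    show "0 < Re (of_real (sqrt r) * cis (- t / 2)) \<or>
          Re (of_real (sqrt r) * cis (- t / 2)) = 0 \<and> 0 \<le> Im (of_real (sqrt r) * cis (- t / 2))"
    proof (cases "t = - pi")
      case True
      then show ?thesis using assms(1) by simp
    next
      case False
      then have "0 < cos (- t / 2)"
        using assms by (intro cos_gt_zero_pi) auto
      then show ?thesis using assms(1) by simp
    qed
  qed
  then show ?thesis
    by (simp add: lower_sqrt_def cis_cnj)
qed

definition xi :: "('n \<Rightarrow> real) \<Rightarrow> ('n \<Rightarrow> real) \<Rightarrow> 'n \<Rightarrow> complex \<Rightarrow> complex" where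
  "xi c a k z = lower_sqrt ((z - of_real (a k)) / of_real (c k))"

definition s_coeff :: "('n::finite \<Rightarrow> real) \<Rightarrow> ('n \<Rightarrow> real) \<Rightarrow> 'n \<Rightarrow> complex \<Rightarrow> complex" where
  "s_coeff c a k z = - (\<Sum>l\<in>UNIV - {k}. of_real (c l) * xi c a l z) / (of_real (c k) * xi c a k z)"

text \<open>\<open>F c a j z k x\<close> is the function with upper index \<open>-,j\<close> at the point \<open>x\<close> of branch \<open>k\<close>.\<close>

definition F :: "('n::finite \<Rightarrow> real) \<Rightarrow> ('n \<Rightarrow> real) \<Rightarrow> 'n \<Rightarrow> complex \<Rightarrow> 'n \<Rightarrow> real \<Rightarrow> complex" where
  "F c a j z k x =
     (if k = j then cos (xi c a j z * of_real x) - \<i> * s_coeff c a j z * sin (xi c a j z * of_real x)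
      else exp (- \<i> * xi c a k z * of_real x))"

definition w :: "('n::finite \<Rightarrow> real) \<Rightarrow> ('n \<Rightarrow> real) \<Rightarrow> real \<Rightarrow> complex" where
  "w c a t = - \<i> * (\<Sum>j\<in>UNIV. of_real (c j) * xi c a j (of_real t))"

section \<open>The matrices\<close>

text \<open>In the following, \<open>p j\<close> is the point chosen on branch \<open>j \<noteq> first\<close>; \<open>p first\<close> is unused.\<close>

definition d_vec :: "('n::{finite,linorder} \<Rightarrow> real) \<Rightarrow> ('n \<Rightarrow> real) \<Rightarrow> ('n \<Rightarrow> real) \<Rightarrow> 'n \<Rightarrow> real \<Rightarrow>
    (complex, 'n) vec" where
  "d_vec c a p j t = (\<chi> l. F c a l (of_real t) j (if j = first then 0 else p j))"

definition alpha :: "('n \<Rightarrow> real) \<Rightarrow> ('n \<Rightarrow> real) \<Rightarrow> ('n \<Rightarrow> real) \<Rightarrow> 'n \<Rightarrow> real \<Rightarrow> complex" where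
  "alpha c a p j t = exp (- \<i> * xi c a j (of_real t) * of_real (p j))"

definition D_mat :: "('n::{finite,linorder} \<Rightarrow> real) \<Rightarrow> ('n \<Rightarrow> real) \<Rightarrow> ('n \<Rightarrow> real) \<Rightarrow> real \<Rightarrow>
    ((complex, 'n) vec, 'n) vec" where
  "D_mat c a p t = (\<Sum>j\<in>UNIV. (columnvector (d_vec c a p j t) :: ((complex, 1) vec, 'n) vec) ** rowvector (axis j 1))"

definition C_mat :: "('n::{finite,linorder} \<Rightarrow> real) \<Rightarrow> ('n \<Rightarrow> real) \<Rightarrow> ('n \<Rightarrow> real) \<Rightarrow> real \<Rightarrow>
    ((complex, 'n) vec, 'n) vec" where
  "C_mat c a p t = (\<chi> i j. if i = j then (if j = first then \<i> else \<i> * alpha c a p j t) else 0)"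

definition Im_mat :: "complex^'n^'m \<Rightarrow> complex^'n^'m" where
  "Im_mat = map_matrix (\<lambda>z. of_real (Im z))"

definition cnj_mat :: "complex^'n^'m \<Rightarrow> complex^'n^'m" where
  "cnj_mat = map_matrix cnj"

definition smult_mat :: "complex \<Rightarrow> complex^'n^'m \<Rightarrow> complex^'n^'m" where
  "smult_mat z = map_matrix ((*) z)"

section \<open>The expansion property\<close>

definition coefficient :: "('n::finite \<Rightarrow> real) \<Rightarrow> ('n \<Rightarrow> real) \<Rightarrow> 'n \<Rightarrow> real \<Rightarrow>
    ('n \<Rightarrow> real \<Rightarrow> complex) \<Rightarrow> complex" where
  "coefficient c a m t f = (\<Sum>k\<in>UNIV. LINT y|branch. cnj (F c a m (of_real t) k y) * f k y)"

text \<open>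
  Pointwise values of the class \<open>E(a,b) f\<close> are those of its representative
  that is continuous on the closed branches. By Stone's formula a matrix \<open>q\<close> with this property
  carries a factor \<open>1 / pi\<close>: for two branches with \<open>c = 1\<close>, \<open>a = 0\<close> it must be the Fourier
  inversion formula on the line, so that \<open>q\<close> is \<open>1 / (4 * pi * sqrt t)\<close> times the unit matrix.
\<close>

definition expansion_matrix :: "('n::{finite,linorder} \<Rightarrow> real) \<Rightarrow> ('n \<Rightarrow> real) \<Rightarrow>
    (real set \<Rightarrow> ('n \<Rightarrow> real \<Rightarrow> complex) \<Rightarrow> 'n \<Rightarrow> real \<Rightarrow> complex) \<Rightarrow>
    (real \<Rightarrow> ((complex, 'n) vec, 'n) vec) \<Rightarrow> bool" where
  "expansion_matrix c a E q \<longleftrightarrow>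
     (\<forall>s r f. a first \<le> s \<longrightarrow> s < r \<longrightarrow> f \<in> space_H \<longrightarrow> compact_support f \<longrightarrow>
       (\<exists>g. eq_H g (E {s<..<r} f) \<and> (\<forall>k. continuous_on {0..} (g k)) \<and>
         (\<forall>k. \<forall>x\<ge>0.
            set_integrable lebesgue {s<..<r}
              (\<lambda>t. \<Sum>l\<in>UNIV. \<Sum>m\<in>UNIV. q t $ l $ m * F c a l (of_real t) k x * coefficient c a m t f) \<and>
            g k x = set_lebesgue_integral lebesgue {s<..<r}
              (\<lambda>t. \<Sum>l\<in>UNIV. \<Sum>m\<in>UNIV. q t $ l $ m * F c a l (of_real t) k x * coefficient c a m t f))))"

end

theory Submission
  imports Defs
begin

text \<open>
  The resolvent \<open>(z - A)\<inverse>\<close>, \<open>Im z < 0\<close>, has an explicit symmetric kernel built from the functions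
  \<open>F\<close>, divided by \<open>w\<close>; it extends continuously to the real axis away from the points \<open>a k\<close>. Stone's formula
  therefore turns \<open>(E(s,r) f, g)\<close> into \<open>1/\<pi>\<close> times the integral over \<open>(s,r)\<close> of the imaginary part of the
  kernel tested against \<open>f\<close> and \<open>g\<close>. Taking indicators of intervals \<open>(0,b]\<close> on single branches for
  \<open>f\<close> and \<open>g\<close>, comparing with the expansion and differentiating in the end points gives, for almost all \<open>t\<close>,
  the pointwise identity \<open>\<Sum> q l m * F l (x) * cnj (F m (y)) = Im K (x,y) / \<pi>\<close>. At the chosen points this reads
  \<open>D\<^sup>T q (cnj D) = Im K / \<pi>\<close>, and \<open>D\<close> is invertible except for countably many \<open>t\<close>.

  The spectral measures only enter through the quadratic form: no complex measures are used.
\<close>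

section \<open>The semi-inner product on representatives\<close>

text \<open>Besides the axioms of a projection-valued measure, the hypothesis on \<open>E\<close>
  gives only the domain of the operator and its quadratic form; there is no functional calculus. The
  bridge is an identity: if \<open>(z - A) u = f\<close>, the integral of
  \<open>1 / |z - t|^2\<close> against the spectral measure of \<open>f\<close> is the square norm
  of \<open>u\<close>. It is proved by cutting the line into short cells, on which \<open>A\<close>
  is nearly a scalar. Since \<open>Im (u, f)\<close> is \<open>- Im z\<close> times that square
  norm, at \<open>z = t - i e\<close> the Poisson integral of the spectral measure is
  \<open>Im (u, f)\<close>, which the kernel makes explicit. The factor \<open>1/pi\<close> reflects
  the total mass \<open>pi\<close> of the Poisson kernel. Indicators of intervals serve as data
  because their resolvents are elementary functions whose membership in the domain can be checked by
  hand, and because they still determine a continuous kernel. The second obstacle is the exceptional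
  null set of \<open>t\<close>: it depends on the interval, the end point and the branches. Hence
  only rational data are collected, one variable is frozen at the chosen points, and the other is
  recovered by continuity.\<close>

abbreviation comb :: "complex \<Rightarrow> ('n \<Rightarrow> real \<Rightarrow> complex) \<Rightarrow> ('n \<Rightarrow> real \<Rightarrow> complex) \<Rightarrow> 'n \<Rightarrow> real \<Rightarrow> complex" where
  "comb z f g \<equiv> (\<lambda>k x. z * f k x + g k x)"

lemma L2_branchD:
  assumes "f \<in> L2_branch"
  shows "f \<in> borel_measurable branch" "integrable branch (\<lambda>x. (cmod (f x))\<^sup>2)"
  using assms by (auto simp: L2_branch_def)

lemma L2_mult_integrable:
  assumes "f \<in> L2_branch" "g \<in> L2_branch"
  shows "integrable branch (\<lambda>x. f x * cnj (g x))"
proof (rule Bochner_Integration.integrable_bound)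
  show "integrable branch (\<lambda>x. (cmod (f x))\<^sup>2 + (cmod (g x))\<^sup>2)"
    using assms by (auto dest: L2_branchD)
  show "(\<lambda>x. f x * cnj (g x)) \<in> borel_measurable branch"
  proof (rule borel_measurable_times)
    show "f \<in> borel_measurable branch" by (rule L2_branchD(1)[OF assms(1)])
    show "(\<lambda>x. cnj (g x)) \<in> borel_measurable branch"
      by (rule measurable_compose[OF L2_branchD(1)[OF assms(2)]])
        (intro borel_measurable_continuous_onI continuous_intros)
  qed
  have "p * q \<le> p\<^sup>2 + q\<^sup>2" if "0 \<le> p" "0 \<le> q" for p q :: real
    using that sum_squares_bound[of p q] mult_nonneg_nonneg[OF that] by linarith
  then show "AE x in branch. norm (f x * cnj (g x)) \<le> norm ((cmod (f x))\<^sup>2 + (cmod (g x))\<^sup>2)"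
    by (auto simp: norm_mult)
qed

lemma L2_branch_comb:
  assumes "f \<in> L2_branch" "g \<in> L2_branch"
  shows "(\<lambda>x. z * f x + g x) \<in> L2_branch"
proof -
  have m: "(\<lambda>x. z * f x + g x) \<in> borel_measurable branch"
    using assms by (auto dest!: L2_branchD(1))
  have "integrable branch (\<lambda>x. (cmod (z * f x + g x))\<^sup>2)"
  proof (rule Bochner_Integration.integrable_bound)
    show "integrable branch (\<lambda>x. 2 * (cmod z)\<^sup>2 * (cmod (f x))\<^sup>2 + 2 * (cmod (g x))\<^sup>2)"
      using L2_branchD(2)[OF assms(1)] L2_branchD(2)[OF assms(2)]
      by (intro Bochner_Integration.integrable_add integrable_mult_right) auto
    show "(\<lambda>x. (cmod (z * f x + g x))\<^sup>2) \<in> borel_measurable branch" using m by measurable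
    have "(cmod (u + v))\<^sup>2 \<le> 2 * (cmod u)\<^sup>2 + 2 * (cmod v)\<^sup>2" for u v
    proof -
      have "(cmod (u + v))\<^sup>2 \<le> (cmod u + cmod v)\<^sup>2"
        by (intro power_mono norm_triangle_ineq) auto
      also have "\<dots> \<le> 2 * (cmod u)\<^sup>2 + 2 * (cmod v)\<^sup>2"
        using sum_squares_bound[of "cmod u" "cmod v"] by (simp add: power2_sum)
      finally show ?thesis .
    qed
    from this[of "z * f _" "g _"]
    show "AE x in branch. norm ((cmod (z * f x + g x))\<^sup>2)
        \<le> norm (2 * (cmod z)\<^sup>2 * (cmod (f x))\<^sup>2 + 2 * (cmod (g x))\<^sup>2)"
      by (auto simp: norm_mult power_mult_distrib mult.assoc)
  qed
  with m show ?thesis by (simp add: L2_branch_def)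
qed

lemma L2_branch_zero: "(\<lambda>x. 0) \<in> L2_branch"
  by (simp add: L2_branch_def)

lemma L2_branch_scale: "f \<in> L2_branch \<Longrightarrow> (\<lambda>x. z * f x) \<in> L2_branch"
  using L2_branch_comb[OF _ L2_branch_zero, of f z] by simp

lemma space_H_comb: "f \<in> space_H \<Longrightarrow> g \<in> space_H \<Longrightarrow> comb z f g \<in> space_H"
  by (auto simp: space_H_def intro!: L2_branch_comb)

lemma space_H_L2: "f \<in> space_H \<Longrightarrow> f k \<in> L2_branch"
  by (auto simp: space_H_def)

lemma inner_H_comb_left:
  assumes "f \<in> space_H" "g \<in> space_H" "h \<in> space_H"
  shows "inner_H (comb z f g) h = z * inner_H f h + inner_H g h"
proof -
  have "(LINT x|branch. (z * f k x + g k x) * cnj (h k x)) =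
     z * (LINT x|branch. f k x * cnj (h k x)) + (LINT x|branch. g k x * cnj (h k x))" for k
    using assms by (simp add: distrib_right mult.assoc L2_mult_integrable space_H_L2)
  then show ?thesis
    by (simp add: inner_H_def sum.distrib sum_distrib_left)
qed

lemma inner_H_commute: "inner_H f g = cnj (inner_H g f)"
proof -
  have *: "(LINT x|branch. f k x * cnj (g k x)) = cnj (LINT x|branch. g k x * cnj (f k x))" for k
    unfolding Bochner_Integration.integral_cnj[symmetric] by (simp add: mult.commute)
  show ?thesis unfolding inner_H_def cnj_sum by (intro sum.cong refl *)
qed

lemma inner_H_comb_right:
  assumes "f \<in> space_H" "g \<in> space_H" "h \<in> space_H"
  shows "inner_H h (comb z f g) = cnj z * inner_H h f + inner_H h g"
  using inner_H_comb_left[OF assms, of z]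
  by (metis inner_H_commute complex_cnj_add complex_cnj_mult complex_cnj_cnj)

lemma inner_H_cong:
  assumes "eq_H f f'" "f \<in> space_H" "f' \<in> space_H" "g \<in> space_H"
  shows "inner_H f g = inner_H f' g"
  unfolding inner_H_def
proof (rule sum.cong[OF refl], rule integral_cong_AE)
  fix k
  show "(\<lambda>x. f k x * cnj (g k x)) \<in> borel_measurable branch"
       "(\<lambda>x. f' k x * cnj (g k x)) \<in> borel_measurable branch"
    using assms by (auto intro!: borel_measurable_integrable L2_mult_integrable space_H_L2)
  show "AE x in branch. f k x * cnj (g k x) = f' k x * cnj (g k x)"
    using assms(1) unfolding eq_H_def by (elim allE[of _ k]) auto
qed

lemma inner_H_self: "inner_H f f = of_real (Re (inner_H f f))" "0 \<le> Re (inner_H f f)"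
proof -
  have "inner_H f f = of_real (\<Sum>k\<in>UNIV. LINT x|branch. (cmod (f k x))\<^sup>2)"
    by (simp add: inner_H_def complex_norm_square[symmetric] del: of_real_power)
  moreover have "0 \<le> (\<Sum>k\<in>UNIV. LINT x|branch. (cmod (f k x))\<^sup>2)"
    by (intro sum_nonneg Bochner_Integration.integral_nonneg) auto
  ultimately show "inner_H f f = of_real (Re (inner_H f f))" "0 \<le> Re (inner_H f f)"
    by simp_all
qed

lemma inner_H_comb_self:
  assumes "f \<in> space_H" "g \<in> space_H"
  shows "Re (inner_H (comb z f g) (comb z f g)) =
    (cmod z)\<^sup>2 * Re (inner_H f f) + 2 * Re (z * inner_H f g) + Re (inner_H g g)"
proof -
  have "inner_H (comb z f g) (comb z f g) =
     z * (cnj z * inner_H f f + inner_H f g) + (cnj z * inner_H g f + inner_H g g)"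
    using assms by (simp add: inner_H_comb_left inner_H_comb_right space_H_comb)
  also have "inner_H g f = cnj (inner_H f g)" by (rule inner_H_commute)
  finally have "inner_H (comb z f g) (comb z f g) =
     (z * cnj z) * inner_H f f + (z * inner_H f g + cnj (z * inner_H f g)) + inner_H g g"
    by (simp add: algebra_simps)
  moreover have "z * cnj z = of_real ((cmod z)\<^sup>2)" by (simp only: complex_norm_square)
  ultimately have "inner_H (comb z f g) (comb z f g) =
     of_real ((cmod z)\<^sup>2) * inner_H f f + (z * inner_H f g + cnj (z * inner_H f g)) + inner_H g g"
    by metis
  then show ?thesis by (simp del: of_real_power)
qed

lemma inner_H_Cauchy_Schwarz:
  assumes "f \<in> space_H" "g \<in> space_H"
  shows "(cmod (inner_H f g))\<^sup>2 \<le> Re (inner_H f f) * Re (inner_H g g)"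
proof -
  let ?m = "(cmod (inner_H f g))\<^sup>2"
  have q: "0 \<le> t\<^sup>2 * ?m * Re (inner_H f f) + 2 * t * ?m + Re (inner_H g g)" for t :: real
  proof -
    \<comment> \<open>This \<open>z\<close> makes \<open>z * inner_H f g\<close> real, so that the
      square norm of \<open>comb z f g\<close> is a real quadratic polynomial in
      \<open>t\<close>.\<close>
    define z where "z = of_real t * cnj (inner_H f g)"
    have "z * inner_H f g = of_real (t * ?m)"
      by (simp add: z_def mult.assoc mult.commute[of "cnj _"] complex_norm_square del: of_real_power)
    moreover have "(cmod z)\<^sup>2 = t\<^sup>2 * ?m"
      by (simp add: z_def norm_mult power_mult_distrib)
    ultimately show ?thesis
      using inner_H_self(2)[of "comb z f g"] inner_H_comb_self[OF assms, of z]
      by (simp add: mult.assoc del: of_real_mult of_real_power)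
  qed
  \<comment> \<open>If \<open>f\<close> is a null vector the polynomial is affine and its slope must
    vanish; otherwise it is evaluated at its minimiser.\<close>
  show ?thesis
  proof (cases "Re (inner_H f f) = 0")
    case True
    have "?m = 0"
    proof (rule ccontr)
      assume m: "?m \<noteq> 0"
      have "2 * (- (Re (inner_H g g) + 1) / ?m) * ?m = - 2 * (Re (inner_H g g) + 1)"
        using m by simp
      with q[of "- (Re (inner_H g g) + 1) / ?m"] inner_H_self(2)[of g] True show False
        by simp
    qed
    with True show ?thesis by simp
  next
    case False
    then have p: "0 < Re (inner_H f f)" using inner_H_self(2)[of f] by simp
    from q[of "- 1 / Re (inner_H f f)"] p show ?thesis
      by (simp add: field_simps power2_eq_square)
  qed
qed

lemma inner_H_null:
  assumes "f \<in> space_H" "g \<in> space_H" "Re (inner_H f f) = 0"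
  shows "inner_H f g = 0" "inner_H g f = 0"
proof -
  show "inner_H f g = 0" using inner_H_Cauchy_Schwarz[OF assms(1,2)] assms(3) by simp
  then show "inner_H g f = 0" by (subst inner_H_commute) simp
qed

lemma norm_H_square: "(norm_H f)\<^sup>2 = Re (inner_H f f)"
  by (simp add: norm_H_def inner_H_self(2))

lemma norm_H_nonneg: "0 \<le> norm_H f"
  by (simp add: norm_H_def inner_H_self(2))

lemma norm_H_comb_le:
  assumes "f \<in> space_H" "g \<in> space_H"
  shows "norm_H (comb z f g) \<le> cmod z * norm_H f + norm_H g"
proof -
  have "Re (z * inner_H f g) \<le> cmod z * cmod (inner_H f g)"
    using complex_Re_le_cmod[of "z * inner_H f g"] by (simp add: norm_mult)
  also have "cmod (inner_H f g) \<le> norm_H f * norm_H g"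
    using real_sqrt_le_mono[OF inner_H_Cauchy_Schwarz[OF assms]]
    by (simp add: norm_H_def real_sqrt_mult)
  finally have "Re (z * inner_H f g) \<le> cmod z * (norm_H f * norm_H g)"
    by (simp add: mult_left_mono)
  then have "(norm_H (comb z f g))\<^sup>2 \<le> (cmod z * norm_H f + norm_H g)\<^sup>2"
    using inner_H_comb_self[OF assms, of z]
    by (simp add: norm_H_square power2_sum power_mult_distrib mult.assoc)
  then show ?thesis
    by (rule power2_le_imp_le) (simp add: norm_H_nonneg)
qed

lemma cmod_inner_H_le:
  assumes "f \<in> space_H" "g \<in> space_H"
  shows "cmod (inner_H f g) \<le> norm_H f * norm_H g"
  using real_sqrt_le_mono[OF inner_H_Cauchy_Schwarz[OF assms]]
  by (simp add: norm_H_def real_sqrt_mult)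

section \<open>Spectral measures\<close>

locale pvm =
  fixes E :: "real set \<Rightarrow> ('n::finite \<Rightarrow> real \<Rightarrow> complex) \<Rightarrow> 'n \<Rightarrow> real \<Rightarrow> complex"
  assumes pvm: "projection_valued_measure E"
begin

abbreviation N :: "real set \<Rightarrow> ('n \<Rightarrow> real \<Rightarrow> complex) \<Rightarrow> real" where
  "N B f \<equiv> Re (inner_H (E B f) f)"

lemma E_space: "B \<in> sets borel \<Longrightarrow> f \<in> space_H \<Longrightarrow> E B f \<in> space_H"
  using pvm by (simp add: projection_valued_measure_def)

lemma E_cong:
  assumes "B \<in> sets borel" "f \<in> space_H" "g \<in> space_H" "eq_H f g" "h \<in> space_H"
  shows "inner_H (E B f) h = inner_H (E B g) h"
  using pvm assms by (intro inner_H_cong E_space) (auto simp: projection_valued_measure_def)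

lemma E_selfadjoint:
  assumes "B \<in> sets borel" "f \<in> space_H" "g \<in> space_H"
  shows "inner_H (E B f) g = inner_H f (E B g)"
  using pvm assms by (simp add: projection_valued_measure_def)

lemma E_idem:
  assumes "B \<in> sets borel" "f \<in> space_H" "g \<in> space_H"
  shows "inner_H (E B (E B f)) g = inner_H (E B f) g" "inner_H (E B f) (E B g) = inner_H (E B f) g"
proof -
  show *: "inner_H (E B (E B f)) g = inner_H (E B f) g"
    using pvm assms by (intro inner_H_cong E_space) (auto simp: projection_valued_measure_def)
  show "inner_H (E B f) (E B g) = inner_H (E B f) g"
    using * E_selfadjoint[of B "E B f" g] assms by (simp add: E_space)
qed

lemma E_UNIV: "f \<in> space_H \<Longrightarrow> g \<in> space_H \<Longrightarrow> inner_H (E UNIV f) g = inner_H f g"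
  using pvm by (intro inner_H_cong E_space) (auto simp: projection_valued_measure_def)

lemma N_eq: "B \<in> sets borel \<Longrightarrow> f \<in> space_H \<Longrightarrow> N B f = Re (inner_H (E B f) (E B f))"
  by (simp add: E_idem)

lemma N_real: "B \<in> sets borel \<Longrightarrow> f \<in> space_H \<Longrightarrow> inner_H (E B f) f = of_real (N B f)"
  using inner_H_self(1)[of "E B f"] by (simp add: E_idem)

lemma N_nonneg: "B \<in> sets borel \<Longrightarrow> f \<in> space_H \<Longrightarrow> 0 \<le> N B f"
  by (metis N_eq inner_H_self(2))

text \<open>Countable additivity is assumed in norm; Cauchy-Schwarz against \<open>g\<close> turns
  it into convergence of scalar series. The partial sums are written with \<open>comb\<close>, so
  that the linearity lemmas apply inductively.\<close>

lemma E_sums: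
  assumes B: "range B \<subseteq> sets borel" "disjoint_family (B :: nat \<Rightarrow> real set)"
    and f: "f \<in> space_H" and g: "g \<in> space_H"
  shows "(\<lambda>i. inner_H (E (B i) f) g) sums inner_H (E (\<Union>i. B i) f) g"
proof -
  define S where "S m = (\<lambda>k x. \<Sum>i<m. E (B i) f k x)" for m :: nat
  have Bs: "B i \<in> sets borel" for i using B by auto
  then have U: "(\<Union>i. B i) \<in> sets borel" by auto
  have S_Suc: "S (Suc m) = comb 1 (E (B m) f) (S m)" for m
    by (auto simp: S_def fun_eq_iff)
  have S0: "S 0 = (\<lambda>k x. 0)" by (simp add: S_def)
  have SH: "S m \<in> space_H" for m
    by (induction m) (simp_all only: S_Suc S0, simp add: space_H_def L2_branch_zero,
      intro space_H_comb E_space Bs f)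
  have Sin: "inner_H (S m) g = (\<Sum>i<m. inner_H (E (B i) f) g)" for m
  proof (induction m)
    case 0
    then show ?case by (simp add: S0 inner_H_def)
  next
    case (Suc m)
    then show ?case
      by (simp only: S_Suc inner_H_comb_left[OF E_space[OF Bs f] SH g]) simp
  qed
  let ?d = "\<lambda>m. comb (-1) (S m) (E (\<Union>i. B i) f)"
  have "(\<lambda>m. norm_H (?d m)) \<longlonglongrightarrow> 0"
    using pvm B f by (simp add: projection_valued_measure_def S_def)
  then have lim: "(\<lambda>m. norm_H (?d m) * norm_H g) \<longlonglongrightarrow> 0"
    by (rule tendsto_mult_left_zero)
  have "(\<lambda>m. inner_H (?d m) g) \<longlonglongrightarrow> 0"
  proof (rule Lim_null_comparison[OF _ lim], rule always_eventually, rule allI)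
    fix m
    show "norm (inner_H (?d m) g) \<le> norm_H (?d m) * norm_H g"
      by (intro cmod_inner_H_le space_H_comb SH E_space U f g)
  qed
  moreover have "inner_H (?d m) g = inner_H (E (\<Union>i. B i) f) g - (\<Sum>i<m. inner_H (E (B i) f) g)" for m
    by (simp only: inner_H_comb_left[OF SH E_space[OF U f] g] Sin) simp
  ultimately have "(\<lambda>m. inner_H (E (\<Union>i. B i) f) g - (\<Sum>i<m. inner_H (E (B i) f) g)) \<longlonglongrightarrow> 0"
    by simp
  then have "(\<lambda>m. inner_H (E (\<Union>i. B i) f) g -
      (inner_H (E (\<Union>i. B i) f) g - (\<Sum>i<m. inner_H (E (B i) f) g))) \<longlonglongrightarrow> inner_H (E (\<Union>i. B i) f) g - 0"
    by (intro tendsto_diff tendsto_const)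
  then show ?thesis by (simp add: sums_def)
qed

text \<open>Additivity for a sequence of empty sets yields a convergent series with constant terms,
  which must be zero.\<close>

lemma E_empty:
  assumes "f \<in> space_H" "g \<in> space_H"
  shows "inner_H (E {} f) g = 0"
proof -
  have "(\<lambda>i::nat. inner_H (E {} f) g) sums inner_H (E (\<Union>i::nat. {}) f) g"
    using assms by (intro E_sums) (auto simp: disjoint_family_on_def)
  then show ?thesis using sums_summable summable_const_iff by blast
qed

lemma E_Un:
  assumes "B \<in> sets borel" "C \<in> sets borel" "B \<inter> C = {}" "f \<in> space_H" "g \<in> space_H"
  shows "inner_H (E (B \<union> C) f) g = inner_H (E B f) g + inner_H (E C f) g"
proof -
  have "(\<lambda>i. inner_H (E (binaryset B C i) f) g) sums inner_H (E (\<Union>i. binaryset B C i) f) g"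
    using assms by (intro E_sums) (auto simp: disjoint_family_on_def binaryset_def)
  moreover have "(\<lambda>i. inner_H (E (binaryset B C i) f) g) sums (inner_H (E B f) g + inner_H (E C f) g)"
    by (intro binaryset_sums E_empty assms)
  ultimately show ?thesis
    by (metis UN_binaryset_eq sums_unique2)
qed

lemma N_le: "B \<in> sets borel \<Longrightarrow> f \<in> space_H \<Longrightarrow> N B f \<le> Re (inner_H f f)"
  using E_Un[of B "-B" f f] N_nonneg[of "-B" f] by (simp add: E_UNIV)

text \<open>Stands in for \<open>E C (E B f) = 0\<close>: the vector \<open>E B f\<close> already
  has its whole square norm on \<open>B\<close>, so additivity and the bound by the total mass leave
  nothing for \<open>C\<close>.\<close>

lemma N_disjoint:
  assumes "B \<in> sets borel" "C \<in> sets borel" "B \<inter> C = {}" "f \<in> space_H"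
  shows "N C (E B f) = 0"
proof -
  have v: "E B f \<in> space_H" using assms by (simp add: E_space)
  have "N (B \<union> C) (E B f) = N B (E B f) + N C (E B f)"
    using assms v by (simp add: E_Un)
  moreover have "N B (E B f) = Re (inner_H (E B f) (E B f))"
    using assms v by (simp add: E_idem)
  moreover have "N (B \<union> C) (E B f) \<le> Re (inner_H (E B f) (E B f))"
    using assms v by (intro N_le) auto
  moreover have "0 \<le> N C (E B f)" using assms v by (intro N_nonneg)
  ultimately show ?thesis by simp
qed

lemma N_null:
  assumes "C \<in> sets borel" "f \<in> space_H" "g \<in> space_H" "N C f = 0"
  shows "inner_H (E C f) g = 0" "inner_H g (E C f) = 0"
  using inner_H_null[OF E_space[OF assms(1,2)] assms(3)] assms(4) N_eq[OF assms(1,2)] by auto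

lemma N_cong:
  assumes "C \<in> sets borel" "f \<in> space_H" "g \<in> space_H" "eq_H f g"
  shows "N C f = N C g"
proof -
  have "inner_H (E C f) f = inner_H f (E C f)" using assms by (simp add: E_selfadjoint)
  also have "\<dots> = inner_H g (E C f)" using assms by (intro inner_H_cong E_space)
  also have "\<dots> = cnj (inner_H (E C f) g)" by (rule inner_H_commute)
  also have "inner_H (E C f) g = inner_H (E C g) g" using assms by (intro E_cong)
  finally show ?thesis by simp
qed

lemma N_comb:
  assumes "B \<in> sets borel" "f \<in> space_H" "g \<in> space_H"
  shows "N B (comb z f g) = (cmod z)\<^sup>2 * N B f + 2 * Re (z * inner_H (E B f) g) + N B g"
proof -
  have "inner_H (E B (comb z f g)) (comb z f g) = inner_H (E B (comb z f g)) (E B (comb z f g))"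
    using assms by (simp add: E_idem space_H_comb)
  also have "\<dots> = inner_H (comb z (E B f) (E B g)) (E B (comb z f g))"
    using pvm assms by (intro inner_H_cong E_space space_H_comb) (auto simp: projection_valued_measure_def)
  also have "\<dots> = cnj (inner_H (E B (comb z f g)) (comb z (E B f) (E B g)))"
    by (rule inner_H_commute)
  also have "inner_H (E B (comb z f g)) (comb z (E B f) (E B g)) =
      inner_H (comb z (E B f) (E B g)) (comb z (E B f) (E B g))"
    using pvm assms by (intro inner_H_cong E_space space_H_comb) (auto simp: projection_valued_measure_def)
  finally have "N B (comb z f g) = Re (inner_H (comb z (E B f) (E B g)) (comb z (E B f) (E B g)))"
    by simp
  then show ?thesis
    using assms inner_H_comb_self[OF E_space E_space, OF assms(1,2) assms(1,3), of z]
    by (simp add: E_idem)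
qed

lemma sqrt_N_comb_le:
  assumes "B \<in> sets borel" "f \<in> space_H" "g \<in> space_H"
  shows "sqrt (N B (comb z f g)) \<le> cmod z * sqrt (N B f) + sqrt (N B g)"
proof -
  have "sqrt (N B (comb z f g)) = norm_H (comb z (E B f) (E B g))"
    unfolding norm_H_def inner_H_comb_self[OF E_space E_space, OF assms(1,2) assms(1,3), of z] N_comb[OF assms]
    using assms by (simp add: E_idem)
  also have "\<dots> \<le> cmod z * norm_H (E B f) + norm_H (E B g)"
    using assms by (intro norm_H_comb_le E_space)
  finally show ?thesis using assms by (simp add: norm_H_def E_idem)
qed

lemma sets_spectral_measure [measurable_cong, simp]: "sets (spectral_measure E f) = sets borel"
  by (simp add: spectral_measure_def sets.sigma_sets_eq[of borel, simplified])

lemma space_spectral_measure [simp]: "space (spectral_measure E f) = UNIV"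
  by (simp add: spectral_measure_def)

lemma emeasure_spectral_measure:
  assumes f: "f \<in> space_H" and B: "B \<in> sets borel"
  shows "emeasure (spectral_measure E f) B = ennreal (N B f)"
proof (rule emeasure_measure_of[OF spectral_measure_def])
  show "sets borel \<subseteq> Pow (UNIV::real set)" by simp
  show "B \<in> sets (spectral_measure E f)" using B by simp
  show "positive (sets (spectral_measure E f)) (\<lambda>B. ennreal (N B f))"
    using f by (simp add: positive_def E_empty)
  show "countably_additive (sets (spectral_measure E f)) (\<lambda>B. ennreal (N B f))"
  proof (rule countably_additiveI)
    fix A :: "nat \<Rightarrow> real set"
    assume A: "range A \<subseteq> sets (spectral_measure E f)" "disjoint_family A"
    then have "(\<lambda>i. N (A i) f) sums N (\<Union>i. A i) f"
      using sums_Re[OF E_sums[OF _ A(2) f f]] by simp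
    then show "(\<Sum>i. ennreal (N (A i) f)) = ennreal (N (\<Union> (range A)) f)"
      using A f by (intro sums_unique[symmetric]) (auto intro!: sums_ennreal[THEN iffD2] N_nonneg)
  qed
qed

lemma finite_spectral_measure: "f \<in> space_H \<Longrightarrow> finite_measure (spectral_measure E f)"
  by (rule finite_measureI) (simp add: emeasure_spectral_measure)

lemma measure_spectral_measure:
  "f \<in> space_H \<Longrightarrow> B \<in> sets borel \<Longrightarrow> measure (spectral_measure E f) B = N B f"
  by (simp add: measure_def emeasure_spectral_measure N_nonneg)

lemma AE_spectral_measure:
  assumes "f \<in> space_H" "B \<in> sets borel" "v \<in> space_H" "eq_H (E B f) v"
  shows "AE t in spectral_measure E v. t \<in> B"
proof (rule AE_I)
  show "emeasure (spectral_measure E v) (- B) = 0"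
    using assms N_disjoint[of B "-B" f] N_cong[of "- B" "E B f" v]
    by (simp add: emeasure_spectral_measure E_space)
qed (use assms in auto)

text \<open>If \<open>E C v\<close> is null, the cross term and the square term in
  \<open>N_comb\<close> vanish on every subset of \<open>C\<close>; the two spectral measures
  therefore coincide there, and so do the integrals, integrable or not.\<close>

lemma integral_spectral_measure_off:
  fixes h :: "real \<Rightarrow> real"
  assumes u: "u \<in> space_H" and v: "v \<in> space_H" and C: "C \<in> sets borel"
    and null: "N C v = 0" and h: "h \<in> borel_measurable borel"
  shows "(LINT t|spectral_measure E (comb z v u). indicator C t * h t) =
         (LINT t|spectral_measure E u. indicator C t * h t)"
proof -
  let ?x = "comb z v u"
  have x: "?x \<in> space_H" using u v by (rule space_H_comb[rotated])
  have eq: "density (spectral_measure E ?x) (indicator C) = density (spectral_measure E u) (indicator C)"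
  proof (rule measure_eqI)
    fix A assume "A \<in> sets (density (spectral_measure E ?x) (indicator C))"
    then have A: "A \<in> sets borel" by simp
    then have AC: "A \<inter> C \<in> sets borel" using C by auto
    have "N (A \<inter> C) v = 0"
    proof -
      have "N C v = N (A \<inter> C) v + N (C - A) v"
      proof -
        have "(A \<inter> C) \<union> (C - A) = C" "(A \<inter> C) \<inter> (C - A) = {}" by auto
        then show ?thesis using E_Un[OF AC _ _ v v, of "C - A"] A C by simp
      qed
      moreover have "0 \<le> N (A \<inter> C) v" "0 \<le> N (C - A) v" using A C v by (auto intro!: N_nonneg)
      ultimately show ?thesis using null by simp
    qed
    then have "N (A \<inter> C) ?x = N (A \<inter> C) u"
      using N_comb[OF AC v u, of z] N_null(1)[OF AC v u] by simp
    moreover have "emeasure (density (spectral_measure E y) (indicator C)) A = ennreal (N (A \<inter> C) y)"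
      if "y \<in> space_H" for y
      using that A C AC
      by (subst emeasure_density) (auto simp: emeasure_spectral_measure Int_commute simp flip: indicator_inter_arith)
    ultimately show "emeasure (density (spectral_measure E ?x) (indicator C)) A =
      emeasure (density (spectral_measure E u) (indicator C)) A" using u x by simp
  qed simp
  have "(LINT t|spectral_measure E y. indicator C t * h t) =
      (LINT t|density (spectral_measure E y) (indicator C). h t)" for y
  proof -
    have "density (spectral_measure E y) (indicator C) =
        density (spectral_measure E y) (\<lambda>t. ennreal (indicator C t))"
      by (intro arg_cong[where f="density _"]) (auto simp: fun_eq_iff split: split_indicator)
    then show ?thesis using C h by (simp add: integral_density)
  qed
  with eq show ?thesis by simp
qed

end

section \<open>Resolvents of an operator known through its quadratic form\<close>

lemma space_H_zero: "(\<lambda>k x. 0) \<in> space_H"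
  by (simp add: space_H_def L2_branch_zero)

lemma space_H_scale: "f \<in> space_H \<Longrightarrow> (\<lambda>k x. z * f k x) \<in> space_H"
  using space_H_comb[OF _ space_H_zero, of f z] by simp

lemma inner_H_scale_left: "f \<in> space_H \<Longrightarrow> h \<in> space_H \<Longrightarrow> inner_H (\<lambda>k x. z * f k x) h = z * inner_H f h"
  using inner_H_comb_left[OF _ space_H_zero, of f h z] by (simp add: inner_H_def)

lemma (in pvm) N_scale:
  assumes "B \<in> sets borel" "f \<in> space_H"
  shows "N B (\<lambda>k x. z * f k x) = (cmod z)\<^sup>2 * N B f"
proof -
  have "inner_H g (\<lambda>k x. 0) = 0" for g :: "'n \<Rightarrow> real \<Rightarrow> complex" by (simp add: inner_H_def)
  then show ?thesis using N_comb[OF assms(1,2) space_H_zero, of z] by simp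
qed

text \<open>\<open>T_comb\<close> states linearity only through scalar products because the operator
  is built from chosen weak derivatives and is linear only up to null sets. \<open>Dom\<close>
  contains particular representatives, whence the \<open>eq_H\<close> in
  \<open>Dom_iff\<close>.\<close>

locale spectral_operator = pvm E
  for E :: "real set \<Rightarrow> ('n::finite \<Rightarrow> real \<Rightarrow> complex) \<Rightarrow> 'n \<Rightarrow> real \<Rightarrow> complex" +
  fixes Dom :: "('n \<Rightarrow> real \<Rightarrow> complex) set"
    and T :: "('n \<Rightarrow> real \<Rightarrow> complex) \<Rightarrow> 'n \<Rightarrow> real \<Rightarrow> complex"
  assumes Dom_space: "u \<in> Dom \<Longrightarrow> u \<in> space_H"
    and T_space: "u \<in> Dom \<Longrightarrow> T u \<in> space_H"
    and Dom_comb: "u \<in> Dom \<Longrightarrow> v \<in> Dom \<Longrightarrow> comb z u v \<in> Dom"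
    and T_comb: "u \<in> Dom \<Longrightarrow> v \<in> Dom \<Longrightarrow> h \<in> space_H \<Longrightarrow>
      inner_H (T (comb z u v)) h = z * inner_H (T u) h + inner_H (T v) h"
    and Dom_iff: "f \<in> space_H \<Longrightarrow>
      (\<exists>u\<in>Dom. eq_H f u) \<longleftrightarrow> integrable (spectral_measure E f) (\<lambda>t. t\<^sup>2)"
    and T_form: "u \<in> Dom \<Longrightarrow> inner_H (T u) u = of_real (LINT t|spectral_measure E u. t)"
begin

lemma integrable_spectral_measure_id:
  assumes "u \<in> Dom"
  shows "integrable (spectral_measure E u) (\<lambda>t. t)"
proof (rule Bochner_Integration.integrable_bound)
  interpret finite_measure "spectral_measure E u"
    using assms by (intro finite_spectral_measure Dom_space)
  have "eq_H u u" by (simp add: eq_H_def)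
  then show "integrable (spectral_measure E u) (\<lambda>t. 1 + t\<^sup>2)"
    using Dom_iff[OF Dom_space[OF assms]] assms by auto
  have "\<bar>t\<bar> \<le> 1 + t\<^sup>2" for t :: real
    using sum_squares_bound[of "\<bar>t\<bar>" 1] by simp
  then show "AE t in spectral_measure E u. norm t \<le> norm (1 + t\<^sup>2)" by (intro AE_I2) simp
qed simp

lemma form_shift:
  assumes "x \<in> Dom"
  shows "inner_H (T x) x - of_real s * inner_H x x = of_real (LINT t|spectral_measure E x. t - s)"
proof -
  interpret finite_measure "spectral_measure E x"
    using assms by (intro finite_spectral_measure Dom_space)
  have "inner_H x x = of_real (N UNIV x)"
    using Dom_space[OF assms] inner_H_self(1)[of x] by (simp add: E_UNIV)
  then show ?thesis
    using assms integrable_spectral_measure_id[OF assms]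
    by (simp add: T_form measure_spectral_measure Dom_space algebra_simps)
qed

text \<open>
  The range of \<open>E B\<close> lies in the domain up to null sets. There, polarization recovers
  \<open>(T u - s u, v)\<close> from four values of the quadratic form; the parts of the spectral integrals
  outside \<open>B\<close> agree for all four and cancel, so only the oscillation of \<open>t\<close> over \<open>B\<close> remains.
\<close>

lemma N_shift_le:
  assumes u: "u \<in> Dom" and B: "B \<in> sets borel" and BI: "B \<subseteq> {s - d..s + d}" and d: "0 < d"
  shows "N B (comb (- of_real s) u (T u)) \<le> 16 * d\<^sup>2 * N B u"
proof -
  define y where "y = comb (- of_real s) u (T u)"
  have uH: "u \<in> space_H" and TuH: "T u \<in> space_H" using u by (auto intro: Dom_space T_space)
  then have y: "y \<in> space_H" unfolding y_def by (rule space_H_comb)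
  have Ey: "E B y \<in> space_H" using B y by (rule E_space)
  have "integrable (spectral_measure E (E B y)) (\<lambda>t. t\<^sup>2)"
  proof (rule finite_measure.integrable_const_bound[where B="(\<bar>s\<bar> + d)\<^sup>2"])
    show "finite_measure (spectral_measure E (E B y))" using Ey by (rule finite_spectral_measure)
    have "AE t in spectral_measure E (E B y). t \<in> B"
      using B y Ey by (intro AE_spectral_measure) (auto simp: eq_H_def)
    then show "AE t in spectral_measure E (E B y). norm (t\<^sup>2) \<le> (\<bar>s\<bar> + d)\<^sup>2"
    proof (rule eventually_mono)
      fix t assume "t \<in> B"
      then have "\<bar>t\<bar> \<le> \<bar>s\<bar> + d" using BI by force
      then show "norm (t\<^sup>2) \<le> (\<bar>s\<bar> + d)\<^sup>2" by (simp add: abs_le_square_iff[symmetric])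
    qed
  qed simp
  \<comment> \<open>\<open>E B y\<close> has a bounded spectral support, so its class has a
    representative in the domain; \<open>v\<close> is that representative.\<close>
  then obtain v where v: "v \<in> Dom" and Ev: "eq_H (E B y) v" using Dom_iff[OF Ey] by blast
  have vH: "v \<in> space_H" using v by (rule Dom_space)
  have Nv: "N B v = N B y"
    using N_cong[OF B Ey vH Ev] B y by (simp add: E_idem Ey)
  have mB: "- B \<in> sets borel" using B by auto
  have Nv0: "N (- B) v = 0"
    using N_cong[OF mB Ey vH Ev] N_disjoint[OF B mB _ y] by simp
  define b where "b p q = inner_H (T p) q - of_real s * inner_H p q" for p q
  \<comment> \<open>The quantity to be estimated is itself a value of the sesquilinear form of
    \<open>T - s\<close>.\<close>
  have buv: "b u v = of_real (N B y)"
  proof -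
    have "b u v = inner_H y v"
      unfolding b_def y_def inner_H_comb_left[OF uH TuH vH] by simp
    also have "\<dots> = cnj (inner_H v y)" by (rule inner_H_commute)
    also have "inner_H v y = inner_H (E B y) y" by (rule inner_H_cong[symmetric]) (fact Ev Ey vH y)+
    also have "\<dots> = of_real (N B y)" by (rule N_real) (fact B y)+
    finally show ?thesis by simp
  qed
  define J where "J = (LINT t|spectral_measure E u. indicator (- B) t * (t - s))"
  define r where "r z = (LINT t|spectral_measure E (comb z v u). indicator B t * (t - s))" for z
  have b_expand: "b (comb z v u) (comb z v u) = z * cnj z * b v v + z * b v u + cnj z * b u v + b u u" for z
    unfolding b_def T_comb[OF v u space_H_comb[OF vH uH]] inner_H_comb_left[OF vH uH space_H_comb[OF vH uH]]
      inner_H_comb_right[OF vH uH T_space[OF v]] inner_H_comb_right[OF vH uH TuH]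
      inner_H_comb_right[OF vH uH vH] inner_H_comb_right[OF vH uH uH]
    by (simp add: algebra_simps)
  \<comment> \<open>The part \<open>J\<close> off \<open>B\<close> does not depend on
    \<open>z\<close>, so it drops out of differences.\<close>
  have b_val: "b (comb z v u) (comb z v u) = of_real (r z + J)" for z
  proof -
    have x: "comb z v u \<in> Dom" by (intro Dom_comb u v)
    interpret finite_measure "spectral_measure E (comb z v u)"
      using x by (intro finite_spectral_measure Dom_space)
    have i: "integrable (spectral_measure E (comb z v u)) (\<lambda>t. t - s)"
      using integrable_spectral_measure_id[OF x] by simp
    have "(LINT t|spectral_measure E (comb z v u). t - s) =
       (LINT t|spectral_measure E (comb z v u). indicator B t * (t - s) + indicator (- B) t * (t - s))"
      by (intro Bochner_Integration.integral_cong) (auto split: split_indicator)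
    also have "\<dots> = r z + (LINT t|spectral_measure E (comb z v u). indicator (- B) t * (t - s))"
      unfolding r_def using i B mB
      by (intro Bochner_Integration.integral_add)
        (simp_all add: integrable_real_mult_indicator mult.commute[of "indicator _ _"])
    also have "(LINT t|spectral_measure E (comb z v u). indicator (- B) t * (t - s)) = J"
      unfolding J_def by (rule integral_spectral_measure_off[OF uH vH mB Nv0]) simp
    finally show ?thesis using form_shift[OF x, of s] by (simp add: b_def)
  qed
  have r_bound: "\<bar>r z\<bar> \<le> d * (2 * (cmod z)\<^sup>2 * N B y + 2 * N B u)" for z
  proof -
    have xH: "comb w v u \<in> space_H" for w by (intro space_H_comb uH vH)
    interpret finite_measure "spectral_measure E (comb z v u)"
      using xH by (rule finite_spectral_measure)
    have le: "\<bar>indicator B t * (t - s)\<bar> \<le> d * indicator B t" for t :: real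
    proof (cases "t \<in> B")
      case True
      then have "t \<in> {s - d..s + d}" using BI by blast
      with True show ?thesis by auto
    qed simp
    have i: "integrable (spectral_measure E (comb z v u)) (\<lambda>t. d * indicator B t)"
      using B by (intro integrable_mult_right integrable_real_indicator) (auto simp: less_top[symmetric])
    have "\<bar>r z\<bar> \<le> (LINT t|spectral_measure E (comb z v u). \<bar>indicator B t * (t - s)\<bar>)"
      unfolding r_def by (rule integral_abs_bound)
    also have "\<dots> \<le> (LINT t|spectral_measure E (comb z v u). d * indicator B t)"
      using le B by (intro integral_mono Bochner_Integration.integrable_bound[OF i])
        (auto intro!: AE_I2 order_trans[OF le] simp: d less_imp_le)
    also have "\<dots> = d * N B (comb z v u)"
      using B xH by (simp add: measure_spectral_measure)
    \<comment> \<open>Parallelogram identity: the values at \<open>z\<close> and \<open>- z\<close>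
      add up to the right side, and the one at \<open>- z\<close> is nonnegative.\<close>
    also have "N B (comb z v u) \<le> 2 * (cmod z)\<^sup>2 * N B y + 2 * N B u"
      using N_comb[OF B vH uH, of z, unfolded Nv] N_comb[OF B vH uH, of "- z", unfolded Nv] N_nonneg[OF B xH, of "- z"]
      unfolding norm_minus_cancel mult_minus_left uminus_complex.sel by linarith
    finally show ?thesis using d by (simp add: mult_left_mono)
  qed
  \<comment> \<open>With this scale the term quadratic in \<sigma> consumes a quarter of the left
    side of the final inequality; what remains gives the constant 16/3, rounded up to 16.\<close>
  define \<sigma> where "\<sigma> = 1 / (4 * d)"
  have \<sigma>: "0 < \<sigma>" using d by (simp add: \<sigma>_def)
  let ?s = "complex_of_real \<sigma>"
  \<comment> \<open>Polarization. Both \<open>b u v\<close> and the numbers \<open>r z\<close> are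
    real, so the second pair of values disappears when real parts are taken.\<close>
  have "4 * ?s * b u v = b (comb ?s v u) (comb ?s v u) - b (comb (- ?s) v u) (comb (- ?s) v u)
     + \<i> * (b (comb (\<i> * ?s) v u) (comb (\<i> * ?s) v u) - b (comb (- \<i> * ?s) v u) (comb (- \<i> * ?s) v u))"
    unfolding b_expand by (simp add: algebra_simps)
  also have "\<dots> = of_real (r ?s - r (- ?s)) + \<i> * of_real (r (\<i> * ?s) - r (- \<i> * ?s))"
    unfolding b_val by simp
  finally have "4 * \<sigma> * N B y = r ?s - r (- ?s)"
    unfolding buv by (simp add: complex_eq_iff)
  also have "\<dots> \<le> \<bar>r ?s\<bar> + \<bar>r (- ?s)\<bar>" by simp
  also have "\<dots> \<le> 2 * (d * (2 * \<sigma>\<^sup>2 * N B y + 2 * N B u))"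
    using r_bound[of ?s] r_bound[of "- ?s"] by simp
  finally have "4 * \<sigma> * N B y \<le> 2 * (d * (2 * \<sigma>\<^sup>2 * N B y + 2 * N B u))" .
  then have "N B y \<le> 16 * d\<^sup>2 * N B u"
    using d N_nonneg[OF B y] by (simp add: \<sigma>_def field_simps power2_eq_square)
  then show ?thesis by (simp add: y_def)
qed

text \<open>Write \<open>f\<close> as \<open>(z - s) u\<close> minus \<open>(T - s) u\<close>. By
  \<open>N_shift_le\<close> the second term has seminorm at most \<open>4 * d\<close> times that of
  \<open>u\<close>, and both estimates are triangle inequalities.\<close>

lemma N_resolvent_close:
  assumes u: "u \<in> Dom" and B: "B \<in> sets borel" and BI: "B \<subseteq> {s - d..s + d}" and d: "0 < d"
    and f: "f \<in> space_H" "eq_H f (\<lambda>k x. z * u k x - T u k x)"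
  shows "sqrt (N B f) \<le> (cmod (z - of_real s) + 4 * d) * sqrt (N B u)"
    and "(cmod (z - of_real s) - 4 * d) * sqrt (N B u) \<le> sqrt (N B f)"
proof -
  define y where "y = comb (- of_real s) u (T u)"
  define f' where "f' = (\<lambda>k x. z * u k x - T u k x)"
  have uH: "u \<in> space_H" and TuH: "T u \<in> space_H" using u by (auto intro: Dom_space T_space)
  then have y: "y \<in> space_H" unfolding y_def by (rule space_H_comb)
  have zu: "(\<lambda>k x. (z - of_real s) * u k x) \<in> space_H" using uH by (rule space_H_scale)
  have f'_eq: "f' = comb (- 1) y (\<lambda>k x. (z - of_real s) * u k x)"
    by (simp add: f'_def y_def fun_eq_iff algebra_simps)
  then have f'H: "f' \<in> space_H" by (simp only: space_H_comb[OF y zu])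
  have Nf: "N B f = N B f'" using f B f'H by (intro N_cong) (auto simp: f'_def)
  have zu_eq: "(\<lambda>k x. (z - of_real s) * u k x) = comb 1 y f'"
    by (simp add: f'_eq)
  have "sqrt (N B y) \<le> sqrt (16 * d\<^sup>2 * N B u)"
    using N_shift_le[OF u B BI d] by (simp add: y_def)
  also have "\<dots> = 4 * d * sqrt (N B u)"
    using d by (simp add: real_sqrt_mult)
  finally have Ny: "sqrt (N B y) \<le> 4 * d * sqrt (N B u)" .
  have Nzu: "sqrt (N B (\<lambda>k x. (z - of_real s) * u k x)) = cmod (z - of_real s) * sqrt (N B u)"
    using N_scale[OF B uH, of "z - of_real s"] by (simp add: real_sqrt_mult)
  show "sqrt (N B f) \<le> (cmod (z - of_real s) + 4 * d) * sqrt (N B u)"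
    using sqrt_N_comb_le[OF B y zu, of "- 1"] Ny Nzu Nf unfolding f'_eq[symmetric]
    by (simp add: algebra_simps)
  show "(cmod (z - of_real s) - 4 * d) * sqrt (N B u) \<le> sqrt (N B f)"
    using sqrt_N_comb_le[OF B y f'H, of 1] Ny Nzu Nf unfolding zu_eq[symmetric]
    by (simp add: algebra_simps)
qed

text \<open>On a cell of length \<open>q * |Im z|\<close> the density \<open>1 / |z - t|^2\<close>
  is nearly constant and \<open>f\<close> is nearly a scalar multiple of \<open>u\<close>. Since
  \<open>z\<close> is at least \<open>|Im z|\<close> away from every real point, the relative error
  depends on \<open>q\<close> alone; summing over the cells and letting \<open>q\<close> tend to 0
  gives equality.\<close>

lemma nn_integral_resolvent:
  assumes u: "u \<in> Dom" and z: "Im z \<noteq> 0"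
    and f: "f \<in> space_H" "eq_H f (\<lambda>k x. z * u k x - T u k x)"
  shows "(\<integral>\<^sup>+t. ennreal (1 / (cmod (z - of_real t))\<^sup>2) \<partial>spectral_measure E f) = ennreal (Re (inner_H u u))"
proof -
  define e where "e = \<bar>Im z\<bar>"
  have e: "0 < e" using z by (simp add: e_def)
  have e_le: "e \<le> cmod (z - of_real t)" for t :: real
    using abs_Im_le_cmod[of "z - of_real t"] by (simp add: e_def)
  have uH: "u \<in> space_H" using u by (rule Dom_space)
  define h where "h t = 1 / (cmod (z - of_real t))\<^sup>2" for t :: real
  have h_meas [measurable]: "h \<in> borel_measurable borel" unfolding h_def by measurable
  define I where "I = (\<integral>\<^sup>+t. ennreal (h t) \<partial>spectral_measure E f)"
  \<comment> \<open>\<open>q < 1/8\<close> keeps \<open>1 - 4 * q\<close> positive, so the lower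
    estimate can be squared; the 4 is the one in \<open>N_resolvent_close\<close>.\<close>
  have bounds: "ennreal (((1 - 4 * q) / (1 + q))\<^sup>2 * Re (inner_H u u)) \<le> I \<and>
      I \<le> ennreal (((1 + 4 * q) / (1 - q))\<^sup>2 * Re (inner_H u u))" if q: "0 < q" "q < 1/8" for q
  proof -
    define d where "d = q * e"
    have d: "0 < d" using q e by (simp add: d_def)
    \<comment> \<open>The cells are naturally indexed by the integers; \<open>int_decode\<close>
      renumbers them by naturals, the index type of countable additivity.\<close>
    define B where "B n = {d * of_int (int_decode n)..<d * (of_int (int_decode n) + 1)}" for n
    have Bs: "B n \<in> sets borel" for n by (simp add: B_def)
    have B_iff: "t \<in> B n \<longleftrightarrow> n = int_encode \<lfloor>t / d\<rfloor>" for t n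
    proof -
      have "t \<in> B n \<longleftrightarrow> of_int (int_decode n) \<le> t / d \<and> t / d < of_int (int_decode n) + 1"
        using d by (auto simp: B_def field_simps)
      also have "\<dots> \<longleftrightarrow> \<lfloor>t / d\<rfloor> = int_decode n" by (auto simp: floor_eq_iff)
      also have "\<dots> \<longleftrightarrow> n = int_encode \<lfloor>t / d\<rfloor>" by (metis int_decode_inverse int_encode_inverse)
      finally show ?thesis .
    qed
    have disj: "disjoint_family B" by (auto simp: disjoint_family_on_def B_iff)
    have UN: "(\<Union>n. B n) = UNIV" by (auto simp: B_iff)
    have B_sub: "B n \<subseteq> {d * of_int (int_decode n) - d..d * of_int (int_decode n) + d}" for n
      using d by (auto simp: B_def algebra_simps)
    have I_sum: "I = (\<Sum>n. \<integral>\<^sup>+t. ennreal (h t) * indicator (B n) t \<partial>spectral_measure E f)"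
    proof -
      have "I = (\<integral>\<^sup>+t. (\<Sum>n. ennreal (h t) * indicator (B n) t) \<partial>spectral_measure E f)"
        unfolding I_def using suminf_indicator[OF disj] UN by (simp add: ennreal_suminf_cmult)
      then show ?thesis using Bs by (subst (asm) nn_integral_suminf) auto
    qed
    have N_sum: "(\<Sum>n. ennreal (c * N (B n) u)) = ennreal (c * Re (inner_H u u))" if "0 \<le> c" for c
    proof -
      have "(\<lambda>n. N (B n) u) sums Re (inner_H u u)"
        using sums_Re[OF E_sums[OF _ disj uH uH]] Bs UN uH by (auto simp: E_UNIV)
      then have "(\<lambda>n. c * N (B n) u) sums (c * Re (inner_H u u))" by (rule sums_mult)
      then show ?thesis
        using that Bs uH by (intro sums_unique[symmetric]) (auto intro!: sums_ennreal[THEN iffD2] mult_nonneg_nonneg N_nonneg inner_H_self(2))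
    qed
    have piece: "ennreal (((1 - 4 * q) / (1 + q))\<^sup>2 * N (B n) u) \<le>
        (\<integral>\<^sup>+t. ennreal (h t) * indicator (B n) t \<partial>spectral_measure E f) \<and>
        (\<integral>\<^sup>+t. ennreal (h t) * indicator (B n) t \<partial>spectral_measure E f) \<le>
        ennreal (((1 + 4 * q) / (1 - q))\<^sup>2 * N (B n) u)" for n
    proof -
      define s where "s = d * of_int (int_decode n)"
      define R where "R = cmod (z - of_real s)"
      have R: "e \<le> R" by (simp add: R_def e_le)
      then have R0: "0 < R" using e by simp
      \<comment> \<open>The cell length is at most the fraction \<open>q\<close> of the distance
        from \<open>z\<close>, uniformly in the cell: this is what makes all errors
        relative.\<close>
      have dR: "d \<le> q * R" using R q by (simp add: d_def)
      have qR: "q * R < R / 8" using q R0 by simp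
      have zt: "R - d \<le> cmod (z - of_real t) \<and> cmod (z - of_real t) \<le> R + d" if "t \<in> B n" for t
      proof -
        have "t \<in> {s - d..s + d}" using that B_sub[of n] unfolding s_def by blast
        then have "\<bar>t - s\<bar> \<le> d" by auto
        then have "cmod (of_real s - of_real t :: complex) \<le> d"
          by (metis norm_minus_commute norm_of_real of_real_diff)
        moreover have "R \<le> cmod (z - of_real t) + cmod (of_real s - of_real t :: complex)"
          unfolding R_def using norm_triangle_ineq4[of "z - of_real t" "of_real s - of_real t"] by simp
        moreover have "cmod (z - of_real t) \<le> R + cmod (of_real s - of_real t :: complex)"
          unfolding R_def using norm_triangle_ineq[of "z - of_real s" "of_real s - of_real t"] by simp
        ultimately show ?thesis by simp
      qed
      note close = N_resolvent_close[OF u Bs[of n] B_sub[of n, folded s_def] d f, folded R_def]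
      have Nu: "0 \<le> N (B n) u" and Nf: "0 \<le> N (B n) f" using Bs uH f by (auto intro!: N_nonneg)
      have "sqrt (N (B n) f) \<le> R * (1 + 4 * q) * sqrt (N (B n) u)"
        by (rule order_trans[OF close(1)], intro mult_right_mono) (use dR Nu in \<open>auto simp: algebra_simps\<close>)
      then have "(sqrt (N (B n) f))\<^sup>2 \<le> (R * (1 + 4 * q) * sqrt (N (B n) u))\<^sup>2"
        by (intro power_mono) (use Nf in auto)
      then have up: "N (B n) f \<le> (R * (1 + 4 * q))\<^sup>2 * N (B n) u"
        using Nu Nf by (simp add: power_mult_distrib)
      have "R * (1 - 4 * q) * sqrt (N (B n) u) \<le> sqrt (N (B n) f)"
        by (rule order_trans[OF _ close(2)], intro mult_right_mono) (use dR Nu in \<open>auto simp: algebra_simps\<close>)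
      then have "(R * (1 - 4 * q) * sqrt (N (B n) u))\<^sup>2 \<le> (sqrt (N (B n) f))\<^sup>2"
        by (intro power_mono) (use Nu q R0 in auto)
      then have low: "(R * (1 - 4 * q))\<^sup>2 * N (B n) u \<le> N (B n) f"
        using Nu Nf by (simp add: power_mult_distrib)
      have hle: "h t \<le> 1 / (R * (1 - q))\<^sup>2" "1 / (R * (1 + q))\<^sup>2 \<le> h t" if "t \<in> B n" for t
      proof -
        have "R * (1 - q) \<le> cmod (z - of_real t)" "cmod (z - of_real t) \<le> R * (1 + q)"
          using zt[OF that] dR by (auto simp: algebra_simps)
        moreover have "0 < R * (1 - q)" using R0 q by simp
        ultimately show "h t \<le> 1 / (R * (1 - q))\<^sup>2" "1 / (R * (1 + q))\<^sup>2 \<le> h t"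
          unfolding h_def by (auto intro!: divide_left_mono power_mono mult_pos_pos)
      qed
      have em: "(\<integral>\<^sup>+t. ennreal c * indicator (B n) t \<partial>spectral_measure E f) = ennreal (c * N (B n) f)"
        if "0 \<le> c" for c
        using that Bs f Nf by (simp add: nn_integral_cmult_indicator emeasure_spectral_measure ennreal_mult)
      have "(\<integral>\<^sup>+t. ennreal (h t) * indicator (B n) t \<partial>spectral_measure E f) \<le>
          (\<integral>\<^sup>+t. ennreal (1 / (R * (1 - q))\<^sup>2) * indicator (B n) t \<partial>spectral_measure E f)"
        using hle by (intro nn_integral_mono) (auto split: split_indicator intro!: ennreal_leI)
      also have "\<dots> = ennreal (1 / (R * (1 - q))\<^sup>2 * N (B n) f)" by (rule em) simp
      also have "\<dots> \<le> ennreal (1 / (R * (1 - q))\<^sup>2 * ((R * (1 + 4 * q))\<^sup>2 * N (B n) u))"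
        using up by (intro ennreal_leI mult_left_mono) auto
      also have "1 / (R * (1 - q))\<^sup>2 * ((R * (1 + 4 * q))\<^sup>2 * N (B n) u) =
          ((1 + 4 * q) / (1 - q))\<^sup>2 * N (B n) u"
        using R0 by (simp add: power_mult_distrib power_divide)
      finally have 1: "(\<integral>\<^sup>+t. ennreal (h t) * indicator (B n) t \<partial>spectral_measure E f) \<le> \<dots>" .
      have "((1 - 4 * q) / (1 + q))\<^sup>2 * N (B n) u =
          1 / (R * (1 + q))\<^sup>2 * ((R * (1 - 4 * q))\<^sup>2 * N (B n) u)"
        using R0 by (simp add: power_mult_distrib power_divide)
      also have "ennreal \<dots> \<le> ennreal (1 / (R * (1 + q))\<^sup>2 * N (B n) f)"
        using low by (intro ennreal_leI mult_left_mono) auto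
      also have "\<dots> = (\<integral>\<^sup>+t. ennreal (1 / (R * (1 + q))\<^sup>2) * indicator (B n) t \<partial>spectral_measure E f)"
        by (rule em[symmetric]) simp
      also have "\<dots> \<le> (\<integral>\<^sup>+t. ennreal (h t) * indicator (B n) t \<partial>spectral_measure E f)"
        using hle by (intro nn_integral_mono) (auto split: split_indicator intro!: ennreal_leI)
      finally show ?thesis using 1 by blast
    qed
    show ?thesis
      unfolding I_sum using piece
      by (auto intro!: suminf_le simp flip: N_sum)
  qed
  have I_fin: "I < \<infinity>" using bounds[of "1/16"] by (auto intro: le_less_trans)
  have nn: "0 \<le> Re (inner_H u u)" by (rule inner_H_self)
  have ev: "\<forall>\<^sub>F q in at_right 0. 0 < q \<and> q < (1/8::real)"
    unfolding eventually_at_right_field by (intro exI[of _ "1/8"]) simp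
  have "((\<lambda>q::real. ((1 + 4 * q) / (1 - q))\<^sup>2 * Re (inner_H u u)) \<longlongrightarrow>
      ((1 + 4 * 0) / (1 - 0))\<^sup>2 * Re (inner_H u u)) (at_right 0)"
    by (intro tendsto_intros) auto
  then have "enn2real I \<le> ((1 + 4 * 0) / (1 - 0))\<^sup>2 * Re (inner_H u u)"
    by (rule tendsto_lowerbound)
      (use ev bounds nn in \<open>auto elim!: eventually_mono intro!: enn2real_leI\<close>)
  moreover have "((\<lambda>q::real. ((1 - 4 * q) / (1 + q))\<^sup>2 * Re (inner_H u u)) \<longlongrightarrow>
      ((1 - 4 * 0) / (1 + 0))\<^sup>2 * Re (inner_H u u)) (at_right 0)"
    by (intro tendsto_intros) auto
  then have "((1 - 4 * 0) / (1 + 0))\<^sup>2 * Re (inner_H u u) \<le> enn2real I"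
  proof (rule tendsto_upperbound)
    show "\<forall>\<^sub>F q in at_right 0. ((1 - 4 * q) / (1 + q))\<^sup>2 * Re (inner_H u u) \<le> enn2real I"
      using ev
    proof (rule eventually_mono)
      fix q :: real assume "0 < q \<and> q < 1/8"
      then have "ennreal (((1 - 4 * q) / (1 + q))\<^sup>2 * Re (inner_H u u)) \<le> ennreal (enn2real I)"
        using bounds[of q] I_fin by simp
      then show "((1 - 4 * q) / (1 + q))\<^sup>2 * Re (inner_H u u) \<le> enn2real I"
        by (subst (asm) ennreal_le_iff) auto
    qed
  qed simp
  ultimately have "enn2real I = Re (inner_H u u)" by simp
  moreover have "I = ennreal (enn2real I)" using I_fin by simp
  ultimately show ?thesis unfolding I_def h_def by (simp only:)
qed

text \<open>\<open>(T u, u)\<close> is the integral of a real function, hence only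
  \<open>z (u, u)\<close> contributes to the imaginary part of \<open>(f, u)\<close>. Exchanging the
  arguments flips the sign, so the result is nonnegative in the lower half plane.\<close>

lemma Im_inner_resolvent:
  assumes u: "u \<in> Dom" and f: "f \<in> space_H" "eq_H f (\<lambda>k x. z * u k x - T u k x)"
  shows "Im (inner_H u f) = - Im z * Re (inner_H u u)"
proof -
  have uH: "u \<in> space_H" and TuH: "T u \<in> space_H" using u by (auto intro: Dom_space T_space)
  have *: "(\<lambda>k x. z * u k x - T u k x) = comb (- 1) (T u) (\<lambda>k x. z * u k x)" by auto
  have "inner_H f u = inner_H (comb (- 1) (T u) (\<lambda>k x. z * u k x)) u"
    using f uH TuH unfolding * by (intro inner_H_cong space_H_comb space_H_scale)
  also have "\<dots> = z * inner_H u u - inner_H (T u) u"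
    by (simp only: inner_H_comb_left[OF TuH space_H_scale[OF uH] uH] inner_H_scale_left[OF uH uH]) simp
  also have "\<dots> = z * of_real (Re (inner_H u u)) - of_real (LINT t|spectral_measure E u. t)"
    using T_form[OF u] inner_H_self(1)[of u] by simp
  finally have "Im (inner_H f u) = Im z * Re (inner_H u u)" by simp
  then show ?thesis by (subst inner_H_commute) simp
qed

end

section \<open>Stieltjes inversion\<close>

lemma nn_integral_Poisson_kernel:
  fixes e x s r :: real
  assumes "0 < e" "s \<le> r"
  shows "(\<integral>\<^sup>+t. ennreal (e / ((t - x)\<^sup>2 + e\<^sup>2)) * indicator {s..r} t \<partial>lborel) =
    ennreal (arctan ((r - x) / e) - arctan ((s - x) / e))"
proof (rule nn_integral_FTC_Icc)
  fix t assume "t \<in> {s..r}"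
  have "((\<lambda>t. arctan ((t - x) / e)) has_real_derivative inverse (1 + ((t - x) / e)\<^sup>2) * (1 / e)) (at t)"
    using assms by (auto intro!: derivative_eq_intros)
  moreover have "inverse (1 + ((t - x) / e)\<^sup>2) * (1 / e) = e / ((t - x)\<^sup>2 + e\<^sup>2)"
    using assms by (simp add: field_simps power2_eq_square)
  ultimately show "((\<lambda>t. arctan ((t - x) / e)) has_real_derivative e / ((t - x)\<^sup>2 + e\<^sup>2)) (at t)"
    by simp
qed (use assms in auto)

text \<open>Integrating the Poisson kernel over \<open>t\<close> in \<open>[s, r]\<close> gives a
  difference of arctangents, bounded by \<open>pi\<close>, whose limit is \<open>pi\<close> inside
  the interval, 0 outside and \<open>pi / 2\<close> at the ends. Continuity of \<phi> down to
  \<open>e = 0\<close> does two jobs: the right side converges, and atoms are excluded, so that the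
  half weights at the ends do no harm.\<close>

lemma measure_Stieltjes_inversion:
  fixes M :: "real measure" and \<phi> :: "real \<Rightarrow> real \<Rightarrow> real"
  assumes M: "finite_measure M" "sets M = sets borel" and sr: "s < r"
    and P: "\<And>t e. t \<in> {s..r} \<Longrightarrow> 0 < e \<Longrightarrow> e \<le> 1 \<Longrightarrow>
      (\<integral>\<^sup>+x. ennreal (e / ((t - x)\<^sup>2 + e\<^sup>2)) \<partial>M) = ennreal (\<phi> t e)"
    and nonneg: "\<And>t e. t \<in> {s..r} \<Longrightarrow> 0 < e \<Longrightarrow> e \<le> 1 \<Longrightarrow> 0 \<le> \<phi> t e"
    and cont: "continuous_on ({s..r} \<times> {0..1}) (\<lambda>(t, e). \<phi> t e)"
  shows "measure M {s<..<r} = integral {s..r} (\<lambda>t. \<phi> t 0) / pi"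
proof -
  interpret finite_measure M by (rule M)
  note M(2)[measurable_cong, simp]
  define e where "e n = 1 / real (Suc n)" for n
  have e: "0 < e n" "e n \<le> 1" for n by (auto simp: e_def)
  have e0: "e \<longlonglongrightarrow> 0" unfolding e_def by (rule LIMSEQ_inverse_real_of_nat[unfolded inverse_eq_divide])
  have spM: "space M = UNIV" using sets_eq_imp_space_eq[OF M(2)] by simp

  \<comment> \<open>At \<open>x = t\<close> the kernel equals \<open>1 / e\<close>, so an atom would
    force \<phi> to grow like its mass divided by \<open>e\<close>, against the finite
    limit.\<close>
  have atom: "measure M {t} = 0" if t: "t \<in> {s..r}" for t
  proof -
    have le: "measure M {t} \<le> e n * \<phi> t (e n)" for n
    proof -
      have "ennreal (1 / e n * measure M {t}) = (\<integral>\<^sup>+x. ennreal (1 / e n) * indicator {t} x \<partial>M)"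
        using e[of n] by (simp add: nn_integral_cmult_indicator emeasure_eq_measure
              flip: ennreal_mult')
      also have "\<dots> \<le> (\<integral>\<^sup>+x. ennreal (e n / ((t - x)\<^sup>2 + (e n)\<^sup>2)) \<partial>M)"
        using e[of n] by (intro nn_integral_mono) (auto split: split_indicator simp: power2_eq_square)
      also have "\<dots> = ennreal (\<phi> t (e n))" using t e by (intro P)
      finally show ?thesis
        using e[of n] nonneg[OF t e, of n] by (simp add: field_simps)
    qed
    have "continuous_on {0..1} (\<lambda>x. (\<lambda>(t, e). \<phi> t e) (t, x))"
      by (rule continuous_on_compose2[OF cont]) (use t in \<open>auto intro!: continuous_intros\<close>)
    then have "(\<lambda>n. \<phi> t (e n)) \<longlonglongrightarrow> \<phi> t 0"
      using e e0 by (intro continuous_on_tendsto_compose[of "{0..1}" "\<phi> t"]) (auto intro!: always_eventually less_imp_le)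
    from tendsto_mult[OF e0 this] have "measure M {t} \<le> 0 * \<phi> t 0"
      by (rule Lim_bounded2) (use le in auto)
    then show ?thesis using measure_nonneg[of M "{t}"] by simp
  qed

  define A where "A n x = arctan ((r - x) / e n) - arctan ((s - x) / e n)" for n x
  have A_nonneg: "0 \<le> A n x" and A_le: "A n x \<le> pi" for n x
  proof -
    show "0 \<le> A n x" using sr e[of n] by (simp add: A_def arctan_le_iff divide_right_mono)
    show "A n x \<le> pi"
      using arctan_bounded[of "(r - x) / e n"] arctan_bounded[of "(s - x) / e n"] by (simp add: A_def)
  qed
  have A_meas: "A n \<in> borel_measurable M" for n
    unfolding A_def by measurable
  have cont_slice: "continuous_on {s..r} (\<lambda>t. \<phi> t x)" if "x \<in> {0..1}" for x
    using that by (intro continuous_on_compose2[OF cont, of _ "\<lambda>t. (t, x)", simplified])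
      (auto intro!: continuous_intros)
  have eq: "(LINT x|M. A n x) = integral {s..r} (\<lambda>t. \<phi> t (e n))" for n
  proof -
    have en: "0 < e n" "e n \<le> 1" by (fact e)+
    interpret PS: pair_sigma_finite lborel M ..
    have "ennreal (LINT x|M. A n x) = (\<integral>\<^sup>+x. ennreal (A n x) \<partial>M)"
      by (intro nn_integral_eq_integral[symmetric] integrable_const_bound[where B=pi])
        (auto simp: A_meas A_nonneg A_le)
    also have "\<dots> = (\<integral>\<^sup>+x. \<integral>\<^sup>+t. ennreal (e n / ((t - x)\<^sup>2 + (e n)\<^sup>2)) * indicator {s..r} t \<partial>lborel \<partial>M)"
      unfolding A_def using en sr by (simp add: nn_integral_Poisson_kernel)
    also have "\<dots> = (\<integral>\<^sup>+t. \<integral>\<^sup>+x. ennreal (e n / ((t - x)\<^sup>2 + (e n)\<^sup>2)) * indicator {s..r} t \<partial>M \<partial>lborel)"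
      by (rule PS.Fubini') measurable
    also have "\<dots> = (\<integral>\<^sup>+t. ennreal (\<phi> t (e n)) * indicator {s..r} t \<partial>lborel)"
      using en by (intro nn_integral_cong) (auto simp: nn_integral_multc P split: split_indicator)
    also have "\<dots> = ennreal (integral {s..r} (\<lambda>t. \<phi> t (e n)))"
      using en nonneg
      by (intro nn_integral_has_integral_lebesgue' integrable_integral integrable_continuous_interval cont_slice) auto
    finally show ?thesis
      using en sr by (subst (asm) ennreal_inj)
        (auto intro!: Bochner_Integration.integral_nonneg integral_nonneg integrable_continuous_interval cont_slice nonneg A_nonneg)
  qed

  have "(\<lambda>n. LINT x|M. A n x) \<longlonglongrightarrow> (LINT x|M. pi * indicator {s<..<r} x)"
  proof (rule integral_dominated_convergence[where w="\<lambda>_. pi"])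
    have "AE x in M. x \<notin> {s} \<and> x \<notin> {r}"
      using atom[of s] atom[of r] sr
      by (intro AE_conjI AE_not_in) (auto simp: null_sets_def emeasure_eq_measure)
    then show "AE x in M. (\<lambda>n. A n x) \<longlonglongrightarrow> pi * indicator {s<..<r} x"
    proof (rule eventually_mono)
      fix x assume x: "x \<notin> {s} \<and> x \<notin> {r}"
      have inf: "filterlim (\<lambda>n. real (Suc n)) at_top sequentially"
        by (rule filterlim_compose[OF filterlim_real_sequentially filterlim_Suc])
      have up: "(\<lambda>n. arctan (c / e n)) \<longlonglongrightarrow> pi / 2" if "0 < c" for c
        unfolding e_def using that
        by (intro filterlim_compose[OF tendsto_arctan_at_top])
          (auto intro!: filterlim_tendsto_pos_mult_at_top[OF tendsto_const _ inf] simp del: of_nat_Suc)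
      have down: "(\<lambda>n. arctan (c / e n)) \<longlonglongrightarrow> - (pi / 2)" if "c < 0" for c
        using tendsto_minus[OF up[of "- c"]] that by (simp add: arctan_minus)
      consider "x < s" | "s < x" "x < r" | "r < x" using x by force
      then show "(\<lambda>n. A n x) \<longlonglongrightarrow> pi * indicator {s<..<r} x"
      proof cases
        case 1
        then show ?thesis using sr tendsto_diff[OF up[of "r - x"] up[of "s - x"]] by (simp add: A_def)
      next
        case 2
        then show ?thesis using sr tendsto_diff[OF up[of "r - x"] down[of "s - x"]] by (simp add: A_def)
      next
        case 3
        then show ?thesis using sr tendsto_diff[OF down[of "r - x"] down[of "s - x"]] by (simp add: A_def)
      qed
    qed
    show "AE x in M. norm (A n x) \<le> pi" for n using A_nonneg[of n] A_le[of n] by simp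
  qed (auto simp: A_meas)
  moreover have "(LINT x|M. pi * indicator {s<..<r} x) = pi * measure M {s<..<r}" by (simp add: spM)
  moreover have "(\<lambda>n. integral {s..r} (\<lambda>t. \<phi> t (e n))) \<longlonglongrightarrow> integral {s..r} (\<lambda>t. \<phi> t 0)"
  proof (rule continuous_on_tendsto_compose[OF _ e0])
    have "continuous_on ({0..1} \<times> cbox s r) (\<lambda>(x, t). \<phi> t x)"
      unfolding split_beta
      by (rule continuous_on_compose2[OF cont[unfolded split_beta], of _ "\<lambda>p. (snd p, fst p)", simplified])
        (auto intro!: continuous_intros)
    from integral_continuous_on_param[OF this]
    show "continuous_on {0..1} (\<lambda>x. integral {s..r} (\<lambda>t. \<phi> t x))" by simp
  qed (use e in \<open>auto intro!: always_eventually less_imp_le\<close>)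
  ultimately have "pi * measure M {s<..<r} = integral {s..r} (\<lambda>t. \<phi> t 0)"
    using LIMSEQ_unique unfolding eq by metis
  then show ?thesis by (simp add: field_simps)
qed

section \<open>Weak derivatives\<close>

lemma sigma_finite_lebesgue: "sigma_finite_measure (lebesgue :: real measure)"
proof
  obtain A :: "real set set" where "countable A" "A \<subseteq> sets lborel" "\<Union>A = space lborel"
      "\<forall>a\<in>A. emeasure lborel a \<noteq> \<infinity>"
    using lborel.sigma_finite_countable by metis
  then show "\<exists>A. countable A \<and> A \<subseteq> sets (lebesgue :: real measure) \<and> \<Union>A = space lebesgue \<and>
      (\<forall>a\<in>A. emeasure lebesgue a \<noteq> \<infinity>)"
    by (intro exI[of _ A]) auto
qed

text \<open>Open intervals are stable under intersection and generate the Borel sets, so a Dynkin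
  argument gives vanishing integrals over all Borel sets, then over Lebesgue sets; a function with
  this property vanishes almost everywhere.\<close>

lemma AE_zero_of_interval_integrals:
  fixes f :: "real \<Rightarrow> complex"
  assumes f: "integrable lebesgue f"
    and zero: "\<And>a b. a < b \<Longrightarrow> (LINT x:{a<..<b}|lebesgue. f x) = 0"
  shows "AE x in lebesgue. f x = 0"
proof -
  interpret sigma_finite_measure "lebesgue :: real measure" by (rule sigma_finite_lebesgue)
  let ?I = "\<lambda>A. LINT x:A|lebesgue. f x"
  have si: "set_integrable lebesgue A f" if "A \<in> sets lebesgue" for A
    using f that unfolding set_integrable_def by (rule integrable_mult_indicator[rotated])
  \<comment> \<open>Needed for the complement step of the Dynkin induction.\<close>
  have total: "(LINT x|lebesgue. f x) = 0"
  proof -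
    have "(\<lambda>n. ?I {- real (Suc n)<..<real (Suc n)}) \<longlonglongrightarrow> ?I (\<Union>n. {- real (Suc n)<..<real (Suc n)})"
      by (rule set_integral_cont_up) (auto simp: incseq_def intro!: si)
    moreover have "(\<Union>n. {- real (Suc n)<..<real (Suc n)}) = UNIV"
    proof -
      have "\<exists>n. - real (Suc n) < x \<and> x < real (Suc n)" for x :: real
      proof -
        obtain n where "\<bar>x\<bar> < real n" using reals_Archimedean2 by blast
        then have "- real (Suc n) < x \<and> x < real (Suc n)" by (simp add: abs_less_iff)
        then show ?thesis by blast
      qed
      then show ?thesis by auto
    qed
    moreover have "?I {- real (Suc n)<..<real (Suc n)} = 0" for n by (rule zero) simp
    ultimately have "?I UNIV = 0" using LIMSEQ_unique[OF tendsto_const, of "0::complex" "?I UNIV"] by simp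
    then show ?thesis by (simp add: set_lebesgue_integral_def)
  qed
  have gen: "sigma_sets UNIV (range (\<lambda>(a, b). {a<..<b::real})) = sets borel"
  proof -
    have "range (\<lambda>(a, b). {a<..<b::real}) = range (\<lambda>(a, b). box a b)" by (simp add: box_real)
    then show ?thesis by (simp only:) (subst borel_eq_box, simp)
  qed
  have borel: "?I A = 0" if "A \<in> sets borel" for A
  proof -
    let ?G = "range (\<lambda>(a, b). {a<..<b::real})"
    have "Int_stable ?G"
    proof (rule Int_stableI)
      fix A B assume "A \<in> ?G" "B \<in> ?G"
      then obtain a b a' b' where "A = {a<..<b}" "B = {a'<..<b'}" by auto
      then have "A \<inter> B = (\<lambda>(a, b). {a<..<b}) (max a a', min b b')" by auto
      then show "A \<inter> B \<in> ?G" by blast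
    qed
    moreover have "?G \<subseteq> Pow UNIV" by simp
    moreover have "A \<in> sigma_sets UNIV ?G"
      using that gen by simp
    ultimately show ?thesis
    proof (induction rule: sigma_sets_induct_disjoint)
      case (basic A)
      then obtain a b where "A = {a<..<b}" by auto
      then show ?case using zero by (cases "a < b") (auto simp: set_lebesgue_integral_def)
    next
      case empty
      show ?case by (simp add: set_lebesgue_integral_def)
    next
      case (compl A)
      then have A: "A \<in> sets lebesgue"
        unfolding gen by simp
      have "?I (A \<union> (UNIV - A)) = ?I A + ?I (UNIV - A)"
        using A by (intro set_integral_Un si) auto
      then show ?case using compl total by (simp add: set_lebesgue_integral_def)
    next
      case (union A)
      have A: "A i \<in> sets lebesgue" for i
        using union.hyps(2) unfolding gen by auto
      have "?I (\<Union>i. A i) = (\<Sum>i. ?I (A i))"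
        using union.hyps(1) A by (intro lebesgue_integral_countable_add si) (auto simp: disjoint_family_on_def)
      then show ?case using union.IH by simp
    qed
  qed
  show ?thesis
  proof (rule density_zero[OF f])
    fix A :: "real set" assume A: "A \<in> sets lebesgue"
    \<comment> \<open>A Lebesgue set differs from its Borel \<open>main_part\<close> by a null set,
      which reduces the claim to the Borel case.\<close>
    obtain M where M: "M \<in> null_sets lborel" "null_part lborel A \<subseteq> M" using null_part[OF A] by blast
    have "AE x in lebesgue. x \<notin> M" using M(1) by (intro AE_not_in null_sets_completionI)
    then have AE_main: "AE x in lebesgue. x \<in> main_part lborel A \<longleftrightarrow> x \<in> A"
      by eventually_elim (use M(2) main_part_null_part_Un[OF A] in blast)
    have "?I A = ?I (main_part lborel A)"
 
      using A main_part_sets[OF A] AE_main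
      by (intro set_integral_cong_set)
        (auto simp: set_borel_measurable_def intro!: borel_measurable_integrable si[unfolded set_integrable_def])
    then show "?I A = 0" using borel[of "main_part lborel A"] main_part_sets[OF A] by simp
  qed
qed

text \<open>The polynomial \<open>P\<close> and the exponent \<open>k\<close> are there to make the
  family stable under differentiation; letting \<open>c\<close> tend to 0 with \<open>P = 1\<close>
  and \<open>k = 0\<close> recovers the indicator of the interval.\<close>

definition bump :: "real \<Rightarrow> real \<Rightarrow> real \<Rightarrow> real poly \<Rightarrow> nat \<Rightarrow> real \<Rightarrow> real" where
  "bump \<alpha> \<beta> c P k x = (if \<alpha> < x \<and> x < \<beta>
     then poly P x / ((x - \<alpha>) * (\<beta> - x)) ^ k * exp (- c / ((x - \<alpha>) * (\<beta> - x))) else 0)"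

text \<open>With \<open>q\<close> the quadratic \<open>(y - \<alpha>) * (\<beta> - y)\<close>, the
  single term of order \<open>n = k + 2\<close> in the exponential series bounds
  \<open>exp (- c / q)\<close> by a multiple of \<open>q ^ n\<close>. Of these powers
  \<open>k\<close> cancel the denominator and two remain; quadratic vanishing is what makes the
  derivative zero at the end points.\<close>

lemma bump_quadratic:
  assumes ab: "\<alpha> < \<beta>" and c: "0 < c"
  obtains M where "\<And>y. \<bar>bump \<alpha> \<beta> c P k y\<bar> \<le> M * ((y - \<alpha>) * (\<beta> - y))\<^sup>2"
proof -
  have "bounded (poly P ` {\<alpha>..\<beta>})"
    by (intro compact_imp_bounded compact_continuous_image continuous_intros) auto
  then obtain K where K: "\<And>y. y \<in> {\<alpha>..\<beta>} \<Longrightarrow> \<bar>poly P y\<bar> \<le> K"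
    by (fastforce simp: bounded_iff)
  define n where "n = k + 2"
  have "\<bar>bump \<alpha> \<beta> c P k y\<bar> \<le> (K * (fact n / c ^ n)) * ((y - \<alpha>) * (\<beta> - y))\<^sup>2" for y
  proof (cases "\<alpha> < y \<and> y < \<beta>")
    case True
    define q where "q = (y - \<alpha>) * (\<beta> - y)"
    have q: "0 < q" using True by (simp add: q_def)
    have "(c / q) ^ n / fact n = (\<Sum>i\<in>{n}. (c / q) ^ i /\<^sub>R fact i)" by (simp add: divide_inverse)
    also have "\<dots> \<le> (\<Sum>i. (c / q) ^ i /\<^sub>R fact i)"
      using c q by (intro sum_le_suminf summable_exp_generic) auto
    finally have "(c / q) ^ n / fact n \<le> exp (c / q)" by (simp add: exp_def)
    then have "exp (- c / q) \<le> fact n / c ^ n * q ^ n"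
      using c q by (simp add: exp_minus field_simps power_divide)
    then have "\<bar>poly P y\<bar> / q ^ k * exp (- c / q) \<le> K / q ^ k * (fact n / c ^ n * q ^ n)"
      using q True K[of y] by (intro mult_mono divide_right_mono) auto
    also have "\<dots> = K * (fact n / c ^ n) * q\<^sup>2"
      using q by (simp add: n_def power_add power2_eq_square)
    finally show ?thesis using True q by (simp add: bump_def abs_mult q_def[symmetric])
  next
    case False
    have "0 \<le> K" using K[of \<alpha>] ab by auto
    with False c show ?thesis by (auto simp: bump_def)
  qed
  then show ?thesis by (rule that)
qed

text \<open>The family is closed under differentiation, so its members are smooth.\<close>

lemma bump_has_derivative:
  assumes ab: "\<alpha> < \<beta>" and c: "0 < c"
  obtains P' k' where "\<And>x. (bump \<alpha> \<beta> c P k has_real_derivative bump \<alpha> \<beta> c P' k' x) (at x)"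
proof
  define q where "q = [:- \<alpha> * \<beta>, \<alpha> + \<beta>, - 1:]"
  have q: "poly q x = (x - \<alpha>) * (\<beta> - x)" for x by (simp add: q_def algebra_simps)
  \<comment> \<open>The product rule applied to \<open>P\<close>, \<open>q ^ (- k)\<close> and
    \<open>exp (- c / q)\<close>, brought to the common denominator
    \<open>q ^ (k + 2)\<close>.\<close>
  define P' where "P' = pderiv P * q ^ 2 - smult (of_nat k) (P * pderiv q * q) + smult c (P * pderiv q)"
  fix x
  show "(bump \<alpha> \<beta> c P k has_real_derivative bump \<alpha> \<beta> c P' (k + 2) x) (at x)"
  proof (cases "\<alpha> < x \<and> x < \<beta>")
    case True
    then have qx: "poly q x > 0" by (simp add: q)
    have b: "bump \<alpha> \<beta> c R l y = poly R y * inverse (poly q y) ^ l * exp (- c * inverse (poly q y))"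
      if "\<alpha> < y \<and> y < \<beta>" for R l y
      using that unfolding bump_def q[symmetric] by (simp add: divide_inverse power_inverse)
    define v where "v = inverse (poly q x)"
    have v: "0 < v" "poly q x * v = 1" using qx by (auto simp: v_def)
    have v1: "v ^ k = (poly q x)\<^sup>2 * v ^ (k + 2)"
    proof -
      have "(poly q x)\<^sup>2 * v ^ (k + 2) = (poly q x * v)\<^sup>2 * v ^ k" by (simp add: power_add power2_eq_square)
      then show ?thesis using v(2) by simp
    qed
    \<comment> \<open>Truncated subtraction in \<open>k - 1\<close> makes \<open>k = 0\<close> a
      separate case, where both sides vanish.\<close>
    have v2: "of_nat k * v ^ (k - 1) * v\<^sup>2 = of_nat k * poly q x * v ^ (k + 2)"
    proof (cases k)
      case (Suc m)
      then have "poly q x * v ^ (k + 2) = (poly q x * v) * (v ^ m * v\<^sup>2)" by (simp add: power2_eq_square)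
      then show ?thesis using v(2) Suc by (simp del: power_Suc of_nat_Suc add: mult.assoc)
    qed simp
    have dv: "((\<lambda>x. inverse (poly q x)) has_real_derivative - (v\<^sup>2 * poly (pderiv q) x)) (at x)"
      using qx by (auto intro!: derivative_eq_intros simp: v_def power2_eq_square)
    have "((\<lambda>x. poly P x * inverse (poly q x) ^ k * exp (- c * inverse (poly q x))) has_real_derivative
        poly (pderiv P) x * v ^ k * exp (- c * v) -
        poly P x * (of_nat k * v ^ (k - 1) * (v\<^sup>2 * poly (pderiv q) x)) * exp (- c * v) +
        poly P x * v ^ k * (exp (- c * v) * (c * (v\<^sup>2 * poly (pderiv q) x)))) (at x)"
      by (rule derivative_eq_intros dv refl)+ (simp add: v_def algebra_simps)
    also have "poly (pderiv P) x * v ^ k * exp (- c * v) -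
        poly P x * (of_nat k * v ^ (k - 1) * (v\<^sup>2 * poly (pderiv q) x)) * exp (- c * v) +
        poly P x * v ^ k * (exp (- c * v) * (c * (v\<^sup>2 * poly (pderiv q) x))) =
        (poly (pderiv P) x * v ^ k - poly P x * poly (pderiv q) x * (of_nat k * v ^ (k - 1) * v\<^sup>2) +
         c * poly P x * poly (pderiv q) x * v ^ (k + 2)) * exp (- c * v)"
      by (simp add: power_add power2_eq_square algebra_simps)
    also have "\<dots> = bump \<alpha> \<beta> c P' (k + 2) x"
      unfolding b[OF True] v_def[symmetric] P'_def v2 by (subst v1) (simp add: algebra_simps)
    finally show ?thesis
      by (rule has_field_derivative_transform_within_open[of _ _ _ "{\<alpha><..<\<beta>}"])
        (use True b in auto)
  next
    case False
    obtain M where M: "\<And>y. \<bar>bump \<alpha> \<beta> c P k y\<bar> \<le> M * ((y - \<alpha>) * (\<beta> - y))\<^sup>2"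
      using bump_quadratic[OF ab c] by blast
    have "0 \<le> M"
      using order_trans[OF abs_ge_zero M[of "(\<alpha> + \<beta>) / 2"]] ab by (auto simp: zero_le_mult_iff)
    \<comment> \<open>The point \<open>x\<close> lies outside the open interval, so the distance of
      \<open>y\<close> to one of the ends is at most \<open>|y - x|\<close>. The function is then of
      order \<open>(y - x)^2\<close> and its difference quotient at \<open>x\<close> tends to
      0.\<close>
    have bound: "\<bar>bump \<alpha> \<beta> c P k y\<bar> \<le> (M * (\<beta> - \<alpha>)\<^sup>2) * (y - x)\<^sup>2" for y
    proof (cases "\<alpha> < y \<and> y < \<beta>")
      case True
      have "(y - \<alpha>) * (\<beta> - y) \<le> (\<beta> - \<alpha>) * \<bar>y - x\<bar>"
      proof (cases "x \<le> \<alpha>")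
        case True
        then have "(y - \<alpha>) * (\<beta> - y) \<le> \<bar>y - x\<bar> * (\<beta> - \<alpha>)"
          using \<open>\<alpha> < y \<and> y < \<beta>\<close> by (intro mult_mono) auto
        then show ?thesis by (simp add: mult.commute)
      next
        case False
        then show ?thesis using \<open>\<alpha> < y \<and> y < \<beta>\<close> \<open>\<not> (\<alpha> < x \<and> x < \<beta>)\<close> by (intro mult_mono) auto
      qed
      then have "((y - \<alpha>) * (\<beta> - y))\<^sup>2 \<le> ((\<beta> - \<alpha>) * \<bar>y - x\<bar>)\<^sup>2"
        using True by (intro power_mono) auto
      then show ?thesis
        using M[of y] mult_left_mono[OF _ \<open>0 \<le> M\<close>] by (fastforce simp: power_mult_distrib mult.assoc)
    next
      case False
      then show ?thesis using \<open>0 \<le> M\<close> by (auto simp: bump_def)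
    qed
    have "((\<lambda>h. (bump \<alpha> \<beta> c P k (x + h) - bump \<alpha> \<beta> c P k x) / h) \<longlongrightarrow> 0) (at 0)"
    proof (rule Lim_null_comparison)
      show "\<forall>\<^sub>F h in at 0. norm ((bump \<alpha> \<beta> c P k (x + h) - bump \<alpha> \<beta> c P k x) / h) \<le> (M * (\<beta> - \<alpha>)\<^sup>2) * \<bar>h\<bar>"
      proof (rule always_eventually, rule allI)
        fix h :: real
        show "norm ((bump \<alpha> \<beta> c P k (x + h) - bump \<alpha> \<beta> c P k x) / h) \<le> (M * (\<beta> - \<alpha>)\<^sup>2) * \<bar>h\<bar>"
          using bound[of "x + h"] False
          by (cases "h = 0") (auto simp: bump_def divide_le_eq abs_mult power2_eq_square mult.assoc split: if_splits)
      qed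
      show "((\<lambda>h. (M * (\<beta> - \<alpha>)\<^sup>2) * \<bar>h\<bar>) \<longlongrightarrow> 0) (at 0)"
        by (auto intro!: tendsto_eq_intros)
    qed
    moreover have "bump \<alpha> \<beta> c P' (k + 2) x = 0" using False by (auto simp: bump_def)
    ultimately show ?thesis by (simp only: DERIV_def)
  qed
qed

lemma test_function_bump:
  assumes "0 < \<alpha>" "\<alpha> < \<beta>" "0 < c"
  shows "test_function (bump \<alpha> \<beta> c P k)"
proof -
  have "\<exists>P' k'. (deriv ^^ m) (bump \<alpha> \<beta> c P k) = bump \<alpha> \<beta> c P' k'" for m
  proof (induction m)
    case 0
    then show ?case by auto
  next
    case (Suc m)
    then obtain P1 k1 where 1: "(deriv ^^ m) (bump \<alpha> \<beta> c P k) = bump \<alpha> \<beta> c P1 k1" by blast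
    obtain P2 k2 where "\<And>x. (bump \<alpha> \<beta> c P1 k1 has_real_derivative bump \<alpha> \<beta> c P2 k2 x) (at x)"
      using bump_has_derivative[OF assms(2,3)] by blast
    then have "deriv (bump \<alpha> \<beta> c P1 k1) = bump \<alpha> \<beta> c P2 k2" by (auto intro!: DERIV_imp_deriv)
    with 1 show ?case by auto
  qed
  moreover have "bump \<alpha> \<beta> c P' k' field_differentiable at x" for P' k' x
    using bump_has_derivative[OF assms(2,3)] by (metis field_differentiable_def)
  ultimately have "(deriv ^^ m) (bump \<alpha> \<beta> c P k) field_differentiable at x" for m x by metis
  then show ?thesis
    unfolding test_function_def
    using assms by (intro conjI allI exI[of _ \<alpha>] exI[of _ \<beta>]) (auto simp: bump_def)
qed

lemma bump_tendsto_indicator: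
  assumes "\<alpha> < \<beta>"
  shows "(\<lambda>n. bump \<alpha> \<beta> (1 / real (Suc n)) 1 0 x) \<longlonglongrightarrow> indicator {\<alpha><..<\<beta>} x"
proof (cases "\<alpha> < x \<and> x < \<beta>")
  case True
  have "(\<lambda>n. exp (- (1 / real (Suc n)) / ((x - \<alpha>) * (\<beta> - x)))) \<longlonglongrightarrow> exp (- 0 / ((x - \<alpha>) * (\<beta> - x)))"
    using True by (intro tendsto_intros LIMSEQ_inverse_real_of_nat[unfolded inverse_eq_divide]) auto
  then show ?thesis using True by (simp add: bump_def)
qed (auto simp: bump_def)

section \<open>The fundamental lemma of the calculus of variations on a branch\<close>

lemma integrable_branch:
  fixes f :: "real \<Rightarrow> 'a::{banach, second_countable_topology}"
  assumes "integrable lebesgue f"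
  shows "integrable branch f"
proof (subst integrable_restrict_space)
  show "integrable lebesgue (\<lambda>x. indicat_real {0<..} x *\<^sub>R f x)"
    using assms by (intro integrable_mult_indicator) simp_all
qed simp

lemma indicator_branch: "A \<in> sets borel \<Longrightarrow> indicat_real A \<in> borel_measurable branch"
  by (intro measurable_restrict_space1 borel_measurable_indicator) auto

lemma continuous_compact_support_L2:
  fixes f :: "real \<Rightarrow> complex"
  assumes "continuous_on UNIV f" and supp: "\<And>x. x \<notin> {r..s} \<Longrightarrow> f x = 0"
  shows "f \<in> L2_branch"
proof -
  have "f \<in> borel_measurable borel" using assms(1) by (rule borel_measurable_continuous_onI)
  then have m: "f \<in> borel_measurable branch"
    by (intro measurable_restrict_space1 measurable_completion) simp
  have "integrable lborel (\<lambda>x. indicator {r..s} x *\<^sub>R (cmod (f x))\<^sup>2)"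
    by (intro borel_integrable_compact continuous_intros continuous_on_subset[OF assms(1)]) auto
  moreover have "(\<lambda>x. indicator {r..s} x *\<^sub>R (cmod (f x))\<^sup>2) = (\<lambda>x. (cmod (f x))\<^sup>2)"
    using supp by (auto simp: fun_eq_iff indicator_def)
  ultimately have "integrable lebesgue (\<lambda>x. (cmod (f x))\<^sup>2)"
    by (simp add: integrable_completion)
  then have "integrable branch (\<lambda>x. (cmod (f x))\<^sup>2)" by (rule integrable_branch)
  with m show ?thesis by (simp add: L2_branch_def)
qed

lemma test_functionD:
  assumes "test_function \<phi>"
  shows "(\<phi> has_real_derivative deriv \<phi> x) (at x)"
    and "continuous_on UNIV \<phi>" "continuous_on UNIV (deriv \<phi>)"
    and "(\<lambda>x. of_real (\<phi> x)) \<in> L2_branch" "(\<lambda>x. of_real (deriv \<phi> x)) \<in> L2_branch"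
proof -
  have d: "(deriv ^^ m) \<phi> field_differentiable at x" for m x
    using assms by (simp add: test_function_def)
  show 1: "(\<phi> has_real_derivative deriv \<phi> x) (at x)" for x
    using d[of 0 x] by (simp add: DERIV_deriv_iff_field_differentiable)
  have "(deriv \<phi> has_real_derivative deriv (deriv \<phi>) x) (at x)" for x
    using d[of 1 x] by (simp add: DERIV_deriv_iff_field_differentiable)
  with 1 show c: "continuous_on UNIV \<phi>" "continuous_on UNIV (deriv \<phi>)"
    by (auto intro!: continuous_at_imp_continuous_on intro: DERIV_isCont)
  obtain r s where supp: "\<And>x. x \<notin> {r..s} \<Longrightarrow> \<phi> x = 0"
    using assms by (auto simp: test_function_def)
  have "deriv \<phi> x = 0" if x: "x \<notin> {r..s}" for x
  proof -
    have "(\<phi> has_real_derivative 0) (at x)"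
      by (rule has_field_derivative_transform_within_open[of "\<lambda>_. 0" _ _ "- {r..s}"])
        (use supp x in \<open>auto intro!: derivative_eq_intros open_Compl\<close>)
    then show ?thesis by (rule DERIV_imp_deriv)
  qed
  with supp c show "(\<lambda>x. of_real (\<phi> x)) \<in> L2_branch" "(\<lambda>x. of_real (deriv \<phi> x)) \<in> L2_branch"
    by (intro continuous_compact_support_L2[of _ r s] continuous_on_of_real; simp)+
qed

lemma L2_test_integrable:
  assumes "v \<in> L2_branch" "(\<lambda>x. of_real (g x)) \<in> L2_branch"
  shows "integrable branch (\<lambda>x. v x * of_real (g x))"
  using L2_mult_integrable[OF assms] by simp

text \<open>Bumps converge boundedly to indicators of intervals compactly contained in the branch,
  so the integrals of \<open>v\<close> over these intervals vanish, which forces \<open>v\<close> to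
  be zero.\<close>

lemma L2_orthogonal_test_functions:
  assumes v: "v \<in> L2_branch"
    and zero: "\<And>\<phi>. test_function \<phi> \<Longrightarrow> (LINT x|branch. v x * of_real (\<phi> x)) = 0"
  shows "AE x in branch. v x = 0"
proof -
  have vm: "v \<in> borel_measurable branch" using v by (rule L2_branchD)
  \<comment> \<open>On a bounded interval square integrability suffices, by
    \<open>|v| <= |v|^2 + 1\<close>.\<close>
  have vi: "integrable branch (\<lambda>x. indicator {a..b} x *\<^sub>R v x)" if "0 < a" for a b
  proof (rule Bochner_Integration.integrable_bound)
    have "integrable lebesgue (indicat_real {a..b})"
      by (intro integrable_completion[THEN iffD2] integrable_real_indicator) (auto simp: emeasure_lborel_Icc_eq)
    then have "integrable branch (indicat_real {a..b})" by (rule integrable_branch)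
    then show "integrable branch (\<lambda>x. (cmod (v x))\<^sup>2 + indicator {a..b} x)"
      using L2_branchD(2)[OF v] by simp
    have "indicator {a..b} x * cmod (v x) \<le> (cmod (v x))\<^sup>2 + indicator {a..b} x" for x
    proof -
      have "cmod (v x) \<le> (cmod (v x))\<^sup>2 + 1"
        using sum_squares_bound[of "cmod (v x)" 1] norm_ge_zero[of "v x"]
        unfolding power_one mult_1_right by linarith
      then show ?thesis by (cases "x \<in> {a..b}") auto
    qed
    then show "AE x in branch. norm (indicator {a..b} x *\<^sub>R v x) \<le> norm ((cmod (v x))\<^sup>2 + indicator {a..b} x)"
      by (auto simp: abs_of_nonneg)
    show "(\<lambda>x. indicator {a..b} x *\<^sub>R v x) \<in> borel_measurable branch"
      using vm by (intro borel_measurable_scaleR indicator_branch) auto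
  qed
  have int0: "(LINT x|branch. indicator {a<..<b} x *\<^sub>R v x) = 0" if ab: "0 < a" "a < b" for a b
  proof -
    let ?\<phi> = "\<lambda>n. bump a b (1 / real (Suc n)) 1 0"
    have "(\<lambda>n. LINT x|branch. v x * of_real (?\<phi> n x)) \<longlonglongrightarrow> (LINT x|branch. indicator {a<..<b} x *\<^sub>R v x)"
    proof (rule integral_dominated_convergence)
      show "integrable branch (\<lambda>x. norm (indicator {a..b} x *\<^sub>R v x))"
        using vi[OF ab(1)] by (rule integrable_norm)
      show "(\<lambda>x. indicator {a<..<b} x *\<^sub>R v x) \<in> borel_measurable branch"
        using vm by (intro borel_measurable_scaleR indicator_branch) auto
      show "(\<lambda>x. v x * of_real (?\<phi> n x)) \<in> borel_measurable branch" for n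
        using v ab by (intro borel_measurable_integrable L2_test_integrable test_functionD test_function_bump) auto
      show "AE x in branch. (\<lambda>n. v x * of_real (?\<phi> n x)) \<longlonglongrightarrow> indicator {a<..<b} x *\<^sub>R v x"
      proof (rule AE_I2)
        fix x
        show "(\<lambda>n. v x * of_real (?\<phi> n x)) \<longlonglongrightarrow> indicator {a<..<b} x *\<^sub>R v x"
          using tendsto_mult_left[OF tendsto_of_real[OF bump_tendsto_indicator[OF ab(2), of x]], of "v x"]
          by (simp add: scaleR_conv_of_real mult.commute)
      qed
      show "AE x in branch. norm (v x * of_real (?\<phi> n x)) \<le> norm (indicator {a..b} x *\<^sub>R v x)" for n
        by (intro AE_I2) (auto simp: bump_def norm_mult indicator_def mult_left_le)
    qed
    moreover have "(LINT x|branch. v x * of_real (?\<phi> n x)) = 0" for n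
      using ab by (intro zero test_function_bump) auto
    ultimately show ?thesis using LIMSEQ_unique[OF tendsto_const] by fastforce
  qed
  \<comment> \<open>\<open>v\<close> need not be integrable on the whole branch; the truncations are
    integrable on the line, and countably many of them cover the branch.\<close>
  define V where "V n x = indicator {1 / real (Suc n)<..<real (Suc n)} x *\<^sub>R v x" for n x
  have V0: "AE x in lebesgue. V n x = 0" for n
  proof (rule AE_zero_of_interval_integrals)
    have pos: "0 < 1 / real (Suc n)" by simp
    have eq: "indicator {0<..} x *\<^sub>R (indicator {a<..<b} x *\<^sub>R v x) = indicator {a<..<b} x *\<^sub>R v x"
      if "0 < a" for a b x
      using that by (auto simp: indicator_def)
    have "integrable branch (V n)"
    proof (rule Bochner_Integration.integrable_bound[OF vi[OF pos]])
      show "V n \<in> borel_measurable branch"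
        unfolding V_def using vm by (intro borel_measurable_scaleR indicator_branch) auto
      show "AE x in branch. norm (V n x) \<le> norm (indicator {1 / real (Suc n)..real (Suc n)} x *\<^sub>R v x)"
        by (intro AE_I2) (auto simp: V_def indicator_def simp del: of_nat_Suc)
    qed
    then have "integrable lebesgue (\<lambda>x. indicat_real {0<..} x *\<^sub>R V n x)"
      by (subst (asm) integrable_restrict_space) auto
    then show "integrable lebesgue (V n)" unfolding V_def eq[OF pos] .
    fix a b :: real assume "a < b"
    let ?a = "max a (1 / real (Suc n))" and ?b = "min b (real (Suc n))"
    have pos': "0 < ?a" using pos by linarith
    have "(LINT x:{a<..<b}|lebesgue. V n x) = (LINT x|lebesgue. indicator {?a<..<?b} x *\<^sub>R v x)"
      unfolding set_lebesgue_integral_def V_def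
      by (intro Bochner_Integration.integral_cong refl) (auto simp: indicator_def simp del: of_nat_Suc)
    also have "\<dots> = (LINT x|branch. indicator {?a<..<?b} x *\<^sub>R v x)"
      by (subst integral_restrict_space) (simp_all only: eq[OF pos'], simp)
    also have "\<dots> = 0"
      using int0[OF pos', of ?b] by (cases "?a < ?b") auto
    finally show "(LINT x:{a<..<b}|lebesgue. V n x) = 0" .
  qed
  have "AE x in lebesgue. \<forall>n. V n x = 0" using V0 by (simp add: AE_all_countable)
  then have "AE x in lebesgue. x \<in> {0<..} \<longrightarrow> v x = 0"
  proof eventually_elim
    case (elim x)
    show ?case
    proof
      assume x: "x \<in> {0<..}"
      obtain m where m: "x < real m" using reals_Archimedean2 by blast
      obtain k where k: "1 / real (Suc k) < x" using x reals_Archimedean[of x] by (auto simp: inverse_eq_divide)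
      have "1 / real (Suc (max m k)) \<le> 1 / real (Suc k)" by (auto simp: field_simps)
      then have "x \<in> {1 / real (Suc (max m k))<..<real (Suc (max m k))}" using m k by auto
      then show "v x = 0" using elim by (auto simp: V_def dest: spec[of _ "max m k"])
    qed
  qed
  then show ?thesis by (subst AE_restrict_space_iff) auto
qed

lemma weak_derivative_unique:
  assumes "v \<in> L2_branch" "v' \<in> L2_branch" "weak_derivative u v" "weak_derivative u v'"
  shows "AE x in branch. v x = v' x"
proof -
  have "(\<lambda>x. (- 1) * v' x + v x) \<in> L2_branch" using assms by (intro L2_branch_comb)
  then have "AE x in branch. (- 1) * v' x + v x = 0"
  proof (rule L2_orthogonal_test_functions)
    fix \<phi> assume \<phi>: "test_function \<phi>"
    note i = L2_test_integrable[OF _ test_functionD(4)[OF \<phi>]]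
    have "(LINT x|branch. ((- 1) * v' x + v x) * of_real (\<phi> x)) =
        (LINT x|branch. v x * of_real (\<phi> x)) - (LINT x|branch. v' x * of_real (\<phi> x))"
      using i[OF assms(1)] i[OF assms(2)] by (simp add: algebra_simps)
    then show "(LINT x|branch. ((- 1) * v' x + v x) * of_real (\<phi> x)) = 0"
      using assms(3)[unfolded weak_derivative_def, rule_format, OF \<phi>]
        assms(4)[unfolded weak_derivative_def, rule_format, OF \<phi>] by simp
  qed
  then show ?thesis by simp
qed

lemma weak_derivative_comb:
  assumes "u \<in> L2_branch" "u' \<in> L2_branch" "v \<in> L2_branch" "v' \<in> L2_branch"
    and "weak_derivative u v" "weak_derivative u' v'"
  shows "weak_derivative (\<lambda>x. z * u x + u' x) (\<lambda>x. z * v x + v' x)"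
  unfolding weak_derivative_def
proof (intro allI impI)
  fix \<phi> assume \<phi>: "test_function \<phi>"
  note i = L2_test_integrable[OF _ test_functionD(4)[OF \<phi>]] L2_test_integrable[OF _ test_functionD(5)[OF \<phi>]]
  have "(LINT x|branch. (z * f x + g x) * of_real (h x)) =
      z * (LINT x|branch. f x * of_real (h x)) + (LINT x|branch. g x * of_real (h x))"
    if "integrable branch (\<lambda>x. f x * of_real (h x))" "integrable branch (\<lambda>x. g x * of_real (h x))"
    for f g :: "real \<Rightarrow> complex" and h :: "real \<Rightarrow> real"
    using that by (simp add: distrib_right mult.assoc)
  then show "(LINT x|branch. (z * u x + u' x) * of_real (deriv \<phi> x)) =
      - (LINT x|branch. (z * v x + v' x) * of_real (\<phi> x))"
    using assms \<phi> i by (simp add: weak_derivative_def)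
qed

lemma weak_derivative_cong:
  assumes "u \<in> L2_branch" "u' \<in> L2_branch" "AE x in branch. u x = u' x" "weak_derivative u v"
  shows "weak_derivative u' v"
  unfolding weak_derivative_def
proof (intro allI impI)
  fix \<phi> assume \<phi>: "test_function \<phi>"
  note i = L2_test_integrable[OF _ test_functionD(5)[OF \<phi>]]
  have "(LINT x|branch. u' x * of_real (deriv \<phi> x)) = (LINT x|branch. u x * of_real (deriv \<phi> x))"
    using assms(3) by (intro integral_cong_AE borel_measurable_integrable i assms) auto
  then show "(LINT x|branch. u' x * of_real (deriv \<phi> x)) = - (LINT x|branch. v x * of_real (\<phi> x))"
    using assms(4) \<phi> by (simp add: weak_derivative_def)
qed

lemma wderiv:
  assumes "v \<in> L2_branch" "weak_derivative u v"
  shows "wderiv u \<in> L2_branch" "weak_derivative u (wderiv u)" "AE x in branch. wderiv u x = v x"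
proof -
  show "wderiv u \<in> L2_branch" "weak_derivative u (wderiv u)"
    using someI[of "\<lambda>v. v \<in> L2_branch \<and> weak_derivative u v" v] assms by (simp_all add: wderiv_def)
  then show "AE x in branch. wderiv u x = v x"
    using assms by (intro weak_derivative_unique)
qed

text \<open>The inner \<open>wderiv u\<close> is an arbitrary choice that agrees with
  \<open>v\<close> only almost everywhere, so the weak derivative \<open>v2\<close> of
  \<open>v\<close> has to be transferred to it before the uniqueness result applies.\<close>

lemma wderiv2:
  assumes "v \<in> L2_branch" "weak_derivative u v" "v2 \<in> L2_branch" "weak_derivative v v2"
  shows "wderiv (wderiv u) \<in> L2_branch" "weak_derivative (wderiv u) (wderiv (wderiv u))"
    "AE x in branch. wderiv (wderiv u) x = v2 x"
proof -
  have "weak_derivative (wderiv u) v2"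
  proof (rule weak_derivative_cong[OF assms(1) _ _ assms(4)])
    show "AE x in branch. v x = wderiv u x"
      using wderiv(3)[OF assms(1,2)] by (rule eventually_mono) (rule sym)
  qed (rule wderiv(1)[OF assms(1,2)])
  from wderiv[OF assms(3) this] show "wderiv (wderiv u) \<in> L2_branch"
    "weak_derivative (wderiv u) (wderiv (wderiv u))" "AE x in branch. wderiv (wderiv u) x = v2 x" by auto
qed

lemma sobolev_H2D:
  assumes "u \<in> sobolev_H2"
  shows "u \<in> L2_branch" "wderiv u \<in> L2_branch" "weak_derivative u (wderiv u)"
    "wderiv (wderiv u) \<in> L2_branch" "weak_derivative (wderiv u) (wderiv (wderiv u))"
proof -
  obtain v v2 where "v \<in> L2_branch" "weak_derivative u v" "v2 \<in> L2_branch" "weak_derivative v v2"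
    using assms by (auto simp: sobolev_H2_def)
  note this = wderiv(1,2)[OF this(1,2)] wderiv2(1,2)[OF this]
  from this show "wderiv u \<in> L2_branch" "weak_derivative u (wderiv u)"
    "wderiv (wderiv u) \<in> L2_branch" "weak_derivative (wderiv u) (wderiv (wderiv u))" .
  show "u \<in> L2_branch" using assms by (simp add: sobolev_H2_def)
qed

lemma sobolev_H2_comb:
  assumes "u \<in> sobolev_H2" "u' \<in> sobolev_H2"
  shows "(\<lambda>x. z * u x + u' x) \<in> sobolev_H2"
    and "AE x in branch. wderiv (wderiv (\<lambda>x. z * u x + u' x)) x = z * wderiv (wderiv u) x + wderiv (wderiv u') x"
proof -
  note D = sobolev_H2D[OF assms(1)] sobolev_H2D[OF assms(2)]
  have 1: "(\<lambda>x. z * wderiv u x + wderiv u' x) \<in> L2_branch"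
    "weak_derivative (\<lambda>x. z * u x + u' x) (\<lambda>x. z * wderiv u x + wderiv u' x)"
    using D by (auto intro!: L2_branch_comb weak_derivative_comb)
  have 2: "(\<lambda>x. z * wderiv (wderiv u) x + wderiv (wderiv u') x) \<in> L2_branch"
    "weak_derivative (\<lambda>x. z * wderiv u x + wderiv u' x) (\<lambda>x. z * wderiv (wderiv u) x + wderiv (wderiv u') x)"
    using D by (auto intro!: L2_branch_comb weak_derivative_comb)
  show "(\<lambda>x. z * u x + u' x) \<in> sobolev_H2"
    using 1 2 L2_branch_comb[OF D(1,6)] unfolding sobolev_H2_def by blast
  show "AE x in branch. wderiv (wderiv (\<lambda>x. z * u x + u' x)) x = z * wderiv (wderiv u) x + wderiv (wderiv u') x"
    by (rule wderiv2[OF 1 2])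
qed

text \<open>Integration by parts against a test function. Continuity of \<open>u\<close> rules out
  jump terms at the points of \<open>S\<close>; such a point occurs for the first derivative of the
  resolvent, which has a kink at the end of the source interval.\<close>

lemma weak_derivative_classical:
  assumes u: "u \<in> L2_branch" "continuous_on {0..} u" and v: "v \<in> L2_branch"
    and S: "finite S" and d: "\<And>x. 0 < x \<Longrightarrow> x \<notin> S \<Longrightarrow> (u has_vector_derivative v x) (at x)"
  shows "weak_derivative u v"
  unfolding weak_derivative_def
proof (intro allI impI)
  fix \<phi> assume \<phi>: "test_function \<phi>"
  obtain r s where r: "0 < r" and supp: "\<And>x. x \<notin> {r..s} \<Longrightarrow> \<phi> x = 0"
    using \<phi> by (auto simp: test_function_def)
  define b where "b = max r s + 1"
  \<comment> \<open>Both ends of \<open>[r / 2, b]\<close> lie outside the support, so the boundary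
    terms vanish.\<close>
  have b: "r / 2 \<le> b" "r / 2 < r" "s < b" using r by (auto simp: b_def)
  let ?g = "\<lambda>x. v x * of_real (\<phi> x) + u x * of_real (deriv \<phi> x)"
  have "(?g has_integral (u b * of_real (\<phi> b) - u (r/2) * of_real (\<phi> (r/2)))) {r/2..b}"
  proof (rule fundamental_theorem_of_calculus_interior_strong[OF S b(1)])
    fix x assume x: "x \<in> {r/2<..<b} - S"
    have "((\<lambda>x. complex_of_real (\<phi> x)) has_vector_derivative of_real (deriv \<phi> x)) (at x)"
      using has_vector_derivative_of_real[OF test_functionD(1)[OF \<phi>]] by auto
    moreover have "(u has_vector_derivative v x) (at x)" using d x r by auto
    ultimately show "((\<lambda>x. u x * of_real (\<phi> x)) has_vector_derivative ?g x) (at x)"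
      using has_vector_derivative_mult[of u "v x" x UNIV] by (subst add.commute) blast
  next
    show "continuous_on {r/2..b} (\<lambda>x. u x * of_real (\<phi> x))"
      using r by (intro continuous_intros continuous_on_subset[OF u(2)] continuous_on_subset[OF test_functionD(2)[OF \<phi>]]) auto
  qed
  moreover have "\<phi> b = 0" "\<phi> (r/2) = 0" using b by (auto intro!: supp)
  ultimately have "(?g has_integral 0) {r/2..b}" by simp
  then have "(?g has_integral 0) {0<..}"
  proof (rule has_integral_on_superset)
    fix x assume "x \<notin> {r/2..b}"
    then have x: "x \<in> - {r..s}" using b by auto
    have "(\<phi> has_real_derivative 0) (at x)"
      by (rule has_field_derivative_transform_within_open[of "\<lambda>_. 0" _ _ "- {r..s}"])
        (use supp x in \<open>auto intro!: derivative_eq_intros open_Compl\<close>)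
    then have "deriv \<phi> x = 0" by (rule DERIV_imp_deriv)
    then show "?g x = 0" using supp x by simp
  qed (use r in auto)
  moreover have i: "integrable branch (\<lambda>x. v x * of_real (\<phi> x))" "integrable branch (\<lambda>x. u x * of_real (deriv \<phi> x))"
    using u(1) v by (auto intro!: L2_test_integrable test_functionD[OF \<phi>])
  then have "(LINT x|branch. ?g x) = integral {0<..} ?g"
    by (intro lebesgue_integral_eq_integral Bochner_Integration.integrable_add) auto
  ultimately have "(LINT x|branch. ?g x) = 0" by (simp add: integral_unique)
  then show "(LINT x|branch. u x * of_real (deriv \<phi> x)) = - (LINT x|branch. v x * of_real (\<phi> x))"
    using i by (simp add: eq_neg_iff_add_eq_0 add.commute)
qed

section \<open>The resolvent\<close>

lemma has_integral_imp_integrable_on_branch: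
  fixes f :: "real \<Rightarrow> real"
  assumes "f integrable_on {0<..}" "\<And>x. 0 < x \<Longrightarrow> 0 \<le> f x"
  shows "integrable branch f"
proof -
  have "f absolutely_integrable_on {0<..}"
    using assms by (intro nonnegative_absolutely_integrable_1) auto
  then show ?thesis by (simp add: absolutely_integrable_on_def set_integrable_def integrable_restrict_space)
qed

text \<open>Continuity is asked only on \<open>[0, b]\<close>, so a jump at \<open>b\<close> is
  allowed: the second derivative of the resolvent of an interval indicator has one.\<close>

lemma exp_decay_L2:
  fixes f :: "real \<Rightarrow> complex"
  assumes \<kappa>: "0 < Re \<kappa>" and b: "0 \<le> b" and cont: "continuous_on {0..b} f"
    and tail: "\<And>x. b < x \<Longrightarrow> f x = C * exp (- \<kappa> * of_real x)"
  shows "f \<in> L2_branch"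
proof -
  define g where "g x = indicator {0..b} x *\<^sub>R f x + indicator {b<..} x *\<^sub>R (C * exp (- \<kappa> * of_real x))" for x
  have fg: "f x = g x" if "0 < x" for x using that tail by (auto simp: g_def indicator_def)
  have "(\<lambda>x. indicator {0..b} x *\<^sub>R f x) \<in> borel_measurable borel"
    by (intro borel_measurable_continuous_on_indicator cont) auto
  moreover have "(\<lambda>x. C * exp (- \<kappa> * of_real x)) \<in> borel_measurable borel"
    by (intro borel_measurable_continuous_onI continuous_intros)
  ultimately have g: "g \<in> borel_measurable borel" unfolding g_def by measurable
  then have "g \<in> borel_measurable branch"
    by (intro measurable_restrict_space1 measurable_completion) simp
  then have fm: "f \<in> borel_measurable branch"
    by (rule measurable_cong[THEN iffD1, rotated]) (simp add: fg)
  have "integrable lborel (\<lambda>x. indicator {0..b} x *\<^sub>R (cmod (f x))\<^sup>2)"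
    by (intro borel_integrable_compact continuous_intros cont) auto
  then have 1: "integrable branch (\<lambda>x. indicator {0..b} x *\<^sub>R (cmod (f x))\<^sup>2)"
    by (intro integrable_branch) (simp add: integrable_completion)
  have "(\<lambda>x. exp (- (2 * Re \<kappa>) * x)) integrable_on {0..}"
    using integrable_on_exp_minus_to_infinity[of "2 * Re \<kappa>" 0] \<kappa> by simp
  then have "(\<lambda>x. exp (- (2 * Re \<kappa>) * x)) integrable_on {0<..}"
    by (rule integrable_spike_set) (rule negligible_subset[of "{0}"]; auto)+
  then have 2: "integrable branch (\<lambda>x. exp (- (2 * Re \<kappa>) * x))"
    by (rule has_integral_imp_integrable_on_branch) simp
  have "integrable branch (\<lambda>x. (cmod (f x))\<^sup>2)"
  proof (rule Bochner_Integration.integrable_bound)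
    show "integrable branch (\<lambda>x. indicator {0..b} x *\<^sub>R (cmod (f x))\<^sup>2 + (cmod C)\<^sup>2 * exp (- (2 * Re \<kappa>) * x))"
      using 1 2 by (intro Bochner_Integration.integrable_add integrable_mult_right)
    show "(\<lambda>x. (cmod (f x))\<^sup>2) \<in> borel_measurable branch" using fm by measurable
    have "(cmod (C * exp (- \<kappa> * of_real x)))\<^sup>2 = (cmod C)\<^sup>2 * exp (- (2 * Re \<kappa>) * x)" for x
      by (simp add: norm_mult power_mult_distrib exp_double[symmetric] algebra_simps flip: exp_of_nat_mult)
    then show "AE x in branch. norm ((cmod (f x))\<^sup>2) \<le>
        norm (indicator {0..b} x *\<^sub>R (cmod (f x))\<^sup>2 + (cmod C)\<^sup>2 * exp (- (2 * Re \<kappa>) * x))"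
      using tail by (intro AE_I2) (auto simp: indicator_def)
  qed
  with fm show ?thesis by (simp add: L2_branch_def)
qed

text \<open>
  One branch of the solution of \<open>c * u'' - c * \<kappa>\<^sup>2 * u = 1\<close> on \<open>(0,b]\<close>, \<open>= 0\<close> beyond: variation of constants with
  the solution \<open>f\<close>, the decaying exponential and their primitives \<open>P\<close>, \<open>Q\<close>. The assumption \<open>jump\<close> is
  the value \<open>- W / c\<close> of their Wronskian. \<open>V\<close> and \<open>Z\<close> are the first two derivatives of \<open>U\<close>.
\<close>

locale branch_resolvent =
  fixes \<kappa> A B W :: complex and c b :: real
  assumes \<kappa>: "\<kappa> \<noteq> 0" and AB: "A + B = 1" and W: "W \<noteq> 0" and c: "0 < c" and jump: "2 * \<kappa> * A * of_real c = - W"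
    and b: "0 \<le> b"
begin

definition ep where "ep x = exp (\<kappa> * of_real x)" for x :: real
definition em where "em x = exp (- \<kappa> * of_real x)" for x :: real
definition f where "f x = A * ep x + B * em x" for x :: real
definition f' where "f' x = \<kappa> * (A * ep x - B * em x)" for x :: real
definition P where "P x = (A * (ep x - 1) - B * (em x - 1)) / \<kappa>" for x :: real
definition Q where "Q x = (1 - em x) / \<kappa>" for x :: real
definition U where "U x = (if x \<in> {..b} then (em x * P x + f x * (Q b - Q x)) / W
  else em x * P b / W)" for x :: real
definition V where "V x = (if x \<in> {..b} then (- \<kappa> * em x * P x + f' x * (Q b - Q x)) / W
  else - \<kappa> * em x * P b / W)" for x :: real
definition Z where "Z x = \<kappa>\<^sup>2 * U x + (if x \<in> {..b} then 1 / of_real c else 0)" for x :: real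

lemma exp_deriv:
  "(ep has_vector_derivative \<kappa> * ep x) (at x)" "(em has_vector_derivative - \<kappa> * em x) (at x)"
  unfolding ep_def[abs_def] em_def[abs_def]
  by (rule has_vector_derivative_real_field, (auto intro!: derivative_eq_intros)[])+

lemma ep_em: "ep x * em x = 1" "em x * ep x = 1"
  by (simp_all add: ep_def em_def mult_exp_exp)

lemma derivs:
  "(f has_vector_derivative f' x) (at x)"
  "(f' has_vector_derivative \<kappa>\<^sup>2 * f x) (at x)"
  "(P has_vector_derivative f x) (at x)"
  "(Q has_vector_derivative em x) (at x)"
  unfolding f_def[abs_def] f'_def[abs_def] P_def[abs_def] Q_def[abs_def]
  using \<kappa> by (auto intro!: derivative_eq_intros exp_deriv simp: algebra_simps power2_eq_square add_divide_distrib)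

lemma at_0: "f 0 = 1" "f' 0 = \<kappa> * (A - B)" "P 0 = 0" "Q 0 = 0"
  using AB by (auto simp: f_def f'_def P_def Q_def ep_def em_def)

lemma U_deriv: "(U has_vector_derivative V x) (at x)"
proof -
  have 1: "((\<lambda>x. (em x * P x + f x * (Q b - Q x)) / W) has_vector_derivative
      (- \<kappa> * em x * P x + f' x * (Q b - Q x)) / W) (at x)" for x
    by (auto intro!: derivative_eq_intros derivs exp_deriv simp: algebra_simps)
  have 2: "((\<lambda>x. em x * P b / W) has_vector_derivative
      - \<kappa> * em x * P b / W) (at x)" for x
    by (auto intro!: derivative_eq_intros exp_deriv simp: algebra_simps)
  \<comment> \<open>The two formulas have the same value and the same derivative at
    \<open>b\<close>, since \<open>Q b - Q x\<close> vanishes there.\<close>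
  have "(U has_vector_derivative V x) (at x within {..b} \<union> {b<..})"
    unfolding U_def[abs_def] V_def
  proof (rule has_vector_derivative_If_within_closures)
    assume "x \<in> closure {..b}" "x \<in> closure {b<..}"
    then have x: "x = b" by simp
    show "(em x * P x + f x * (Q b - Q x)) / W = em x * P b / W"
      "(- \<kappa> * em x * P x + f' x * (Q b - Q x)) / W = - \<kappa> * em x * P b / W"
      by (simp_all add: x)
  qed (rule 1[THEN has_vector_derivative_at_within] 2[THEN has_vector_derivative_at_within] | force)+
  moreover have "{..b} \<union> {b<..} = UNIV" by auto
  ultimately show ?thesis by simp
qed

lemma V_deriv:
  assumes "x \<noteq> b"
  shows "(V has_vector_derivative Z x) (at x)"
proof (cases "x < b")
  case True
  \<comment> \<open>The growing exponential is all that survives; multiplied by \<open>em x\<close>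
    it is constant, and \<open>jump\<close> turns that constant into the inhomogeneity
    \<open>1 / c\<close>.\<close>
  have k: "\<kappa> * f x + f' x = 2 * \<kappa> * A * ep x"
    by (simp add: f_def f'_def algebra_simps)
  have "((\<lambda>x. (- \<kappa> * em x * P x + f' x * (Q b - Q x)) / W) has_vector_derivative
      (\<kappa>\<^sup>2 * (em x * P x + f x * (Q b - Q x)) - em x * (\<kappa> * f x + f' x)) / W) (at x)"
    by (auto intro!: derivative_eq_intros derivs exp_deriv simp: algebra_simps power2_eq_square)
  also have "(\<kappa>\<^sup>2 * (em x * P x + f x * (Q b - Q x)) - em x * (\<kappa> * f x + f' x)) / W = Z x"
  proof -
    have "em x * (\<kappa> * f x + f' x) = 2 * \<kappa> * A"
      unfolding k using ep_em(2)[of x] by (simp add: mult.left_commute)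
    also have "\<dots> = - W / of_real c" using jump c by (simp add: field_simps)
    finally show ?thesis using True W by (simp add: Z_def U_def add_divide_distrib distrib_left)
  qed
  finally show ?thesis
    by (rule has_vector_derivative_transform_within_open[of _ _ _ "{..<b}"]) (use True in \<open>auto simp: V_def\<close>)
next
  case False
  with assms have x: "b < x" by simp
  have "((\<lambda>x. - \<kappa> * em x * P b / W) has_vector_derivative Z x) (at x)"
    using x by (auto intro!: derivative_eq_intros exp_deriv simp: Z_def U_def power2_eq_square)
  then show ?thesis
    by (rule has_vector_derivative_transform_within_open[of _ _ _ "{b<..}"]) (use x in \<open>auto simp: V_def\<close>)
qed

lemma cont_exp: "continuous_on S ep" "continuous_on S em"
  unfolding ep_def[abs_def] em_def[abs_def] by (intro continuous_intros)+

lemma cont: "continuous_on S P" "continuous_on S Q" "continuous_on S f" "continuous_on S f'"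
  unfolding P_def[abs_def] Q_def[abs_def] f_def[abs_def] f'_def[abs_def]
  by (intro continuous_intros cont_exp \<kappa> ballI)+

lemma U_cont: "continuous_on S U"
  using U_deriv by (meson continuous_at_imp_continuous_on has_vector_derivative_continuous)

lemma V_cont: "continuous_on S V"
proof -
  have "continuous_on ({..b} \<union> {b..}) (\<lambda>x. if x \<in> {..b} then (- \<kappa> * em x * P x + f' x * (Q b - Q x)) / W
    else - \<kappa> * em x * P b / W)"
    by (rule continuous_on_If) (auto intro!: continuous_intros cont cont_exp simp: W)
  moreover have "{..b} \<union> {b..} = UNIV" by auto
  ultimately show ?thesis unfolding V_def[abs_def] using continuous_on_subset[OF _ subset_UNIV] by simp
qed

lemma L2:
  assumes "0 < Re \<kappa>"
  shows "U \<in> L2_branch" "V \<in> L2_branch" "Z \<in> L2_branch"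
proof -
  show "U \<in> L2_branch"
    by (rule exp_decay_L2[OF assms b U_cont, of "P b / W"]) (simp add: U_def em_def)
  show "V \<in> L2_branch"
    by (rule exp_decay_L2[OF assms b V_cont, of "- \<kappa> * P b / W"]) (simp add: V_def em_def)
  have "continuous_on {0..b} (\<lambda>x. \<kappa>\<^sup>2 * U x + 1 / of_real c)"
    by (intro continuous_intros U_cont)
  then have "continuous_on {0..b} Z"
    by (rule continuous_on_eq) (simp add: Z_def)
  then show "Z \<in> L2_branch"
    by (rule exp_decay_L2[OF assms b, of _ "\<kappa>\<^sup>2 * P b / W"]) (simp add: Z_def U_def em_def)
qed

lemma weak:
  assumes "0 < Re \<kappa>"
  shows "weak_derivative U V" "weak_derivative V Z"
proof -
  show "weak_derivative U V"
    by (rule weak_derivative_classical[OF L2(1)[OF assms] U_cont L2(2)[OF assms] finite.emptyI]) (rule U_deriv)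
  show "weak_derivative V Z"
    by (rule weak_derivative_classical[OF L2(2)[OF assms] V_cont L2(3)[OF assms], of "{b}"]) (auto intro: V_deriv)
qed

text \<open>Identifies the variation-of-constants formula with the kernel integral: below
  \<open>x\<close> the integrand is a multiple of \<open>f\<close>, above it a multiple of
  \<open>em\<close>, with primitives \<open>P\<close> and \<open>Q\<close>.\<close>

lemma U_integral:
  assumes "0 \<le> x"
  shows "((\<lambda>y. f (min x y) * em (max x y) / W) has_integral U x) {0..b}"
proof -
  \<comment> \<open>For \<open>x\<close> beyond the source interval the second piece shrinks to the
    point \<open>b\<close>.\<close>
  define m where "m = min x b"
  have m: "0 \<le> m" "m \<le> b" using assms b by (auto simp: m_def)
  have "(f has_integral (P m - P 0)) {0..m}"
    by (rule fundamental_theorem_of_calculus[OF m(1)]) (rule has_vector_derivative_at_within[OF derivs(3)])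
  then have "((\<lambda>y. em x / W * f y) has_integral (em x / W * (P m - P 0))) {0..m}"
    by (rule has_integral_mult_right)
  then have 1: "((\<lambda>y. f (min x y) * em (max x y) / W) has_integral
      (em x / W * (P m - P 0))) {0..m}"
    by (rule has_integral_eq[rotated]) (auto simp: m_def min_absorb2 max_absorb1)
  have "((\<lambda>y. em y) has_integral (Q b - Q m)) {m..b}"
    by (rule fundamental_theorem_of_calculus[OF m(2)]) (rule has_vector_derivative_at_within[OF derivs(4)])
  then have "((\<lambda>y. f x / W * em y) has_integral (f x / W * (Q b - Q m))) {m..b}"
    by (rule has_integral_mult_right)
  then have 2: "((\<lambda>y. f (min x y) * em (max x y) / W) has_integral
      (f x / W * (Q b - Q m))) {m..b}"
  \<comment> \<open>If \<open>x > b\<close> the single point \<open>b\<close> of the second piece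
    lies below \<open>x\<close>, where the formula for the integrand is wrong; it is discarded as a
    null set.\<close>
  proof (rule has_integral_spike_finite[of "{b}", rotated -1])
    fix y assume "y \<in> {m..b} - {b}"
    then have "x \<le> y" by (auto simp: m_def min_def split: if_splits)
    then show "f (min x y) * em (max x y) / W = f x / W * em y"
      by (simp add: min_absorb1 max_absorb2)
  qed simp
  have "(em x / W * (P m - P 0)) + (f x / W * (Q b - Q m)) = U x"
    unfolding at_0 by (auto simp: U_def m_def min_def add_divide_distrib)
  with has_integral_combine[OF m 1 2] show ?thesis by simp
qed

end

section \<open>The operator on the star-shaped network\<close>

text \<open>On the closed upper half plane the sign in the imaginary part of \<open>csqrt\<close> is
  constantly positive, so its Cartesian formula stays continuous up to the cut. Conjugation carries
  this over to \<open>lower_sqrt\<close> on the closed lower half plane.\<close>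

lemma continuous_on_csqrt_upper: "continuous_on {z. 0 \<le> Im z} csqrt"
proof -
  have "continuous_on {z. 0 \<le> Im z} (\<lambda>z. Complex (sqrt ((cmod z + Re z) / 2)) (sqrt ((cmod z - Re z) / 2)))"
    unfolding Complex_eq by (intro continuous_intros) auto
  moreover have "Complex (sqrt ((cmod z + Re z) / 2)) (sqrt ((cmod z - Re z) / 2)) = csqrt z" if "0 \<le> Im z" for z
    using that by (auto simp: complex_eq_iff)
  ultimately show ?thesis by (rule continuous_on_eq) auto
qed

lemma continuous_on_lower_sqrt: "continuous_on {z. Im z \<le> 0} lower_sqrt"
  unfolding lower_sqrt_def[abs_def]
  by (intro continuous_intros continuous_on_compose2[OF continuous_on_csqrt_upper]) auto

lemma lower_sqrt_square: "(lower_sqrt z)\<^sup>2 = z"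
  by (simp add: lower_sqrt_def flip: complex_cnj_power)

lemma lower_sqrt_Re: "0 \<le> Re (lower_sqrt z)"
  using csqrt_principal[of "cnj z"] by (auto simp: lower_sqrt_def simp del: csqrt.sel)

lemma lower_sqrt_Im:
  assumes "Im z \<le> 0"
  shows "Im (lower_sqrt z) \<le> 0" "Im z < 0 \<Longrightarrow> Im (lower_sqrt z) < 0"
proof -
  have "\<bar>Re z\<bar> \<le> cmod z" by (rule abs_Re_le_cmod)
  then show "Im (lower_sqrt z) \<le> 0" using assms by (simp add: lower_sqrt_def)
  assume "Im z < 0"
  then have "Re z \<noteq> cmod z" using cmod_power2[of z] by auto
  then have "Re z < cmod z" using complex_Re_le_cmod[of z] by simp
  then show "Im (lower_sqrt z) < 0" using \<open>Im z < 0\<close> by (simp add: lower_sqrt_def)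
qed

lemma exp_tail_weak:
  assumes "0 < Re \<kappa>"
  shows "(\<lambda>x. C * exp (- \<kappa> * of_real x)) \<in> L2_branch"
    and "weak_derivative (\<lambda>x. C * exp (- \<kappa> * of_real x)) (\<lambda>x. (- \<kappa> * C) * exp (- \<kappa> * of_real x))"
    and "((\<lambda>x. C * exp (- \<kappa> * of_real x)) has_vector_derivative (- \<kappa> * C) * exp (- \<kappa> * of_real x)) (at x)"
proof -
  show L: "(\<lambda>x. C * exp (- \<kappa> * of_real x)) \<in> L2_branch" for C
    by (rule exp_decay_L2[OF assms, of 0 _ C]) auto
  show d: "((\<lambda>x. C * exp (- \<kappa> * of_real x)) has_vector_derivative (- \<kappa> * C) * exp (- \<kappa> * of_real x)) (at x)" for x
    by (rule has_vector_derivative_real_field) (auto intro!: derivative_eq_intros)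
  show "weak_derivative (\<lambda>x. C * exp (- \<kappa> * of_real x)) (\<lambda>x. (- \<kappa> * C) * exp (- \<kappa> * of_real x))"
    by (rule weak_derivative_classical[OF L _ L finite.emptyI]) (intro continuous_intros, rule d)
qed

lemma dom_A_comb:
  assumes "u \<in> dom_A c" "v \<in> dom_A c"
  shows "comb z u v \<in> dom_A c"
proof -
  obtain u' where u': "\<And>k. continuous_on {0..} (u' k)"
      "\<And>k x. 0 \<le> x \<Longrightarrow> (u k has_vector_derivative u' k x) (at x within {0..})"
      "(\<Sum>k\<in>UNIV. of_real (c k) * u' k 0) = 0"
    using assms(1) by (auto simp: dom_A_def transmission1_def)
  obtain v' where v': "\<And>k. continuous_on {0..} (v' k)"
      "\<And>k x. 0 \<le> x \<Longrightarrow> (v k has_vector_derivative v' k x) (at x within {0..})"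
      "(\<Sum>k\<in>UNIV. of_real (c k) * v' k 0) = 0"
    using assms(2) by (auto simp: dom_A_def transmission1_def)
  have "(\<Sum>k\<in>UNIV. of_real (c k) * (z * u' k 0 + v' k 0)) =
      z * (\<Sum>k\<in>UNIV. of_real (c k) * u' k 0) + (\<Sum>k\<in>UNIV. of_real (c k) * v' k 0)"
    by (simp add: sum.distrib sum_distrib_left algebra_simps)
  then have "(\<Sum>k\<in>UNIV. of_real (c k) * (z * u' k 0 + v' k 0)) = 0" using u' v' by simp
  then have "transmission1 c (comb z u v)"
    unfolding transmission1_def using u' v'
    by (intro exI[of _ "comb z u' v'"] conjI allI impI)
      (auto intro!: continuous_intros has_vector_derivative_add has_vector_derivative_mult_right)
  moreover have "transmission0 (comb z u v)"
    using assms by (auto simp: dom_A_def transmission0_def intro!: continuous_intros) metis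
  ultimately show ?thesis
    using assms by (auto simp: dom_A_def sobolev_H2_comb)
qed

lemma dom_A_space: "u \<in> dom_A c \<Longrightarrow> u \<in> space_H"
  by (auto simp: dom_A_def space_H_def intro: sobolev_H2D)

lemma op_A_space:
  assumes "u \<in> dom_A c"
  shows "op_A c a u \<in> space_H"
proof -
  have "op_A c a u k \<in> L2_branch" for k
    using assms L2_branch_comb[OF sobolev_H2D(4) L2_branch_scale[OF sobolev_H2D(1)], of "u k" "u k" "- of_real (c k)" "of_real (a k)"]
    by (simp add: dom_A_def op_A_def[abs_def])
  then show ?thesis by (simp add: space_H_def)
qed

lemma op_A_comb:
  assumes "u \<in> dom_A c" "v \<in> dom_A c"
  shows "eq_H (op_A c a (comb z u v)) (comb z (op_A c a u) (op_A c a v))"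
  unfolding eq_H_def
proof
  fix k
  have "u k \<in> sobolev_H2" "v k \<in> sobolev_H2" using assms by (auto simp: dom_A_def)
  from sobolev_H2_comb(2)[OF this, of z]
  show "AE x in branch. op_A c a (comb z u v) k x = z * op_A c a u k x + op_A c a v k x"
    by eventually_elim (simp add: op_A_def algebra_simps)
qed

lemma spectral_operator_A:
  assumes "resolution_of_identity (dom_A c) (op_A c a) E"
  shows "spectral_operator E (dom_A c) (op_A c a)"
proof
  show "projection_valued_measure E" using assms by (simp add: resolution_of_identity_def)
  show "u \<in> dom_A c \<Longrightarrow> u \<in> space_H" for u by (rule dom_A_space)
  show "u \<in> dom_A c \<Longrightarrow> op_A c a u \<in> space_H" for u by (rule op_A_space)
  show "u \<in> dom_A c \<Longrightarrow> v \<in> dom_A c \<Longrightarrow> comb z u v \<in> dom_A c" for u v z by (rule dom_A_comb)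
  show "(\<exists>u\<in>dom_A c. eq_H f u) \<longleftrightarrow> integrable (spectral_measure E f) (\<lambda>t. t\<^sup>2)" if "f \<in> space_H" for f
    using assms that by (simp add: resolution_of_identity_def)
  show "inner_H (op_A c a u) u = of_real (LINT t|spectral_measure E u. t)" if "u \<in> dom_A c" for u
    using assms that by (simp add: resolution_of_identity_def)
  fix u v h z assume u: "u \<in> dom_A c" and v: "v \<in> dom_A c" and h: "h \<in> (space_H :: ('a \<Rightarrow> real \<Rightarrow> complex) set)"
  have "inner_H (op_A c a (comb z u v)) h = inner_H (comb z (op_A c a u) (op_A c a v)) h"
    by (intro inner_H_cong op_A_comb space_H_comb op_A_space dom_A_comb u v h)
  then show "inner_H (op_A c a (comb z u v)) h = z * inner_H (op_A c a u) h + inner_H (op_A c a v) h"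
    using u v h by (simp only: inner_H_comb_left[OF op_A_space op_A_space])
qed

section \<open>Green's function of the star-shaped network\<close>

locale star_network =
  fixes c a :: "'n::{finite,linorder} \<Rightarrow> real"
  assumes two: "2 \<le> CARD('n)" and c_pos: "0 < c k"
begin

text \<open>The decay rate: for \<open>Im z < 0\<close> the root \<open>xi\<close> has negative
  imaginary part, so \<open>kap\<close> has positive real part and
  \<open>exp (- kap k z * x)\<close> is a square-integrable solution on branch
  \<open>k\<close>.\<close>

definition kap :: "'n \<Rightarrow> complex \<Rightarrow> complex" where
  "kap k z = \<i> * xi c a k z"

text \<open>The sum in condition \<open>(T_1)\<close> for the decaying exponentials, which all equal
  1 at the vertex; a zero of \<open>W\<close> would make them an eigenfunction.\<close>

definition W :: "complex \<Rightarrow> complex" where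
  "W z = - (\<Sum>k\<in>UNIV. of_real (c k) * kap k z)"

text \<open>
  The closed lower half plane without the branch points: \<open>lower_sqrt\<close> is continuous there up to
  the real axis.
\<close>

definition Om :: "complex set" where
  "Om = {z. Im z \<le> 0 \<and> (\<forall>k. z \<noteq> of_real (a k))}"

text \<open>The Green's function of \<open>z - A\<close> with source at \<open>y\<close> on branch
  \<open>j\<close>. The function \<open>F\<close> with index \<open>j\<close> satisfies both
  transmission conditions and decays on the other branches; on branch \<open>j\<close> it is matched
  at the source with the decaying exponential, and \<open>W\<close> normalizes the jump of the
  derivative to \<open>1 / c j\<close>.\<close>

definition K :: "complex \<Rightarrow> 'n \<Rightarrow> real \<Rightarrow> 'n \<Rightarrow> real \<Rightarrow> complex" where
  "K z j y k x = (if k = j then F c a j z j (min x y) * exp (- kap j z * of_real (max x y)) / W z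
     else exp (- kap k z * of_real x) * exp (- kap j z * of_real y) / W z)"

lemma K_commute: "K z j y k x = K z k x j y"
  by (auto simp: K_def min.commute max.commute mult.commute)

lemma W_real: "W (of_real t) = w c a t"
  by (simp add: W_def w_def kap_def sum_distrib_left sum_negf mult.left_commute)

lemma Im_arg:
  assumes "Im z \<le> 0"
  shows "Im ((z - of_real (a k)) / of_real (c k)) \<le> 0"
    "Im z < 0 \<Longrightarrow> Im ((z - of_real (a k)) / of_real (c k)) < 0"
  using assms c_pos[of k] by (auto simp: divide_nonpos_pos divide_neg_pos)

lemma kap_square: "(kap k z)\<^sup>2 = (of_real (a k) - z) / of_real (c k)"
  by (simp add: kap_def power_mult_distrib xi_def lower_sqrt_square flip: minus_divide_left)

lemma kap_nonzero: "z \<noteq> of_real (a k) \<Longrightarrow> kap k z \<noteq> 0"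
  using kap_square[of k z] c_pos[of k] by auto

lemma kap_Re: "Im z \<le> 0 \<Longrightarrow> 0 \<le> Re (kap k z)" "Im z < 0 \<Longrightarrow> 0 < Re (kap k z)"
  and kap_Im: "0 \<le> Im (kap k z)"
  using lower_sqrt_Im[OF Im_arg(1)] Im_arg(2) lower_sqrt_Re by (auto simp: kap_def xi_def)

text \<open>In the closed lower half plane every \<open>kap\<close> has nonnegative real and
  imaginary parts, so the weighted sum vanishes only if each \<open>kap\<close> does, that is, only
  at branch points.\<close>

lemma W_nonzero:
  assumes "z \<in> Om"
  shows "W z \<noteq> 0"
proof
  assume W0: "W z = 0"
  have z: "Im z \<le> 0" "z \<noteq> of_real (a k)" for k using assms by (auto simp: Om_def)
  have "(\<Sum>k\<in>UNIV. c k * Re (kap k z)) = 0" "(\<Sum>k\<in>UNIV. c k * Im (kap k z)) = 0"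
    using W0 by (simp_all add: W_def complex_eq_iff)
  moreover have "0 \<le> c k * Re (kap k z)" "0 \<le> c k * Im (kap k z)" for k
    using kap_Re(1)[OF z(1)] kap_Im c_pos[of k] by (auto intro!: mult_nonneg_nonneg)
  ultimately have "c first * Re (kap first z) = 0" "c first * Im (kap first z) = 0"
    by (simp_all add: sum_nonneg_eq_0_iff)
  then have "kap first z = 0" using c_pos[of first] by (simp add: complex_eq_iff)
  with kap_nonzero[OF z(2)] show False by blast
qed

lemma F_own:
  "F c a j z j x = (1 - s_coeff c a j z) / 2 * exp (kap j z * of_real x) +
     (1 + s_coeff c a j z) / 2 * exp (- kap j z * of_real x)"
  by (simp add: F_def kap_def cos_exp_eq sin_exp_eq field_simps)

lemma F_other: "k \<noteq> j \<Longrightarrow> F c a j z k x = exp (- kap k z * of_real x)"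
  by (simp add: F_def kap_def)

text \<open>\<open>s_coeff\<close> is minus the sum over the other branches divided by the own term,
  hence \<open>1 - s_coeff\<close> restores the full sum. This is the Wronskian relation required by
  \<open>branch_resolvent\<close>.\<close>

lemma jump:
  assumes "z \<in> Om"
  shows "kap j z * (1 - s_coeff c a j z) * of_real (c j) = - W z"
proof -
  have nz: "xi c a j z \<noteq> 0" "of_real (c j) \<noteq> (0::complex)"
    using kap_nonzero[of z j] assms c_pos[of j] by (auto simp: Om_def kap_def)
  have "(\<Sum>l\<in>UNIV. of_real (c l) * xi c a l z) =
      of_real (c j) * xi c a j z + (\<Sum>l\<in>UNIV - {j}. of_real (c l) * xi c a l z)"
    by (simp add: sum.remove[of UNIV j])
  moreover have "xi c a j z * s_coeff c a j z * of_real (c j) = - (\<Sum>l\<in>UNIV - {j}. of_real (c l) * xi c a l z)"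
    using nz by (simp add: s_coeff_def)
  ultimately show ?thesis
    by (simp add: W_def kap_def sum_distrib_left[symmetric] mult.left_commute algebra_simps)
qed

lemma branch_resolvent:
  assumes "z \<in> Om" "0 \<le> b"
  shows "branch_resolvent (kap j z) ((1 - s_coeff c a j z) / 2) ((1 + s_coeff c a j z) / 2) (W z) (c j) b"
  using assms kap_nonzero[of z j] W_nonzero[OF assms(1)] c_pos[of j] jump[OF assms(1), of j]
  by unfold_locales (simp_all add: Om_def add_divide_distrib diff_divide_distrib right_diff_distrib)

lemma continuous_xi: "continuous_on {z. Im z \<le> 0} (xi c a k)"
  unfolding xi_def[abs_def] using Im_arg(1) c_pos[of k]
  by (intro continuous_on_compose2[OF continuous_on_lower_sqrt] continuous_intros) auto

lemma continuous_on_kap: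
  assumes "continuous_on S g" "g ` S \<subseteq> Om"
  shows "continuous_on S (\<lambda>p. kap k (g p))" "continuous_on S (\<lambda>p. xi c a k (g p))"
  unfolding kap_def using assms
  by (auto intro!: continuous_intros continuous_on_compose2[OF continuous_xi] simp: Om_def)

lemma continuous_on_F:
  assumes g: "continuous_on S g" "g ` S \<subseteq> Om" and x: "continuous_on S x"
  shows "continuous_on S (\<lambda>p. F c a j (g p) k (x p))"
proof -
  note xi = continuous_on_kap(2)[OF g]
  have "xi c a j (g p) \<noteq> 0" if "p \<in> S" for p
    using kap_nonzero[of "g p" j] g(2) that by (auto simp: Om_def kap_def)
  then have "continuous_on S (\<lambda>p. s_coeff c a j (g p))"
    unfolding s_coeff_def using c_pos[of j] by (intro continuous_intros xi ballI) auto
  then show ?thesis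
    by (cases "k = j") (auto simp: F_own F_other intro!: continuous_intros continuous_on_kap g x)
qed

lemma continuous_on_K:
  assumes g: "continuous_on S g" "g ` S \<subseteq> Om" and x: "continuous_on S x" and y: "continuous_on S y"
  shows "continuous_on S (\<lambda>p. K (g p) j (y p) k (x p))"
proof -
  have W: "continuous_on S (\<lambda>p. W (g p))" unfolding W_def by (intro continuous_intros continuous_on_kap g)
  have W0: "\<forall>p\<in>S. W (g p) \<noteq> 0" using W_nonzero g(2) by blast
  show ?thesis
    unfolding K_def
    by (cases "k = j") (auto intro!: continuous_intros continuous_on_F continuous_on_kap g x y W W0[rule_format])
qed

section \<open>The resolvent of indicators of intervals\<close>

definition chi :: "'n \<Rightarrow> real \<Rightarrow> 'n \<Rightarrow> real \<Rightarrow> complex" where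
  "chi j b k x = (if k = j \<and> 0 < x \<and> x \<le> b then 1 else 0)"

lemma integral_chi:
  assumes g: "continuous_on {0..b} g"
  shows "integrable branch (\<lambda>x. g x * chi j b j x)"
    and "(LINT x|branch. g x * chi j b j x) = integral {0..b} g"
proof -
  have "integrable lborel (\<lambda>x. indicator {0..b} x *\<^sub>R g x)"
    by (intro borel_integrable_compact g) auto
  then have "integrable branch (\<lambda>x. indicator {0..b} x *\<^sub>R g x)"
    by (intro integrable_branch) (simp add: integrable_completion)
  moreover have "indicator {0..b} x *\<^sub>R g x = g x * chi j b j x" if "0 < x" for x
    using that by (auto simp: chi_def indicator_def)
  ultimately show i: "integrable branch (\<lambda>x. g x * chi j b j x)"
    by (rule Bochner_Integration.integrable_cong[OF refl, THEN iffD1, rotated]) auto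
  have "(LINT x|branch. g x * chi j b j x) = integral {0<..} (\<lambda>x. g x * chi j b j x)"
    using i by (rule lebesgue_integral_eq_integral) simp
  also have "\<dots> = integral {0<..} (\<lambda>x. if x \<in> {0<..b} then g x else 0)"
    by (rule integral_cong) (auto simp: chi_def)
  also have "\<dots> = integral ({0<..b} \<inter> {0<..}) g" by (rule integral_restrict_Int)
  also have "\<dots> = integral {0<..b} g" by (rule arg_cong[where f="\<lambda>S. integral S g"]) auto
  also have "\<dots> = integral {0..b} g"
    by (rule integral_spike_set) (rule negligible_subset[of "{0}"]; auto)+
  finally show "(LINT x|branch. g x * chi j b j x) = integral {0..b} g" .
qed

lemma chi_L2: "chi j b k \<in> L2_branch"
proof (cases "k = j")
  case False
  then show ?thesis using L2_branch_zero by (simp add: chi_def[abs_def])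
next
  case True
  have "integrable branch (\<lambda>x. 1 * chi j b j x)"
    by (rule integral_chi) (intro continuous_intros)
  then have i: "integrable branch (chi j b j)" by simp
  have "norm (chi j b j x) = (cmod (chi j b j x))\<^sup>2" for x by (simp add: chi_def)
  then have "integrable branch (\<lambda>x. (cmod (chi j b j x))\<^sup>2)" using integrable_norm[OF i] by simp
  with i True show ?thesis by (simp add: L2_branch_def borel_measurable_integrable)
qed

lemma chi_space: "chi j b \<in> space_H"
  by (simp add: space_H_def chi_L2)

lemma compact_support_chi: "compact_support (chi j b)"
  unfolding compact_support_def by (intro exI[of _ b] allI AE_I2) (simp add: chi_def)

lemma inner_chi:
  assumes "continuous_on {0..} (g k)"
  shows "inner_H g (chi k b) = integral {0..b} (g k)"
proof -
  have "inner_H g (chi k b) = (\<Sum>l\<in>UNIV. if l = k then LINT x|branch. g k x * chi k b k x else 0)"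
    unfolding inner_H_def by (intro sum.cong refl) (auto simp: chi_def intro!: arg_cong[where f="integral\<^sup>L _"])
  also have "\<dots> = integral {0..b} (g k)"
    using integral_chi(2)[OF continuous_on_subset[OF assms], of b k] by simp
  finally show ?thesis .
qed

text \<open>Closed form of the integral of \<open>K\<close> over \<open>y\<close> in
  \<open>[0, b]\<close>: variation of constants on the source branch, and elsewhere a multiple of
  the decaying exponential, where \<open>Q b\<close> is the integral of
  \<open>exp (- kap j z * y)\<close>.\<close>

definition Res :: "complex \<Rightarrow> 'n \<Rightarrow> real \<Rightarrow> 'n \<Rightarrow> real \<Rightarrow> complex" where
  "Res z j b k = (if k = j
     then branch_resolvent.U (kap j z) ((1 - s_coeff c a j z) / 2) ((1 + s_coeff c a j z) / 2) (W z) b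
     else (\<lambda>x. (branch_resolvent.Q (kap j z) b / W z) * exp (- kap k z * of_real x)))"

lemma Res_integral:
  assumes z: "z \<in> Om" and b: "0 \<le> b" and x: "0 \<le> x"
  shows "((\<lambda>y. K z j y k x) has_integral Res z j b k x) {0..b}"
proof -
  interpret br: branch_resolvent "kap j z" "(1 - s_coeff c a j z) / 2" "(1 + s_coeff c a j z) / 2" "W z" "c j" b
    by (rule branch_resolvent[OF z b])
  show ?thesis
  proof (cases "k = j")
    case True
    have "F c a j z j x = br.f x" for x by (simp add: F_own br.f_def br.ep_def br.em_def)
    then show ?thesis
      using br.U_integral[OF x] True by (simp add: K_def Res_def br.em_def)
  next
    case False
    have "(br.em has_integral (br.Q b - br.Q 0)) {0..b}"
      by (rule fundamental_theorem_of_calculus[OF b]) (rule has_vector_derivative_at_within[OF br.derivs(4)])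
    then have "((\<lambda>y. exp (- kap k z * of_real x) / W z * br.em y) has_integral
        (exp (- kap k z * of_real x) / W z * (br.Q b - br.Q 0))) {0..b}"
      by (rule has_integral_mult_right)
    then show ?thesis using False by (simp add: K_def Res_def br.em_def br.at_0 mult.commute)
  qed
qed

text \<open>All branches share the value \<open>Q b / W z\<close> at the vertex, and off the source
  branch the function solves the homogeneous equation. What has to be computed is the flux at the
  vertex.\<close>

lemma Res_resolvent:
  assumes z: "Im z < 0" and b: "0 \<le> b"
  shows "Res z j b \<in> dom_A c" (is ?dom)
    and "eq_H (chi j b) (\<lambda>k x. z * Res z j b k x - op_A c a (Res z j b) k x)" (is ?eq)
proof -
  have zO: "z \<in> Om" using z by (auto simp: Om_def)
  interpret br: branch_resolvent "kap j z" "(1 - s_coeff c a j z) / 2" "(1 + s_coeff c a j z) / 2" "W z" "c j" b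
    by (rule branch_resolvent[OF zO b])
  have Re: "0 < Re (kap k z)" for k using kap_Re(2)[OF z] .
  define V where "V k = (if k = j then br.V else (\<lambda>x. (- kap k z * (br.Q b / W z)) * exp (- kap k z * of_real x)))" for k
  define Z where "Z k = (if k = j then br.Z else (\<lambda>x. (- kap k z * (- kap k z * (br.Q b / W z))) * exp (- kap k z * of_real x)))" for k
  have own: "Res z j b j = br.U" and other: "k \<noteq> j \<Longrightarrow> Res z j b k = (\<lambda>x. (br.Q b / W z) * exp (- kap k z * of_real x))" for k
    by (simp_all add: Res_def)
  have L: "Res z j b k \<in> L2_branch" "V k \<in> L2_branch" "Z k \<in> L2_branch"
      "weak_derivative (Res z j b k) (V k)" "weak_derivative (V k) (Z k)" for k
    using br.L2[OF Re] br.weak[OF Re] exp_tail_weak(1,2)[OF Re]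
    by (atomize (full), cases "k = j") (simp_all only: own other V_def Z_def if_True if_False refl simp_thms)
  have d: "(Res z j b k has_vector_derivative V k x) (at x)" for k x
    using br.U_deriv exp_tail_weak(3)[OF Re] by (cases "k = j") (simp_all only: own other V_def if_True if_False simp_thms)
  have cont_V: "continuous_on {0..} (V k)" for k
    by (cases "k = j") (auto simp: V_def br.W intro!: br.V_cont continuous_intros)
  have cont: "continuous_on {0..} (Res z j b k)" for k
    by (intro continuous_at_imp_continuous_on ballI has_vector_derivative_continuous[OF d])
  have at0: "Res z j b k 0 = br.Q b / W z" for k
    using b by (cases "k = j") (simp_all add: own other br.U_def br.at_0)
  \<comment> \<open>Each branch contributes the flux of a decaying exponential; the source branch
    has an extra \<open>- W z\<close>, which cancels the total \<open>W z\<close> of these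
    fluxes.\<close>
  have V0: "of_real (c k) * V k 0 = (if k = j then - W z else 0) * (br.Q b / W z) - of_real (c k) * kap k z * (br.Q b / W z)" for k
  proof (cases "k = j")
    case True
    have "br.V 0 = (kap j z * (- s_coeff c a j z)) * (br.Q b / W z)"
      using b by (simp add: br.V_def br.at_0 field_simps)
    moreover have "of_real (c j) * (kap j z * (- s_coeff c a j z)) = - W z - of_real (c j) * kap j z"
      using jump[OF zO, of j] by (simp add: algebra_simps)
    ultimately have "of_real (c j) * br.V 0 = (- W z - of_real (c j) * kap j z) * (br.Q b / W z)"
      by (metis mult.assoc)
    then show ?thesis using True by (simp add: V_def left_diff_distrib diff_divide_distrib br.W)
  next
    case False
    then show ?thesis by (simp add: V_def)
  qed
  show dom: ?dom
    unfolding dom_A_def mem_Collect_eq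
  proof (intro conjI allI)
    show "Res z j b k \<in> sobolev_H2" for k using L unfolding sobolev_H2_def by blast
    show "transmission0 (Res z j b)" using cont at0 by (simp add: transmission0_def)
    show "transmission1 c (Res z j b)"
      unfolding transmission1_def
    proof (intro exI[of _ V] conjI allI impI)
      show "(Res z j b k has_vector_derivative V k x) (at x within {0..})" for k x
        by (rule has_vector_derivative_at_within[OF d])
      have "(\<Sum>k\<in>UNIV. of_real (c k) * V k 0) = - W z * (br.Q b / W z) - (\<Sum>k\<in>UNIV. of_real (c k) * kap k z) * (br.Q b / W z)"
        unfolding V0 sum_subtractf sum_distrib_right[symmetric] by simp
      also have "(\<Sum>k\<in>UNIV. of_real (c k) * kap k z) = - W z" by (simp add: W_def)
      finally show "(\<Sum>k\<in>UNIV. of_real (c k) * V k 0) = 0" by simp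
    qed (rule cont_V)
  qed
  show ?eq
    unfolding eq_H_def
  proof
    fix k
    have "AE x in branch. wderiv (wderiv (Res z j b k)) x = Z k x"
      by (rule wderiv2(3)[OF L(2,4,3,5)])
    moreover have "AE x in branch. 0 < x" by (rule AE_I2) simp
    ultimately show "AE x in branch. chi j b k x = z * Res z j b k x - op_A c a (Res z j b) k x"
    proof eventually_elim
      case (elim x)
      have ck: "complex_of_real (c k) \<noteq> 0" using c_pos[of k] by simp
      have sq: "of_real (c k) * (kap k z)\<^sup>2 = of_real (a k) - z" using kap_square[of k z] ck by simp
      have "of_real (c k) * Z k x = (of_real (a k) - z) * Res z j b k x + chi j b k x"
      proof (cases "k = j")
        case True
        have "of_real (c j) * br.Z x = (of_real (c j) * (kap j z)\<^sup>2) * br.U x + (if x \<in> {..b} then 1 else 0)"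
          using ck True by (simp add: br.Z_def distrib_left)
        then show ?thesis using True sq elim(2) by (simp add: Z_def own chi_def)
      next
        case False
        have "of_real (c k) * Z k x = (of_real (c k) * (kap k z)\<^sup>2) * Res z j b k x"
          using False by (simp add: Z_def other power2_eq_square)
        then show ?thesis using False sq by (simp add: chi_def)
      qed
      then show ?case using elim(1) by (simp add: op_A_def algebra_simps)
    qed
  qed
qed

text \<open>For \<open>Im z < 0\<close> this is the matrix element of the resolvent between two
  indicators (\<open>inner_Res\<close>); written through the kernel it also makes sense, and is
  continuous, at the real points of \<open>Om\<close>.\<close>

definition G :: "complex \<Rightarrow> 'n \<Rightarrow> real \<Rightarrow> 'n \<Rightarrow> real \<Rightarrow> complex" where
  "G z j b k b' = integral {0..b'} (\<lambda>x. integral {0..b} (\<lambda>y. K z j y k x))"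

lemma G_commute:
  assumes "z \<in> Om"
  shows "G z j b k b' = G z k b' j b"
proof -
  have "continuous_on (cbox (0, 0) (b', b)) (\<lambda>(x, y). K z j y k x)"
    unfolding split_beta using assms by (intro continuous_on_K continuous_intros) auto
  from integral_swap_continuous[OF this]
  have "G z j b k b' = integral {0..b} (\<lambda>y. integral {0..b'} (\<lambda>x. K z j y k x))"
    by (simp add: G_def)
  then show ?thesis by (simp add: G_def K_commute[of z j _ k])
qed

lemma inner_Res:
  assumes z: "Im z < 0" and b: "0 \<le> b"
  shows "inner_H (Res z j b) (chi k b') = G z j b k b'"
proof -
  have zO: "z \<in> Om" using z by (auto simp: Om_def)
  have "continuous_on {0..} (Res z j b k)"
    using Res_resolvent(1)[OF z b, of j] by (simp add: dom_A_def transmission0_def)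
  then have "inner_H (Res z j b) (chi k b') = integral {0..b'} (Res z j b k)"
    by (rule inner_chi)
  also have "\<dots> = G z j b k b'"
    unfolding G_def
    by (rule integral_cong) (rule integral_unique[symmetric, OF Res_integral[OF zO b]], simp)
  finally show ?thesis .
qed

lemma continuous_on_inner_integral:
  assumes g: "continuous_on S g" "g ` S \<subseteq> Om" and x: "continuous_on S x"
  shows "continuous_on S (\<lambda>p. integral {0..b} (\<lambda>y. K (g p) j y k (x p)))"
proof -
  have "continuous_on (S \<times> cbox 0 b) (\<lambda>(p, y). K (g p) j y k (x p))"
    unfolding split_beta
    by (intro continuous_on_K continuous_on_compose2[OF g(1)] continuous_on_compose2[OF x] continuous_intros)
      (use g(2) in auto)
  from integral_continuous_on_param[OF this] show ?thesis by simp
qed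

lemma continuous_on_G:
  assumes g: "continuous_on S g" "g ` S \<subseteq> Om"
  shows "continuous_on S (\<lambda>p. G (g p) j b k b')"
proof -
  have "continuous_on (S \<times> cbox 0 b') (\<lambda>(p, x). integral {0..b} (\<lambda>y. K (g p) j y k x))"
    unfolding split_beta
    by (intro continuous_on_inner_integral continuous_on_compose2[OF g(1)] continuous_intros)
      (use g(2) in auto)
  from integral_continuous_on_param[OF this] show ?thesis by (simp add: G_def)
qed

end

text \<open>Allows almost-everywhere statements to be gathered over countably many end points only:
  the indefinite integral is continuous, so it vanishes for all end points, and so does its
  derivative.\<close>

lemma integral_zero_rational_imp_zero:
  fixes f :: "real \<Rightarrow> complex"
  assumes cont: "continuous_on {0..} f"
    and zero: "\<And>b. b \<in> \<rat> \<Longrightarrow> 0 \<le> b \<Longrightarrow> integral {0..b} f = 0"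
    and x: "0 \<le> x"
  shows "f x = 0"
proof -
  define B where "B = x + 1"
  have B: "0 < B" "x \<in> {0..B}" using x by (auto simp: B_def)
  have cB: "continuous_on {0..B} f" using cont by (rule continuous_on_subset) auto
  let ?I = "\<lambda>u. integral {0..u} f"
  have cI: "continuous_on {0..B} ?I"
    by (intro indefinite_integral_continuous_1 integrable_continuous_interval cB)
  have I0: "?I u = 0" if u: "u \<in> {0<..<B}" for u
  proof (rule ccontr)
    assume nz: "?I u \<noteq> 0"
    have "continuous_on {0<..<B} ?I" using cI by (rule continuous_on_subset) auto
    then have "open ({0<..<B} \<inter> ?I -` (- {0}))"
      by (rule continuous_open_preimage) auto
    moreover have "u \<in> {0<..<B} \<inter> ?I -` (- {0})" using nz u by auto
    ultimately obtain e where e: "0 < e" "ball u e \<subseteq> {0<..<B} \<inter> ?I -` (- {0})"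
      using open_contains_ball by blast
    obtain r where r: "r \<in> \<rat>" "u < r" "r < u + e" using Rats_dense_in_real[of u "u + e"] e by auto
    then have "r \<in> ball u e" by (auto simp: dist_real_def)
    then have "r \<in> {0<..<B} \<inter> ?I -` (- {0})" using e by blast
    then show False using zero[of r] r by auto
  qed
  have I0': "?I u = 0" if u: "u \<in> {0..B}" for u
  proof (rule continuous_constant_on_closure[of "{0<..<B}" ?I 0])
    show "continuous_on (closure {0<..<B}) ?I" using cI B by simp
    show "u \<in> closure {0<..<B}" using u B by simp
  qed (use I0 in auto)
  have "(?I has_vector_derivative f x) (at x within {0..B})"
    by (rule integral_has_vector_derivative[OF cB B(2)])
  moreover have "(?I has_vector_derivative 0) (at x within {0..B})"
    by (rule has_vector_derivative_transform[OF B(2) _ has_vector_derivative_const[of 0]]) (use I0' in auto)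
  ultimately show "f x = 0"
    using vector_derivative_unique_within_closed_interval[of 0 B x ?I "f x" 0] B by simp
qed

lemma AE_zero_on_interval:
  fixes h :: "real \<Rightarrow> complex"
  assumes h: "set_integrable lebesgue {s<..<r} h"
    and zero: "\<And>u v. s \<le> u \<Longrightarrow> u < v \<Longrightarrow> v \<le> r \<Longrightarrow> (LINT t:{u<..<v}|lebesgue. h t) = 0"
  shows "AE t in lebesgue. t \<in> {s<..<r} \<longrightarrow> h t = 0"
proof -
  have "AE t in lebesgue. indicator {s<..<r} t *\<^sub>R h t = 0"
  proof (rule AE_zero_of_interval_integrals)
    show "integrable lebesgue (\<lambda>t. indicator {s<..<r} t *\<^sub>R h t)"
      using h by (simp add: set_integrable_def)
    fix u v :: real assume "u < v"
    have "(LINT t:{u<..<v}|lebesgue. indicator {s<..<r} t *\<^sub>R h t) = (LINT t:{max s u<..<min r v}|lebesgue. h t)"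
      unfolding set_lebesgue_integral_def
      by (intro Bochner_Integration.integral_cong) (auto simp: indicator_def)
    also have "\<dots> = 0"
      using zero[of "max s u" "min r v"] by (cases "max s u < min r v") (auto simp: set_lebesgue_integral_def)
    finally show "(LINT t:{u<..<v}|lebesgue. indicator {s<..<r} t *\<^sub>R h t) = 0" .
  qed
  then show ?thesis by eventually_elim (auto simp: indicator_def)
qed

section \<open>Stone's formula and the expansion\<close>

context star_network
begin

lemma Om_real: "of_real t \<in> Om \<longleftrightarrow> t \<notin> range a"
  by (auto simp: Om_def)

text \<open>Stieltjes inversion applies to positive measures, hence to quadratic form values. The
  Poisson integral of the spectral measure of \<open>f\<close> is \<open>e\<close> times the square
  norm of the resolvent \<open>u\<close>, which is \<open>Im (u, f)\<close>, and \<open>q\<close>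
  expresses that scalar product through \<open>G\<close>, continuously down to the real
  axis.\<close>

lemma Stone_quadratic:
  fixes \<zeta> :: complex and j k :: 'n and b b' :: real
  assumes res: "resolution_of_identity (dom_A c) (op_A c a) E"
    and sr: "s < r" "\<And>k. a k \<notin> {s..r}" and b: "0 \<le> b" "0 \<le> b'"
  defines "q \<equiv> (\<lambda>z. \<zeta> * cnj \<zeta> * G z j b j b + \<zeta> * G z j b k b' + cnj \<zeta> * G z k b' j b + G z k b' k b')"
  shows "Re (inner_H (E {s<..<r} (comb \<zeta> (chi j b) (chi k b'))) (comb \<zeta> (chi j b) (chi k b'))) =
    integral {s..r} (\<lambda>t. Im (q (of_real t))) / pi"
proof -
  interpret spectral_operator E "dom_A c" "op_A c a" by (rule spectral_operator_A[OF res])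
  define f where "f = comb \<zeta> (chi j b) (chi k b')"
  have f: "f \<in> space_H" unfolding f_def by (intro space_H_comb chi_space)
  \<comment> \<open>The real axis is approached from below, the side on which the kernel extends
    continuously and \<open>Im (u, f)\<close> is nonnegative.\<close>
  define z where "z t e = complex_of_real t - \<i> * of_real e" for t e
  have zO: "z t e \<in> Om" if "t \<in> {s..r}" "0 \<le> e" for t e
    using sr(2) that by (auto simp: Om_def z_def complex_eq_iff)
  define u where "u t e = comb \<zeta> (Res (z t e) j b) (Res (z t e) k b')" for t e
  have key: "u t e \<in> dom_A c" "eq_H f (\<lambda>l x. z t e * u t e l x - op_A c a (u t e) l x)"
      "inner_H (u t e) f = q (z t e)" if e: "0 < e" for t e
  proof -
    have Im: "Im (z t e) < 0" using e by (simp add: z_def)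
    note R1 = Res_resolvent[OF Im b(1), of j] and R2 = Res_resolvent[OF Im b(2), of k]
    show dom: "u t e \<in> dom_A c" unfolding u_def by (intro dom_A_comb R1 R2)
    show "eq_H f (\<lambda>l x. z t e * u t e l x - op_A c a (u t e) l x)"
      unfolding eq_H_def
    proof
      fix l
      show "AE x in branch. f l x = z t e * u t e l x - op_A c a (u t e) l x"
        using R1(2)[unfolded eq_H_def, rule_format, of l] R2(2)[unfolded eq_H_def, rule_format, of l]
          op_A_comb[OF R1(1) R2(1), of a \<zeta>, unfolded eq_H_def, rule_format, of l]
      proof eventually_elim
        case (elim x)
        show ?case unfolding f_def u_def elim(1) elim(2) elim(3) by (simp add: algebra_simps)
      qed
    qed
    have sp: "Res (z t e) j b \<in> space_H" "Res (z t e) k b' \<in> space_H"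
      using R1 R2 by (auto intro: dom_A_space)
    show "inner_H (u t e) f = q (z t e)"
      unfolding u_def f_def q_def inner_H_comb_left[OF sp space_H_comb[OF chi_space chi_space]]
        inner_H_comb_right[OF chi_space chi_space sp(1)] inner_H_comb_right[OF chi_space chi_space sp(2)]
        inner_Res[OF Im b(1)] inner_Res[OF Im b(2)]
      by (simp add: algebra_simps)
  qed
  have Imq: "Im (q (z t e)) = e * Re (inner_H (u t e) (u t e))" if "0 < e" for t e
    using Im_inner_resolvent[OF key(1)[OF that] f key(2)[OF that], of t] key(3)[OF that, of t]
    by (simp add: z_def)
  have "measure (spectral_measure E f) {s<..<r} = integral {s..r} (\<lambda>t. Im (q (z t 0))) / pi"
  proof (rule measure_Stieltjes_inversion[OF finite_spectral_measure[OF f] sets_spectral_measure sr(1)])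
    fix t e :: real assume e: "0 < e"
    show "0 \<le> Im (q (z t e))" using e by (simp add: Imq inner_H_self(2))
    have sq: "(cmod (z t e - of_real x))\<^sup>2 = (t - x)\<^sup>2 + e\<^sup>2" for x
      by (simp add: cmod_power2 z_def)
    have "(\<integral>\<^sup>+x. ennreal (e / ((t - x)\<^sup>2 + e\<^sup>2)) \<partial>spectral_measure E f) =
        (\<integral>\<^sup>+x. ennreal e * ennreal (1 / (cmod (z t e - of_real x))\<^sup>2) \<partial>spectral_measure E f)"
      using e unfolding sq by (intro nn_integral_cong) (simp flip: ennreal_mult)
    also have "\<dots> = ennreal e * (\<integral>\<^sup>+x. ennreal (1 / (cmod (z t e - of_real x))\<^sup>2) \<partial>spectral_measure E f)"
      by (rule nn_integral_cmult) measurable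
    also have "\<dots> = ennreal e * ennreal (Re (inner_H (u t e) (u t e)))"
      using e nn_integral_resolvent[OF key(1)[OF e] _ f key(2)[OF e]] by (simp add: z_def)
    also have "\<dots> = ennreal (Im (q (z t e)))"
      using e by (simp add: Imq inner_H_self(2) flip: ennreal_mult)
    finally show "(\<integral>\<^sup>+x. ennreal (e / ((t - x)\<^sup>2 + e\<^sup>2)) \<partial>spectral_measure E f) = ennreal (Im (q (z t e)))" .
  next
    have "continuous_on ({s..r} \<times> {0..1}) (\<lambda>p. q (z (fst p) (snd p)))"
      unfolding q_def
      by (intro continuous_intros continuous_on_G) (auto simp: z_def[abs_def] intro!: continuous_intros zO[unfolded z_def])
    then show "continuous_on ({s..r} \<times> {0..1}) (\<lambda>(t, e). Im (q (z t e)))"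
      unfolding split_beta by (intro continuous_intros)
  qed
  then show ?thesis
    using f by (simp add: measure_spectral_measure z_def f_def)
qed

text \<open>Polarization with the four units. \<open>G\<close> is symmetric without a conjugation,
  so \<open>1\<close> and \<open>-1\<close> give four times \<open>Im G\<close> while
  \<open>i\<close> and \<open>-i\<close> give equal values: the matrix element is real.\<close>

lemma Stone:
  assumes res: "resolution_of_identity (dom_A c) (op_A c a) E"
    and sr: "s < r" "\<And>k. a k \<notin> {s..r}" and b: "0 \<le> b" "0 \<le> b'"
  shows "inner_H (E {s<..<r} (chi j b)) (chi k b') = of_real (integral {s..r} (\<lambda>t. Im (G (of_real t) j b k b')) / pi)"
proof -
  interpret spectral_operator E "dom_A c" "op_A c a" by (rule spectral_operator_A[OF res])
  define e where "e = inner_H (E {s<..<r} (chi j b)) (chi k b')"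
  define J where "J \<zeta> = integral {s..r} (\<lambda>t. Im (\<zeta> * cnj \<zeta> * G (of_real t) j b j b + \<zeta> * G (of_real t) j b k b' +
      cnj \<zeta> * G (of_real t) k b' j b + G (of_real t) k b' k b'))" for \<zeta>
  have N: "(cmod \<zeta>)\<^sup>2 * N {s<..<r} (chi j b) + 2 * Re (\<zeta> * e) + N {s<..<r} (chi k b') = J \<zeta> / pi" for \<zeta>
    using N_comb[of "{s<..<r}" "chi j b" "chi k b'" \<zeta>] Stone_quadratic[OF res sr b, of \<zeta> j k]
    by (simp add: chi_space e_def J_def del: times_complex.sel plus_complex.sel)
  have G_cont: "continuous_on {s..r} (\<lambda>t. G (of_real t) i b1 l b2)" for i b1 l b2
    by (rule continuous_on_G) (use sr(2) in \<open>auto simp: Om_real intro!: continuous_intros\<close>)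
  have int: "(\<lambda>t. Im (\<zeta> * cnj \<zeta> * G (of_real t) j b j b + \<zeta> * G (of_real t) j b k b' +
      cnj \<zeta> * G (of_real t) k b' j b + G (of_real t) k b' k b')) integrable_on {s..r}" for \<zeta>
    by (intro integrable_continuous_interval continuous_intros G_cont)
  have com: "G (of_real t) k b' j b = G (of_real t) j b k b'" if "t \<in> {s..r}" for t
    using sr(2) that by (intro G_commute) (auto simp: Om_real)
  have "J 1 - J (- 1) = integral {s..r} (\<lambda>t. 4 * Im (G (of_real t) j b k b'))"
    unfolding J_def by (subst integral_diff[symmetric, OF int int]) (rule integral_cong, simp add: com)
  then have 1: "J 1 - J (- 1) = 4 * integral {s..r} (\<lambda>t. Im (G (of_real t) j b k b'))" by simp
  have "J \<i> - J (- \<i>) = integral {s..r} (\<lambda>t. 0)"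
    unfolding J_def by (subst integral_diff[symmetric, OF int int]) (rule integral_cong, simp add: com)
  then have 2: "J \<i> - J (- \<i>) = 0" by simp
  have "Re e = integral {s..r} (\<lambda>t. Im (G (of_real t) j b k b')) / pi"
    using N[of 1] N[of "- 1"] 1 by (simp add: field_simps)
  moreover have "Im e = 0" using N[of \<i>] N[of "- \<i>"] 2 by (simp add: field_simps)
  ultimately show ?thesis by (simp add: complex_eq_iff e_def)
qed

definition expansion_density :: "(real \<Rightarrow> ((complex, 'n) vec, 'n) vec) \<Rightarrow> 'n \<Rightarrow> real \<Rightarrow> 'n \<Rightarrow> real \<Rightarrow> real \<Rightarrow> complex" where
  "expansion_density q j b k x t =
     (\<Sum>l\<in>UNIV. \<Sum>m\<in>UNIV. q t $ l $ m * F c a l (of_real t) k x * coefficient c a m t (chi j b))"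

text \<open>Stone's formula determines only the integrals of \<open>g k\<close> over the intervals
  \<open>[0, b']\<close>. Both \<open>g k\<close> and the explicit candidate \<open>h\<close> are
  continuous, so equal integrals give equality at every point, after two exchanges of integration
  order.\<close>

lemma expansion_integral:
  assumes res: "resolution_of_identity (dom_A c) (op_A c a) E"
    and ex: "expansion_matrix c a E q"
    and sr: "a first \<le> s" "s < r" "\<And>k. a k \<notin> {s..r}" and b: "0 \<le> b" and x: "0 \<le> x"
  shows "set_integrable lebesgue {s<..<r} (expansion_density q j b k x)"
    and "(LINT t:{s<..<r}|lebesgue. expansion_density q j b k x t) =
      of_real (integral {s..r} (\<lambda>t. Im (integral {0..b} (\<lambda>y. K (of_real t) j y k x))) / pi)"
proof -
  interpret spectral_operator E "dom_A c" "op_A c a" by (rule spectral_operator_A[OF res])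
  obtain g where g: "eq_H g (E {s<..<r} (chi j b))" "\<And>k. continuous_on {0..} (g k)"
    and gx: "\<And>k x. 0 \<le> x \<Longrightarrow> set_integrable lebesgue {s<..<r} (expansion_density q j b k x) \<and>
      g k x = (LINT t:{s<..<r}|lebesgue. expansion_density q j b k x t)"
    using ex sr chi_space compact_support_chi unfolding expansion_matrix_def expansion_density_def[abs_def] by blast
  show "set_integrable lebesgue {s<..<r} (expansion_density q j b k x)" using gx[OF x] by blast
  define H where "H x t = integral {0..b} (\<lambda>y. K (of_real t) j y k x)" for x t
  define h where "h x = complex_of_real (integral {s..r} (\<lambda>t. Im (H x t)) / pi)" for x
  have EH: "E {s<..<r} (chi j b) \<in> space_H" by (intro E_space chi_space) auto
  \<comment> \<open>\<open>eq_H\<close> compares values only; measurability of the representative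
    comes from its continuity.\<close>
  have gH: "g \<in> space_H"
    unfolding space_H_def mem_Collect_eq
  proof
    fix k
    have L: "E {s<..<r} (chi j b) k \<in> L2_branch" using EH by (rule space_H_L2)
    have ae: "AE x in branch. g k x = E {s<..<r} (chi j b) k x" using g(1) by (simp add: eq_H_def)
    have "continuous_on {0<..} (g k)" using g(2) by (rule continuous_on_subset) auto
    then have m: "g k \<in> borel_measurable branch"
      by (rule continuous_imp_measurable_on_sets_lebesgue) simp
    have "integrable branch (\<lambda>x. (cmod (g k x))\<^sup>2)"
      by (rule integrable_cong_AE_imp[OF L2_branchD(2)[OF L]])
        (use m ae in \<open>auto elim: eventually_mono\<close>)
    with m show "g k \<in> L2_branch" by (simp add: L2_branch_def)
  qed
  have H_cont: "continuous_on ({0..} \<times> {s..r}) (\<lambda>(x, t). H x t)"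
    unfolding H_def split_beta
    by (intro continuous_on_inner_integral) (use sr(3) in \<open>auto simp: Om_real intro!: continuous_intros\<close>)
  have h_cont: "continuous_on {0..} h"
  proof -
    have "continuous_on ({0..} \<times> cbox s r) (\<lambda>(x, t). Im (H x t))"
      using H_cont unfolding split_beta by (auto intro!: continuous_intros)
    from integral_continuous_on_param[OF this] show ?thesis
      unfolding h_def by (auto intro!: continuous_intros)
  qed
  have int_eq: "integral {0..b'} (g k) = integral {0..b'} h" if b': "0 \<le> b'" for b'
  proof -
    have "integral {0..b'} (g k) = inner_H g (chi k b')" by (rule inner_chi[symmetric, OF g(2)])
    also have "\<dots> = inner_H (E {s<..<r} (chi j b)) (chi k b')"
      by (rule inner_H_cong[OF g(1) gH EH chi_space])
    also have "\<dots> = of_real (integral {s..r} (\<lambda>t. Im (integral {0..b'} (\<lambda>x. H x t))) / pi)"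
      using Stone[OF res sr(2,3) b b', of j k] by (simp add: G_def H_def)
    also have "integral {s..r} (\<lambda>t. Im (integral {0..b'} (\<lambda>x. H x t))) =
        integral {s..r} (\<lambda>t. integral {0..b'} (\<lambda>x. Im (H x t)))"
    proof (rule integral_cong)
      fix t assume t: "t \<in> {s..r}"
      have "continuous_on {0..b'} (\<lambda>x. (\<lambda>(x, t). H x t) (x, t))"
        by (rule continuous_on_compose2[OF H_cont]) (use t in \<open>auto intro!: continuous_intros\<close>)
      then have "(\<lambda>x. H x t) integrable_on {0..b'}" by (intro integrable_continuous_interval) simp
      then show "Im (integral {0..b'} (\<lambda>x. H x t)) = integral {0..b'} (\<lambda>x. Im (H x t))"
        using integral_linear[OF _ bounded_linear_Im, of "\<lambda>x. H x t" "{0..b'}"] by (simp add: o_def)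
    qed
    also have "\<dots> = integral {0..b'} (\<lambda>x. integral {s..r} (\<lambda>t. Im (H x t)))"
    proof -
      have "continuous_on (cbox (0, s) (b', r)) (\<lambda>p. Im ((\<lambda>(x, t). H x t) p))"
        by (intro continuous_intros continuous_on_subset[OF H_cont]) (auto simp: cbox_Pair_eq)
      then have "continuous_on (cbox (0, s) (b', r)) (\<lambda>(x, t). Im (H x t))"
        by (simp add: split_beta)
      from integral_swap_continuous[OF this] show ?thesis by simp
    qed
    also have "complex_of_real (integral {0..b'} (\<lambda>x. integral {s..r} (\<lambda>t. Im (H x t))) / pi) = integral {0..b'} h"
    proof -
      have "h = (\<lambda>x. of_real (integral {s..r} (\<lambda>t. Im (H x t)) / pi))" by (simp add: h_def fun_eq_iff)
      moreover have "(\<lambda>x. integral {s..r} (\<lambda>t. Im (H x t))) integrable_on {0..b'}"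
      proof -
        have "continuous_on {0..b'} (\<lambda>x. pi * Re (h x))"
          by (intro continuous_intros continuous_on_subset[OF h_cont]) auto
        then show ?thesis by (intro integrable_continuous_interval) (simp add: h_def)
      qed
      ultimately show ?thesis
        using integral_linear[of "\<lambda>x. integral {s..r} (\<lambda>t. Im (H x t)) / pi" "{0..b'}" complex_of_real]
        by (simp add: o_def bounded_linear_of_real integrable_on_divide)
    qed
    finally show ?thesis .
  qed
  have "g k x - h x = 0"
  proof (rule integral_zero_rational_imp_zero[OF _ _ x])
    show "continuous_on {0..} (\<lambda>x. g k x - h x)" by (intro continuous_intros g(2) h_cont)
    fix b' :: real assume b': "0 \<le> b'"
    have "integral {0..b'} (\<lambda>x. g k x - h x) = integral {0..b'} (g k) - integral {0..b'} h"
      by (intro integral_diff integrable_continuous_interval continuous_on_subset[OF g(2)] continuous_on_subset[OF h_cont]) auto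
    then show "integral {0..b'} (\<lambda>x. g k x - h x) = 0" using int_eq[OF b'] by simp
  qed
  then have "g k x = h x" by simp
  with gx[OF x] show "(LINT t:{s<..<r}|lebesgue. expansion_density q j b k x t) =
      of_real (integral {s..r} (\<lambda>t. Im (integral {0..b} (\<lambda>y. K (of_real t) j y k x))) / pi)"
    by (simp add: h_def H_def)
qed

text \<open>The preceding identity holds for every subinterval of \<open>(s, r)\<close>, so the
  integrands agree almost everywhere. The exceptional set still depends on \<open>j\<close>,
  \<open>k\<close>, \<open>b\<close> and \<open>x\<close>.\<close>

lemma AE_density_interval:
  assumes res: "resolution_of_identity (dom_A c) (op_A c a) E"
    and ex: "expansion_matrix c a E q"
    and sr: "a first \<le> s" "s < r" "\<And>k. a k \<notin> {s..r}" and b: "0 \<le> b" and x: "0 \<le> x"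
  shows "AE t in lebesgue. t \<in> {s<..<r} \<longrightarrow>
    expansion_density q j b k x t = of_real (Im (integral {0..b} (\<lambda>y. K (of_real t) j y k x)) / pi)"
proof -
  define H where "H t = complex_of_real (Im (integral {0..b} (\<lambda>y. K (of_real t) j y k x)) / pi)" for t
  note I = expansion_integral[OF res ex _ _ _ b x, of _ _ j k]
  have H_cont: "continuous_on {s..r} H"
    unfolding H_def
    by (intro continuous_intros continuous_on_inner_integral) (use sr(3) in \<open>auto simp: Om_real intro!: continuous_intros\<close>)
  have H_int: "set_integrable lebesgue {u<..<v} H" "(LINT t:{u<..<v}|lebesgue. H t) =
      of_real (integral {u..v} (\<lambda>t. Im (integral {0..b} (\<lambda>y. K (of_real t) j y k x))) / pi)"
    if "s \<le> u" "v \<le> r" for u v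
  proof -
    have c: "continuous_on {u..v} H" using H_cont that by (auto intro: continuous_on_subset)
    then have "set_integrable lborel {u..v} H" by (rule borel_integrable_atLeastAtMost')
    then have i: "set_integrable lborel {u<..<v} H" by (rule set_integrable_subset) auto
    then show si: "set_integrable lebesgue {u<..<v} H"
      unfolding set_integrable_def by (simp add: integrable_completion)
    have "(LINT t:{u<..<v}|lebesgue. H t) = (LINT t:{u<..<v}|lborel. H t)"
      using i unfolding set_integrable_def set_lebesgue_integral_def
      by (intro integral_completion) (rule borel_measurable_integrable)
    also have "\<dots> = integral {u<..<v} H" by (rule set_borel_integral_eq_integral(2)[OF i])
    also have "\<dots> = integral {u..v} H" by (rule integral_open_interval_real[symmetric])
    also have "\<dots> = of_real (integral {u..v} (\<lambda>t. Im (integral {0..b} (\<lambda>y. K (of_real t) j y k x))) / pi)"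
    proof -
      have "continuous_on {u..v} (\<lambda>t. Re (H t))" by (intro continuous_intros c)
      then have "(\<lambda>t. Im (integral {0..b} (\<lambda>y. K (of_real t) j y k x)) / pi) integrable_on {u..v}"
        by (intro integrable_continuous_interval) (simp add: H_def)
      from integral_linear[OF this bounded_linear_of_real[where 'a=complex]]
      show ?thesis by (simp add: H_def[abs_def] o_def)
    qed
    finally show "(LINT t:{u<..<v}|lebesgue. H t) =
      of_real (integral {u..v} (\<lambda>t. Im (integral {0..b} (\<lambda>y. K (of_real t) j y k x))) / pi)" .
  qed
  have "AE t in lebesgue. t \<in> {s<..<r} \<longrightarrow> expansion_density q j b k x t - H t = 0"
  proof (rule AE_zero_on_interval)
    show "set_integrable lebesgue {s<..<r} (\<lambda>t. expansion_density q j b k x t - H t)"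
      using sr by (intro set_integral_diff I H_int) auto
    fix u v assume uv: "s \<le> u" "u < v" "v \<le> r"
    have "a k \<notin> {u..v}" for k using sr(3)[of k] uv by auto
    then show "(LINT t:{u<..<v}|lebesgue. expansion_density q j b k x t - H t) = 0"
      using I[of u v] H_int[of u v] uv sr by (subst set_integral_diff) auto
  qed
  then show ?thesis by eventually_elim (simp add: H_def)
qed

text \<open>One null set serves all \<open>y\<close>: the intervals and end points \<open>b\<close>
  are restricted to rationals, \<open>x\<close> is fixed to one point per branch, and the integral
  over \<open>[0, b]\<close> is removed by continuity in \<open>y\<close>.\<close>

lemma AE_kernel:
  assumes res: "resolution_of_identity (dom_A c) (op_A c a) E"
    and ex: "expansion_matrix c a E q" and p: "\<And>k. 0 \<le> p k"
  shows "AE t in lebesgue. a first < t \<longrightarrow> (\<forall>j k. \<forall>y\<ge>0.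
    (\<Sum>l\<in>UNIV. \<Sum>m\<in>UNIV. q t $ l $ m * F c a l (of_real t) k (p k) * cnj (F c a m (of_real t) j y)) =
    of_real (Im (K (of_real t) j y k (p k)) / pi))"
proof -
  define X where "X = {(s, r). s \<in> \<rat> \<and> r \<in> \<rat> \<and> a first \<le> s \<and> s < r \<and> (\<forall>k. a k \<notin> {s..r})}"
  define Y where "Y = {b. b \<in> \<rat> \<and> (0::real) \<le> b}"
  have "countable X" by (rule countable_subset[of _ "\<rat> \<times> \<rat>"]) (auto simp: X_def countable_rat)
  have "countable Y" by (rule countable_subset[of _ "\<rat>"]) (auto simp: Y_def countable_rat)
  have "AE t in lebesgue. \<forall>sr\<in>X. \<forall>b\<in>Y. \<forall>j\<in>UNIV. \<forall>k\<in>UNIV. t \<in> {fst sr<..<snd sr} \<longrightarrow>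
      expansion_density q j b k (p k) t = of_real (Im (integral {0..b} (\<lambda>y. K (of_real t) j y k (p k))) / pi)"
    unfolding AE_ball_countable[OF \<open>countable X\<close>] AE_ball_countable[OF \<open>countable Y\<close>]
      AE_ball_countable[OF countable_finite[OF finite]]
    by (intro ballI AE_density_interval[OF res ex _ _ _ _ p]) (auto simp: X_def Y_def)
  moreover have "AE t in lebesgue. t \<notin> range a"
    by (intro AE_not_in null_sets_completionI finite_imp_null_set_lborel) auto
  ultimately show ?thesis
  proof eventually_elim
    case (elim t)
    show ?case
    proof (intro impI allI)
      fix j k :: 'n and y :: real assume t: "a first < t" and y: "0 \<le> y"
      \<comment> \<open>Produces a rational interval around \<open>t\<close> that stays to the right
        of \<open>a first\<close> and avoids all branch points, hence a member of
        \<open>X\<close>.\<close>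
      have "open (- range a \<inter> {a first<..})" by (intro open_Int open_Compl finite_imp_closed) auto
      then obtain e where e: "0 < e" "ball t e \<subseteq> - range a \<inter> {a first<..}"
        using t elim(2) open_contains_ball by blast
      obtain s where s: "s \<in> \<rat>" "t - e < s" "s < t" using Rats_dense_in_real[of "t - e" t] e by auto
      obtain r where r: "r \<in> \<rat>" "t < r" "r < t + e" using Rats_dense_in_real[of t "t + e"] e by auto
      have sub: "{s..r} \<subseteq> ball t e" using s r by (auto simp: dist_real_def)
      then have "{s..r} \<subseteq> - range a \<inter> {a first<..}" using e(2) by (rule order_trans)
      moreover have "s \<in> {s..r}" using s r by simp
      ultimately have "s \<in> - range a \<inter> {a first<..}" "\<And>k. a k \<notin> {s..r}" by blast+
      then have X: "(s, r) \<in> X" using s r by (auto simp: X_def)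
      have tO: "of_real t \<in> Om" using elim(2) by (simp add: Om_real)
      let ?g = "\<lambda>y. (\<Sum>l\<in>UNIV. \<Sum>m\<in>UNIV. q t $ l $ m * F c a l (of_real t) k (p k) * cnj (F c a m (of_real t) j y))"
      let ?h = "\<lambda>y. complex_of_real (Im (K (of_real t) j y k (p k)) / pi)"
      have F_cont: "continuous_on S (\<lambda>y. F c a m (of_real t) j y)" for m S
        using tO by (intro continuous_on_F continuous_intros) auto
      have K_cont: "continuous_on S (\<lambda>y. K (of_real t) j y k (p k))" for S
        using tO by (intro continuous_on_K continuous_intros) auto
      have g_cont: "continuous_on S ?g" and h_cont: "continuous_on S ?h" for S
        by (intro continuous_intros F_cont K_cont; simp)+
      have "?g y - ?h y = 0"
      proof (rule integral_zero_rational_imp_zero[OF _ _ y])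
        show "continuous_on {0..} (\<lambda>y. ?g y - ?h y)" by (intro continuous_on_diff g_cont h_cont)
        fix b :: real assume b: "b \<in> \<rat>" "0 \<le> b"
        have "coefficient c a m t (chi j b) = integral {0..b} (\<lambda>y. cnj (F c a m (of_real t) j y))" for m
        proof -
          have "coefficient c a m t (chi j b) = (\<Sum>i\<in>UNIV. if i = j
              then LINT y|branch. cnj (F c a m (of_real t) j y) * chi j b j y else 0)"
            unfolding coefficient_def by (intro sum.cong refl) (auto simp: chi_def intro!: arg_cong[where f="integral\<^sup>L _"])
          also have "\<dots> = integral {0..b} (\<lambda>y. cnj (F c a m (of_real t) j y))"
            using integral_chi(2)[of b "\<lambda>y. cnj (F c a m (of_real t) j y)" j] F_cont by (simp add: continuous_on_cnj)
          finally show ?thesis .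
        qed
        then have "integral {0..b} ?g = expansion_density q j b k (p k) t"
          unfolding expansion_density_def
          by (simp add: integral_sum integrable_continuous_interval F_cont continuous_on_cnj integrable_sum integrable_on_mult_right)
        also have "\<dots> = of_real (Im (integral {0..b} (\<lambda>y. K (of_real t) j y k (p k))) / pi)"
          using elim(1)[rule_format, OF X, of b j k] s r b by (simp add: Y_def)
        also have "\<dots> = integral {0..b} ?h"
        proof -
          have i: "(\<lambda>y. K (of_real t) j y k (p k)) integrable_on {0..b}"
            by (intro integrable_continuous_interval K_cont)
          have "bounded_linear (\<lambda>z. complex_of_real (Im z / pi))"
            by (intro bounded_linear_compose[OF bounded_linear_of_real] bounded_linear_compose[OF bounded_linear_divide] bounded_linear_Im)
          from integral_linear[OF i this] show ?thesis by (simp add: o_def)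
        qed
        finally show "integral {0..b} (\<lambda>y. ?g y - ?h y) = 0"
          by (subst integral_diff[OF integrable_continuous_interval[OF g_cont] integrable_continuous_interval[OF h_cont]]) simp
      qed
      then show "?g y = ?h y" by simp
    qed
  qed
qed

end

section \<open>Solving for the matrix\<close>

lemma matrix_inv_mult:
  fixes A :: "'a::field^'n^'n"
  assumes "invertible A"
  shows "A ** matrix_inv A = mat 1" "matrix_inv A ** A = mat 1"
  using someI_ex[of "\<lambda>B. A ** B = mat 1 \<and> B ** A = mat 1"] assms
  by (simp_all add: invertible_def matrix_inv_def)

lemma cnj_mat_mult: "cnj_mat (A ** B) = cnj_mat A ** cnj_mat B"
  by (simp add: cnj_mat_def matrix_matrix_mult_def vec_eq_iff)

lemma invertible_cnj_mat:
  fixes A :: "complex^'n^'n"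
  assumes "invertible A"
  shows "invertible (cnj_mat A)"
proof -
  have one: "cnj_mat (mat 1) = mat 1" by (simp add: cnj_mat_def mat_def vec_eq_iff)
  show ?thesis
    unfolding invertible_right_inverse
    using cnj_mat_mult[of A "matrix_inv A"] matrix_inv_mult(1)[OF assms] one by metis
qed

lemma matrix_congruence_solve:
  fixes D Q M :: "complex^'n^'n"
  assumes D: "invertible D" and eq: "transpose D ** Q ** cnj_mat D = r *\<^sub>R M"
  shows "Q = r *\<^sub>R (transpose (matrix_inv D) ** M ** matrix_inv (cnj_mat D))"
proof -
  have T: "transpose (matrix_inv D) ** transpose D = mat 1"
    by (simp add: matrix_transpose_mul[symmetric] matrix_inv_mult[OF D] transpose_mat)
  have C: "cnj_mat D ** matrix_inv (cnj_mat D) = mat 1"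
    by (rule matrix_inv_mult[OF invertible_cnj_mat[OF D]])
  have "Q = (transpose (matrix_inv D) ** transpose D) ** Q ** (cnj_mat D ** matrix_inv (cnj_mat D))"
    by (simp add: T C)
  also have "\<dots> = transpose (matrix_inv D) ** (transpose D ** Q ** cnj_mat D) ** matrix_inv (cnj_mat D)"
    by (simp add: matrix_mul_assoc)
  also have "\<dots> = transpose (matrix_inv D) ** (r *\<^sub>R M) ** matrix_inv (cnj_mat D)"
    by (simp add: eq)
  also have "\<dots> = r *\<^sub>R (transpose (matrix_inv D) ** M ** matrix_inv (cnj_mat D))"
    by (simp add: vec_eq_iff matrix_matrix_mult_def scaleR_sum_right sum_distrib_right)
  finally show ?thesis .
qed

text \<open>The scalar \<open>d_j^T e_{j+1}\<close> in the first formula must be an off-diagonal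
  entry of \<open>d_j\<close>, so that it equals \<open>alpha\<close>; this is where at least two
  branches are required.\<close>

lemma cyclic_next_neq:
  fixes j :: "'n::{finite,linorder}"
  assumes "2 \<le> CARD('n)"
  shows "cyclic_next j \<noteq> j"
proof (cases "j = Max UNIV")
  case True
  have "Min UNIV \<noteq> (Max UNIV :: 'n)"
  proof
    assume eq: "Min UNIV = (Max UNIV :: 'n)"
    have "k = Min UNIV" for k :: 'n
    proof (rule antisym)
      show "k \<le> Min UNIV" unfolding eq by (rule Max_ge) auto
      show "Min UNIV \<le> k" by (rule Min_le) auto
    qed
    then have "(UNIV :: 'n set) \<subseteq> {Min UNIV}" by blast
    from card_mono[OF _ this] assms show False by simp
  qed
  then show ?thesis using True by (simp add: cyclic_next_def)
next
  case False
  have "j < Max UNIV" using False Max_ge[of UNIV j] by (simp add: order_less_le)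
  then have "{k. j < k} \<noteq> {}" by blast
  then have "Min {k. j < k} \<in> {k. j < k}" by (intro Min_in) auto
  then show ?thesis using False by (simp add: cyclic_next_def)
qed

lemma column_row_nth:
  "((columnvector u :: ((complex, 1) vec, 'n::finite) vec) ** (rowvector v :: ((complex, 'm::finite) vec, 1) vec)) $ i $ m = u $ i * v $ m"
proof -
  show ?thesis by (simp add: matrix_matrix_mult_def columnvector_def rowvector_def)
qed

text \<open>The outer unit vectors pick out and reinsert row \<open>j\<close> of \<open>D\<close>,
  and the inner product with \<open>e_l\<close> is a scalar. Summed over \<open>j\<close>, the
  products form a diagonal matrix times \<open>D\<close>.\<close>

lemma selector_product:
  fixes D :: "((complex, 'n::finite) vec, 'n) vec"
  shows "((columnvector (axis j 1) :: ((complex, 1) vec, 'n) vec) **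
      (rowvector d :: ((complex, 'n) vec, 1) vec) **
      (columnvector (axis l 1) :: ((complex, 1) vec, 'n) vec) **
      (rowvector (axis j 1) :: ((complex, 'n) vec, 1) vec) ** D) $ i $ m = (if i = j then d $ l * D $ j $ m else 0)"
proof -
  let ?X = "(columnvector (axis j 1) :: ((complex, 1) vec, 'n) vec) ** (rowvector d :: ((complex, 'n) vec, 1) vec)"
  let ?e = "columnvector (axis l 1) :: ((complex, 1) vec, 'n) vec"
  let ?r = "rowvector (axis j 1) :: ((complex, 'n) vec, 1) vec"
  have 1: "?X ** ?e = columnvector (\<chi> i. axis j 1 $ i * d $ l)"
  proof -
    have "(?X ** ?e) $ i $ k = (\<Sum>m\<in>UNIV. if m = l then axis j 1 $ i * d $ m else 0)" for i k
      unfolding matrix_matrix_mult_def[of ?X] vec_lambda_beta column_row_nth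
      by (intro sum.cong refl) (simp add: columnvector_def axis_def)
    then show ?thesis by (simp add: vec_eq_iff columnvector_def)
  qed
  have "(?X ** ?e ** ?r ** D) $ i $ m = (\<Sum>k\<in>UNIV. if k = j then axis j 1 $ i * d $ l * D $ k $ m else 0)"
    unfolding 1 matrix_matrix_mult_def[of _ D] vec_lambda_beta column_row_nth
    by (intro sum.cong refl) (simp add: axis_def)
  then show ?thesis by (simp add: axis_def)
qed

section \<open>The matrices at the chosen points\<close>

context star_network
begin

definition pt :: "('n \<Rightarrow> real) \<Rightarrow> 'n \<Rightarrow> real" where
  "pt p j = (if j = first then 0 else p j)"

lemma D_mat_nth: "D_mat c a p t $ l $ i = F c a l (of_real t) i (pt p i)"
proof -
  have "D_mat c a p t $ l $ i = (\<Sum>j\<in>UNIV. if j = i then F c a l (of_real t) j (pt p j) else 0)"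
    unfolding D_mat_def sum_component column_row_nth
    by (intro sum.cong refl) (simp add: d_vec_def pt_def axis_def)
  then show ?thesis by simp
qed

lemma F_0: "F c a l z k 0 = 1"
  by (simp add: F_def)

text \<open>Off the diagonal each column of the matrix is constant, so row \<open>l\<close> of a
  kernel equation reads \<open>(beta_l - alpha_l) v_l = - S\<close> with a common \<open>S\<close>.
  The first row, taken at the vertex, gives \<open>S = 0\<close>; the other rows then kill
  \<open>v_l\<close>, and \<open>S\<close> itself reduces to the remaining component.\<close>

lemma invertible_D_mat:
  assumes nr: "\<And>l. l \<noteq> first \<Longrightarrow> F c a l (of_real t) l (p l) \<noteq> exp (- kap l (of_real t) * of_real (p l))"
  shows "invertible (D_mat c a p t)"
  unfolding invertible_left_inverse matrix_left_invertible_ker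
proof (intro allI impI)
  fix v assume v: "D_mat c a p t *v v = 0"
  define \<alpha> where "\<alpha> i = exp (- kap i (of_real t) * of_real (pt p i))" for i
  define S where "S = (\<Sum>i\<in>UNIV. \<alpha> i * v $ i)"
  have eq: "(F c a l (of_real t) l (pt p l) - \<alpha> l) * v $ l = - S" for l
  proof -
    have "0 = (D_mat c a p t *v v) $ l" using v by simp
    also have "\<dots> = (\<Sum>i\<in>UNIV. F c a l (of_real t) i (pt p i) * v $ i)"
      by (simp add: matrix_vector_mult_def D_mat_nth)
    also have "\<dots> = (\<Sum>i\<in>UNIV. \<alpha> i * v $ i + (if i = l then (F c a l (of_real t) l (pt p l) - \<alpha> l) * v $ l else 0))"
      by (intro sum.cong refl) (auto simp: \<alpha>_def F_other algebra_simps)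
    also have "\<dots> = S + (F c a l (of_real t) l (pt p l) - \<alpha> l) * v $ l"
      by (simp add: sum.distrib S_def)
    finally show ?thesis by (simp add: eq_neg_iff_add_eq_0 add.commute)
  qed
  have S0: "S = 0" using eq[of first] by (simp add: pt_def F_0 \<alpha>_def)
  have off: "v $ l = 0" if "l \<noteq> first" for l
    using eq[of l] nr[OF that] that S0 by (simp add: pt_def \<alpha>_def)
  have "S = (\<Sum>i\<in>(UNIV :: 'n set). if i = first then v $ first else 0)"
    unfolding S_def by (intro sum.cong refl) (auto simp: off \<alpha>_def pt_def)
  then have "v $ first = 0" using S0 by simp
  with off show "v = 0" by (simp add: vec_eq_iff) metis
qed

text \<open>Equality means \<open>(1 - s) * (exp (kap * p) - exp (- kap * p)) = 0\<close>. The first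
  factor is nonzero by \<open>jump\<close>, so \<open>kap * p\<close> is an integer multiple of
  \<open>i * pi\<close>; squaring and inserting \<open>kap_square\<close> gives the countable set
  \<open>B\<close>.\<close>

lemma AE_nonresonant:
  assumes p: "\<And>j. j \<noteq> first \<Longrightarrow> 0 < p j"
  shows "AE t in lebesgue. t \<notin> range a \<and>
    (\<forall>l. l \<noteq> first \<longrightarrow> F c a l (of_real t) l (p l) \<noteq> exp (- kap l (of_real t) * of_real (p l)))"
proof -
  define B where "B = range a \<union> (\<Union>l. range (\<lambda>n::int. a l + c l * (of_int n * pi / p l)\<^sup>2))"
  have "countable B" unfolding B_def by (intro countable_Un countable_UN countable_image) (auto intro: countable_finite)
  then have "AE t in lebesgue. t \<notin> B"
    by (intro AE_not_in null_sets_completionI countable_imp_null_set_lborel)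
  then show ?thesis
  proof eventually_elim
    case (elim t)
    have tO: "of_real t \<in> Om" using elim by (auto simp: Om_real B_def)
    have "F c a l (of_real t) l (p l) \<noteq> exp (- kap l (of_real t) * of_real (p l))" if l: "l \<noteq> first" for l
    proof
      define k where "k = kap l (of_real t)"
      define s where "s = s_coeff c a l (of_real t)"
      assume "F c a l (of_real t) l (p l) = exp (- kap l (of_real t) * of_real (p l))"
      then have "(1 - s) * exp (k * of_real (p l)) = (1 - s) * exp (- k * of_real (p l))"
      proof -
        assume "F c a l (of_real t) l (p l) = exp (- kap l (of_real t) * of_real (p l))"
        then have e: "(1 - s) / 2 * exp (k * of_real (p l)) + (1 + s) / 2 * exp (- k * of_real (p l)) = exp (- k * of_real (p l))"
          unfolding F_own k_def s_def .
        have "(1 - s) * exp (k * of_real (p l)) = 2 * ((1 - s) / 2 * exp (k * of_real (p l)) + (1 + s) / 2 * exp (- k * of_real (p l))) -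
            (1 + s) * exp (- k * of_real (p l))"
          by (simp add: add_divide_distrib diff_divide_distrib algebra_simps)
        then show ?thesis unfolding e by (simp add: algebra_simps)
      qed
      moreover have "1 - s \<noteq> 0"
        using jump[OF tO, of l] W_nonzero[OF tO] by (auto simp: s_def)
      ultimately have "exp (k * of_real (p l)) = exp (- k * of_real (p l))" by simp
      then have "exp (k * of_real (p l)) * exp (k * of_real (p l)) = exp (- k * of_real (p l)) * exp (k * of_real (p l))"
        by (rule arg_cong)
      also have "\<dots> = 1" unfolding mult_exp_exp by simp
      finally have "exp (2 * (k * of_real (p l))) = 1" unfolding mult_exp_exp mult_2 .
      then obtain n :: int where "Re (2 * (k * of_real (p l))) = 0" "Im (2 * (k * of_real (p l))) = of_int (2 * n) * pi"
        by (auto simp: exp_eq_1)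
      then have "k * of_real (p l) = \<i> * of_real (of_int n * pi)" by (simp add: complex_eq_iff)
      then have "k\<^sup>2 * of_real ((p l)\<^sup>2) = - complex_of_real ((of_int n * pi)\<^sup>2)"
        unfolding of_real_power power_mult_distrib[symmetric] by (simp add: power_mult_distrib)
      then have "of_real ((a l - t) / c l * (p l)\<^sup>2) = complex_of_real (- ((of_int n * pi)\<^sup>2))"
        unfolding k_def kap_square by simp
      then have "(a l - t) / c l * (p l)\<^sup>2 = - ((of_int n * pi)\<^sup>2)" by (simp only: of_real_eq_iff)
      then have "t = a l + c l * (of_int n * pi / p l)\<^sup>2"
        using c_pos[of l] p[OF l] by (simp add: field_simps power2_eq_square)
      with elim show False by (auto simp: B_def)
    qed
    then show ?case using elim by (auto simp: B_def)
  qed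
qed

text \<open>For \<open>i = j\<close> minimum and maximum coincide, and for distinct branches the
  second exponential is the off-diagonal entry of \<open>D\<close>. The kernel at the chosen points
  is therefore \<open>diag(alpha) D / w\<close>.\<close>

lemma K_at_points:
  "K (of_real t) j (pt p j) i (pt p i) =
    exp (- kap i (of_real t) * of_real (pt p i)) * D_mat c a p t $ i $ j / w c a t"
proof (cases "i = j")
  case True
  show ?thesis unfolding K_def W_real D_mat_nth True by simp
next
  case False
  show ?thesis unfolding K_def W_real D_mat_nth F_other[OF not_sym[OF False]] using False by simp
qed

lemma C_mat_nth: "C_mat c a p t $ i $ j = (if i = j then \<i> * exp (- kap i (of_real t) * of_real (pt p i)) else 0)"
proof -
  show ?thesis unfolding C_mat_def vec_lambda_beta alpha_def kap_def pt_def by auto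
qed

text \<open>Both matrices inside \<open>Im\<close> are \<open>diag(alpha) D / w\<close>: in the
  first the scalar products supply \<open>alpha\<close>, in the second the \<open>i\<close> in
  \<open>C_mat\<close> cancels against \<open>- i\<close>.\<close>

lemma Im_matrices:
  fixes p :: "'n \<Rightarrow> real" and t :: real
  defines "M \<equiv> (\<chi> i j. of_real (Im (K (of_real t) j (pt p j) i (pt p i))))"
  shows "Im_mat (smult_mat (1 / w c a t)
          (\<Sum>j\<in>UNIV. (columnvector (axis j 1) :: ((complex, 1) vec, 'n) vec) **
             (rowvector (d_vec c a p j t) :: ((complex, 'n) vec, 1) vec) **
             (columnvector (axis (cyclic_next j) 1) :: ((complex, 1) vec, 'n) vec) **
             (rowvector (axis j 1) :: ((complex, 'n) vec, 1) vec) ** D_mat c a p t)) = M"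
    and "Im_mat (smult_mat (- \<i> / w c a t) (C_mat c a p t ** D_mat c a p t)) = M"
proof -
  have d: "d_vec c a p j t $ cyclic_next j = exp (- kap j (of_real t) * of_real (pt p j))" for j
    using F_other[OF cyclic_next_neq[OF two, THEN not_sym], of j "of_real t" "pt p j"] by (simp add: d_vec_def pt_def)
  show "Im_mat (smult_mat (1 / w c a t)
          (\<Sum>j\<in>UNIV. (columnvector (axis j 1) :: ((complex, 1) vec, 'n) vec) **
             (rowvector (d_vec c a p j t) :: ((complex, 'n) vec, 1) vec) **
             (columnvector (axis (cyclic_next j) 1) :: ((complex, 1) vec, 'n) vec) **
             (rowvector (axis j 1) :: ((complex, 'n) vec, 1) vec) ** D_mat c a p t)) = M"
    unfolding vec_eq_iff Im_mat_def smult_mat_def nth_map_matrix sum_component selector_product M_def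
    by (simp add: d K_at_points)
  have CD: "(C_mat c a p t ** D_mat c a p t) $ i $ j =
      \<i> * exp (- kap i (of_real t) * of_real (pt p i)) * D_mat c a p t $ i $ j" for i j
    by (simp add: matrix_matrix_mult_def C_mat_nth if_distrib if_distribR cong: if_cong)
  show "Im_mat (smult_mat (- \<i> / w c a t) (C_mat c a p t ** D_mat c a p t)) = M"
    unfolding vec_eq_iff Im_mat_def smult_mat_def nth_map_matrix CD M_def K_at_points
    by (simp add: field_simps)
qed

end

theorem theorem6p1:
  fixes c a p :: "'n::{finite,linorder} \<Rightarrow> real"
    and E :: "real set \<Rightarrow> ('n \<Rightarrow> real \<Rightarrow> complex) \<Rightarrow> 'n \<Rightarrow> real \<Rightarrow> complex"
    and q :: "real \<Rightarrow> ((complex, 'n) vec, 'n) vec"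
  assumes "2 \<le> CARD('n)"
    and "\<And>k. 0 < c k"
    and "0 \<le> a first"
    and "mono a"
    and "resolution_of_identity (dom_A c) (op_A c a) E"
    and "\<And>j. j \<noteq> first \<Longrightarrow> 0 < p j"
    and "expansion_matrix c a E q"
  shows "AE t in lebesgue. a first < t \<longrightarrow>
     invertible (D_mat c a p t) \<and>
     q t = (1 / pi) *\<^sub>R
       (transpose (matrix_inv (D_mat c a p t)) **
        Im_mat (smult_mat (1 / w c a t)
          (\<Sum>j\<in>UNIV. (columnvector (axis j 1) :: ((complex, 1) vec, 'n) vec) **
             (rowvector (d_vec c a p j t) :: ((complex, 'n) vec, 1) vec) **
             (columnvector (axis (cyclic_next j) 1) :: ((complex, 1) vec, 'n) vec) **
             (rowvector (axis j 1) :: ((complex, 'n) vec, 1) vec) ** D_mat c a p t)) **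
        matrix_inv (cnj_mat (D_mat c a p t))) \<and>
     q t = (1 / pi) *\<^sub>R
       (transpose (matrix_inv (D_mat c a p t)) **
        Im_mat (smult_mat (- \<i> / w c a t) (C_mat c a p t ** D_mat c a p t)) **
        matrix_inv (cnj_mat (D_mat c a p t)))"
proof -
  interpret star_network c a
    by unfold_locales (fact assms)+
  have pt: "0 \<le> pt p k" for k using assms(6)[of k] by (simp add: pt_def less_imp_le)
  have nr: "AE t in lebesgue. t \<notin> range a \<and>
      (\<forall>l. l \<noteq> first \<longrightarrow> F c a l (of_real t) l (p l) \<noteq> exp (- kap l (of_real t) * of_real (p l)))"
    by (rule AE_nonresonant) (rule assms(6))
  show ?thesis
    using AE_kernel[OF assms(5,7), of "pt p", OF pt] nr
  proof eventually_elim
    case (elim t)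
    show ?case
    proof
      assume t: "a first < t"
      let ?D = "D_mat c a p t"
      have D: "invertible ?D" using elim(2) by (intro invertible_D_mat) blast
      define M :: "((complex, 'n) vec, 'n) vec"
        where "M = (\<chi> i j. of_real (Im (K (of_real t) j (pt p j) i (pt p i))))"
      have "transpose ?D ** q t ** cnj_mat ?D = (1 / pi) *\<^sub>R M"
        unfolding vec_eq_iff
      proof (intro allI)
        fix i j
        have "(transpose ?D ** q t ** cnj_mat ?D) $ i $ j =
            (\<Sum>m\<in>UNIV. \<Sum>l\<in>UNIV. q t $ l $ m * F c a l (of_real t) i (pt p i) * cnj (F c a m (of_real t) j (pt p j)))"
          unfolding matrix_matrix_mult_def transpose_def cnj_mat_def nth_map_matrix vec_lambda_beta D_mat_nth sum_distrib_right
          by (intro sum.cong refl) simp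
        also have "\<dots> = of_real (Im (K (of_real t) j (pt p j) i (pt p i)) / pi)"
          using elim(1) t pt by (subst sum.swap) blast
        finally show "(transpose ?D ** q t ** cnj_mat ?D) $ i $ j = ((1 / pi) *\<^sub>R M) $ i $ j"
          unfolding vector_scaleR_component M_def vec_lambda_beta by (simp add: scaleR_conv_of_real)
      qed
      note solution = matrix_congruence_solve[OF D this]
      show "invertible ?D \<and>
        q t = (1 / pi) *\<^sub>R
          (transpose (matrix_inv ?D) **
           Im_mat (smult_mat (1 / w c a t)
             (\<Sum>j\<in>UNIV. (columnvector (axis j 1) :: ((complex, 1) vec, 'n) vec) **
                (rowvector (d_vec c a p j t) :: ((complex, 'n) vec, 1) vec) **
                (columnvector (axis (cyclic_next j) 1) :: ((complex, 1) vec, 'n) vec) **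
                (rowvector (axis j 1) :: ((complex, 'n) vec, 1) vec) ** ?D)) **
           matrix_inv (cnj_mat ?D)) \<and>
        q t = (1 / pi) *\<^sub>R
          (transpose (matrix_inv ?D) **
           Im_mat (smult_mat (- \<i> / w c a t) (C_mat c a p t ** ?D)) **
           matrix_inv (cnj_mat ?D))"
        unfolding Im_matrices M_def[symmetric] by (intro conjI D solution)
    qed
  qed
qed

end
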